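(* Let $k\ge 1$ be an integer, let $N$ be a perfect square (a positive integer), and let $f(z)=\sum_{n=1}^{\infty}a_{f}(n)e^{2\pi i n z}\in S_{k+\frac12}(\Gamma_0(4N))$. Assume that the Fourier coefficients $a_f(n)$ are either all real or all purely imaginary. For each choice of sign $\pm$, let $N_0^{\pm}(T)$ denote the number of zeros of odd order of the function $L(s,f)\pm L(s,f|W_{4N})$ of the form $s=\frac{k}{2}+\frac14+it$ with $0\le t\le T$. Then $N_0^{\pm}(T)\gg T$; equivalently, $$\liminf_{T\to\infty}\frac{N_0^{\pm}(T)}{T}>d$$ for some $d>0$.
   Context: $\mathbb{H}=\{w\in\mathbb{C}:\mathrm{Im}(w)>0\}$. The square root $z^{1/2}$ is chosen with $-\frac{\pi}{2}<\arg(z^{1/2})\le\frac{\pi}{2}$, and half-integral powers are $z^{k+1/2}=(z^{1/2})^{2k+1}$. $S_{k+\frac12}(\Gamma_0(4N))$ is the space of cusp forms of weight $k+\frac12$ on $\Gamma_0(4N)$: holomorphic functions $f$ on $\mathbb{H}$, vanishing at all cusps, satisfying $$f\left(\frac{az+b}{cz+d}\right)=\left(\frac{c}{d}\right)^{2k+1}\epsilon_d^{-2k-1}(cz+d)^{k+\frac12}f(z)\quad\text{for all }\begin{pmatrix}a&b\\c&d\end{pmatrix}\in\Gamma_0(4N),$$ where $\left(\frac{c}{d}\right)$ is Shimura's extension of the Jacobi symbol (for odd $d$: the Jacobi symbol $\left(\frac{c}{d}\right)$ if $d>0$; for $d<0$ and $c\neq0$, it is $\left(\frac{c}{|d|}\right)$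 if $c>0$ and $-\left(\frac{c}{|d|}\right)$ if $c<0$; and $\left(\frac{0}{\pm1}\right)=1$), and $\epsilon_d=1$ if $d\equiv1\bmod 4$, $\epsilon_d=i$ if $d\equiv 3\bmod 4$. Such $f$ has a Fourier expansion $f(z)=\sum_{n\ge1}a_f(n)e^{2\pi i n z}$. The Fricke involution on $S_{k+\frac12}(\Gamma_0(4N))$ is $$(f|W_{4N})(z)=i^{k+\frac12}(4N)^{-\frac k2-\frac14}z^{-k-\frac12}f\left(-\frac{1}{4Nz}\right).$$ For a cusp form $g(z)=\sum_{n\ge1}a_g(n)e^{2\pi i nz}$, $L(s,g)=\sum_{n\ge1}a_g(n)n^{-s}$ for $\mathrm{Re}(s)$ large, and $L(s,g)$ also denotes its continuation to an entire function of $s$.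
   Formalization: For the chosen sign it is additionally assumed that L(s,f) ± L(s,f|W_{4N}) is not identically zero; otherwise (e.g. f = 0, or f|W_{4N} = f with the minus sign) zeros of odd order are undefined and the claim fails. *)

theory Defs
  imports
    "HOL-Complex_Analysis.Complex_Analysis"
    "HOL-Number_Theory.Number_Theory"
    "HOL-Computational_Algebra.Nth_Powers"
begin

definition upper_half_plane :: "complex set" where
  "upper_half_plane = {z. Im z > 0}"

text \<open>
  \<open>half_power z m\<close> is $z^{m/2} = (z^{1/2})^m$. The branch of \<^const>\<open>csqrt\<close> is exactly
  $-\pi/2 < \arg(z^{1/2}) \le \pi/2$.
\<close>

definition half_power :: "complex \<Rightarrow> int \<Rightarrow> complex" where
  "half_power z m = csqrt z powi m"

text \<open>The Jacobi symbol; only meaningful for odd positive \<open>n\<close>.\<close>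

definition Jacobi :: "int \<Rightarrow> int \<Rightarrow> int" where
  "Jacobi a n = (\<Prod>p\<in>#prime_factorization n. Legendre a p)"

text \<open>
  Shimura's extension of the Jacobi symbol; only meaningful for odd \<open>d\<close>. For \<open>d < 0\<close>
  and \<open>c = 0\<close> it is only needed at \<open>d = -1\<close>; the last branch then gives the empty
  product \<open>Jacobi 0 1 = 1\<close>.
\<close>

definition shimura_symbol :: "int \<Rightarrow> int \<Rightarrow> int" where
  "shimura_symbol c d =
     (if d > 0 then Jacobi c d
      else if c < 0 then - Jacobi c \<bar>d\<bar>
      else Jacobi c \<bar>d\<bar>)"

definition theta_eps :: "int \<Rightarrow> complex" where
  "theta_eps d = (if [d = 1] (mod 4) then 1 else \<i>)"

definition moebius_act :: "int \<Rightarrow> int \<Rightarrow> int \<Rightarrow> int \<Rightarrow> complex \<Rightarrow> complex" where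
  "moebius_act a b c d z = (of_int a * z + of_int b) / (of_int c * z + of_int d)"

text \<open>
  Cusp forms of weight $k + \frac12$ on $\Gamma_0(M)$ (for \<open>4 dvd M\<close>), as functions on \<^typ>\<open>complex\<close>
  of which only the values on the upper half plane matter. Every cusp is $\gamma\infty$ for some
  $\gamma = (a, b; c, d) \in SL_2(\mathbb{Z})$, and vanishing there means that
  $(cz+d)^{-k-1/2} f(\gamma z)$ tends to $0$ as $\mathrm{Im}\, z \to \infty$, uniformly in
  $\mathrm{Re}\, z$.
\<close>

definition cusp_forms_half :: "nat \<Rightarrow> nat \<Rightarrow> (complex \<Rightarrow> complex) set" where
  "cusp_forms_half k M = {f.
     f holomorphic_on upper_half_plane \<and>
     (\<forall>a b c d :: int. a * d - b * c = 1 \<longrightarrow> int M dvd c \<longrightarrow>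
        (\<forall>z\<in>upper_half_plane.
           f (moebius_act a b c d z) =
             of_int (shimura_symbol c d) ^ (2 * k + 1)
             * theta_eps d powi (- 2 * int k - 1)
             * half_power (of_int c * z + of_int d) (2 * int k + 1) * f z)) \<and>
     (\<forall>a b c d :: int. a * d - b * c = 1 \<longrightarrow>
        ((\<lambda>z. half_power (of_int c * z + of_int d) (- 2 * int k - 1)
              * f (moebius_act a b c d z)) \<longlongrightarrow> 0) (filtercomap Im at_top))}"

text \<open>
  $(f|W_M)(z) = i^{k+1/2} M^{-k/2-1/4} z^{-k-1/2} f(-1/(Mz))$, so that $W_{4N}$ is \<open>fricke k (4 * N)\<close>.
\<close>

definition fricke :: "nat \<Rightarrow> nat \<Rightarrow> (complex \<Rightarrow> complex) \<Rightarrow> complex \<Rightarrow> complex" where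
  "fricke k M f z =
     half_power \<i> (2 * int k + 1)
     * of_real (real M powr (- real k / 2 - 1 / 4))
     * half_power z (- 2 * int k - 1)
     * f (- 1 / (of_nat M * z))"

text \<open>
  The coefficients $a_g(n)$ of $g(z) = \sum_{n\ge1} a_g(n) e^{2\pi i n z}$. They are unique if they
  exist; the value at $0$ is fixed to be $0$ since the expansion starts at $n = 1$.
\<close>

definition fourier_coeff :: "(complex \<Rightarrow> complex) \<Rightarrow> nat \<Rightarrow> complex" where
  "fourier_coeff g = (THE a. a 0 = 0 \<and>
     (\<forall>z\<in>upper_half_plane. (\<lambda>n. a n * exp (2 * of_real pi * \<i> * of_nat n * z)) sums g z))"

text \<open>
  The entire function that agrees with $\sum_{n\ge1} a_g(n) n^{-s}$ for $\mathrm{Re}(s)$ large; it is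
  unique if it exists.
\<close>

definition L_function :: "(complex \<Rightarrow> complex) \<Rightarrow> complex \<Rightarrow> complex" where
  "L_function g = (THE F. F holomorphic_on UNIV \<and>
     (\<exists>\<sigma>::real. \<forall>s. Re s > \<sigma> \<longrightarrow>
        (\<lambda>n. fourier_coeff g (Suc n) * of_nat (Suc n) powr (- s)) sums F s))"

text \<open>
  The number of distinct zeros of odd order of \<open>F\<close> of the form $\sigma + it$ with $0 \le t \le T$.
  Meaningful for an entire \<open>F\<close> that does not vanish identically, in which case the set is finite.
\<close>

definition odd_zero_count :: "(complex \<Rightarrow> complex) \<Rightarrow> real \<Rightarrow> real \<Rightarrow> nat" where
  "odd_zero_count F \<sigma> T =
     card {s. Re s = \<sigma> \<and> 0 \<le> Im s \<and> Im s \<le> T \<and> F s = 0 \<and> odd (zorder F s)}"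

end

(* Put g = f +- f|W, M = 4N, kappa = k + 1/2. Then phi(w) = g(i e^w / sqrt M) e^(kappa w / 2) is holomorphic for
   |Im w| < pi/2 and satisfies phi(-w) = +- phi(w), and the completed L-function of g at kappa/2 + z is the
   two-sided Laplace transform of phi at z. Since the coefficients are all real or all imaginary, its restriction to
   the critical line is a constant times a real function X(t), whose sign changes are zeros of odd order. They are
   counted by the method of Hardy and Littlewood. Moving the line of integration to Im w = theta = pi/2 - 1/T
   multiplies X(t) by e^(theta t), which for t in [T, 3T] cancels the decay of the Gamma factor. The bound
   |g(z)| <= C (Im z)^(-kappa/2), which follows from the vanishing at all cusps, gives
   phi(u + i theta) = O(T^(kappa/2)); by Bessel's inequality the integral of X(t) e^(theta t) over an interval of
   length H is then in mean square smaller by a factor sqrt H than the integral of its absolute value, which is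
   bounded from below by moving the contour to the right, where the first coefficient of the Dirichlet series
   dominates. *)

theory Submission
  imports Defs
begin

section \<open>A lower bound for the Gamma function on vertical lines\<close>

text \<open>The powers of T decide what can be proved. On [T, 3T] the reciprocal Gamma factor at
  real part \<kappa>/2 + b costs T^(1/2 - \<kappa>/2 - b), and cos \<theta> is of order 1/T, so a
  mean square of size (cos \<theta>)^(-\<kappa> - 2b) turns into O(T): F is bounded in mean,
  uniformly in T. This permits intervals of constant length H, hence a count of order T. The
  obstacle is the critical line itself, where the same estimate for |F|^2 would lose a logarithm of
  T. So b is kept positive, where the mean square is O(T/b); the mean of |F| is then O(T b^(-1/2)),
  and this is integrable up to b = 0, which suffices for the horizontal sides of a rectangle. The
  short integral without absolute values suffers no such loss, because integrating over the interval
  multiplies \<phi> by a kernel whose square has integral O(H).\<close>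

lemma convex_on_ln_one_plus_inverse_square:
  fixes t :: real
  shows "convex_on {0<..} (\<lambda>y. ln (1 + t\<^sup>2 / y\<^sup>2))"
proof -
  have pos: "y\<^sup>2 + t\<^sup>2 > 0" if "y > 0" for y :: real
    using that by (simp add: add_pos_nonneg)
  \<comment> \<open>Written as this difference the function is easy to differentiate twice; the
    second derivative is 2 t^2 (3 y^2 + t^2) / ((y^2 + t^2)^2 y^2).\<close>
  have "convex_on {0<..} (\<lambda>y. ln (y\<^sup>2 + t\<^sup>2) - 2 * ln y)"
  proof (rule f''_ge0_imp_convex)
    show "((\<lambda>y. ln (y\<^sup>2 + t\<^sup>2) - 2 * ln y) has_real_derivative (2 * y / (y\<^sup>2 + t\<^sup>2) - 2 / y)) (at y)"
      if "y \<in> {0<..}" for y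
      using that pos[of y] by (auto intro!: derivative_eq_intros)
    show "((\<lambda>y. 2 * y / (y\<^sup>2 + t\<^sup>2) - 2 / y) has_real_derivative
            ((2 * (y\<^sup>2 + t\<^sup>2) - 2 * y * (2 * y)) / (y\<^sup>2 + t\<^sup>2)\<^sup>2 + 2 / y\<^sup>2)) (at y)"
      if "y \<in> {0<..}" for y
      using that pos[of y] by (auto intro!: derivative_eq_intros simp: power2_eq_square)
    show "(2 * (y\<^sup>2 + t\<^sup>2) - 2 * y * (2 * y)) / (y\<^sup>2 + t\<^sup>2)\<^sup>2 + 2 / y\<^sup>2 \<ge> 0" if "y \<in> {0<..}" for y
    proof -
      have "(2 * (y\<^sup>2 + t\<^sup>2) - 2 * y * (2 * y)) / (y\<^sup>2 + t\<^sup>2)\<^sup>2 + 2 / y\<^sup>2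
          = 2 * t\<^sup>2 * (3 * y\<^sup>2 + t\<^sup>2) / ((y\<^sup>2 + t\<^sup>2)\<^sup>2 * y\<^sup>2)"
      proof -
        have "(2 * (y\<^sup>2 + t\<^sup>2) - 2 * y * (2 * y)) * y\<^sup>2 + 2 * (y\<^sup>2 + t\<^sup>2)\<^sup>2 = 2 * t\<^sup>2 * (3 * y\<^sup>2 + t\<^sup>2)"
          by (simp add: algebra_simps power2_eq_square)
        moreover have "(y\<^sup>2 + t\<^sup>2)\<^sup>2 \<noteq> 0" "y\<^sup>2 \<noteq> 0" using that pos[of y] by auto
        ultimately show ?thesis by (simp add: add_frac_eq)
      qed
      then show ?thesis by simp
    qed
  qed simp
  moreover have "ln (y\<^sup>2 + t\<^sup>2) - 2 * ln y = ln (1 + t\<^sup>2 / y\<^sup>2)" if "y \<in> {0<..}" for y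
  proof -
    have "ln (1 + t\<^sup>2 / y\<^sup>2) = ln ((y\<^sup>2 + t\<^sup>2) / y\<^sup>2)"
      using that by (simp add: field_simps)
    also have "\<dots> = ln (y\<^sup>2 + t\<^sup>2) - ln (y\<^sup>2)" using that pos[of y] by (simp add: ln_div)
    finally show ?thesis using that by (simp add: ln_realpow)
  qed
  moreover have "u * x + v * y \<in> {0<..}" if "x > 0" "y > 0" "u \<ge> 0" "v \<ge> 0" "u + v = 1" for u v x y :: real
    using convexD[of "{0::real<..}" x y u v] that by simp
  ultimately show ?thesis
    unfolding convex_on_def by auto
qed

text \<open>\<open>\<bar>\<Gamma>(x)/\<Gamma>(x+it)\<bar>\<^sup>2\<close> is the product of the factors \<open>1 + t\<^sup>2/(x+j)\<^sup>2\<close>, each of which is log-convex in \<open>x\<close>.\<close>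

lemma rGamma_quotient_log_convex:
  fixes a b t \<mu> :: real
  assumes ab: "a > 0" "b > 0" and \<mu>: "0 \<le> \<mu>" "\<mu> \<le> 1"
  defines "x \<equiv> (1 - \<mu>) * a + \<mu> * b"
  shows "norm (rGamma (Complex x t)) / rGamma x \<le>
     (norm (rGamma (Complex a t)) / rGamma a) powr (1 - \<mu>) * (norm (rGamma (Complex b t)) / rGamma b) powr \<mu>"
proof -
  define h where "h y = ln (1 + t\<^sup>2 / y\<^sup>2)" for y :: real
  define g where "g n y = (\<Sum>j\<le>n. h (y + real j))" for n :: nat and y :: real
  have x: "x > 0" using ab \<mu> unfolding x_def
    by (cases "\<mu> = 0") (auto intro!: add_nonneg_pos mult_nonneg_nonneg)
  \<comment> \<open>In the quotient of Gauss products the factorial and the modulus of n^z, which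
    depends on Re z only, cancel; the product of sqrt (1 + t^2/(y+j)^2) over j \<le> n
    remains.\<close>
  have quot: "norm (rGamma_series (Complex y t) n) / rGamma_series y n = exp (g n y / 2)" if y: "y > 0" for y n
  proof -
    have f: "norm (Complex y t + of_nat j) = (y + real j) * exp (h (y + real j) / 2)" for j
    proof -
      have p: "y + real j > 0" using y by simp
      have "norm (Complex y t + of_nat j) = sqrt ((y + real j)\<^sup>2 + t\<^sup>2)" by (simp add: cmod_def)
      also have "(y + real j)\<^sup>2 + t\<^sup>2 = (y + real j)\<^sup>2 * (1 + t\<^sup>2 / (y + real j)\<^sup>2)"
        using p by (simp add: field_simps)
      also have "sqrt \<dots> = (y + real j) * sqrt (1 + t\<^sup>2 / (y + real j)\<^sup>2)"
        using p by (simp add: real_sqrt_mult)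
      also have "sqrt (1 + t\<^sup>2 / (y + real j)\<^sup>2) = exp (h (y + real j) / 2)"
        unfolding h_def by (simp add: sqrt_def root_powr_inverse powr_def add_pos_nonneg del: root_powr_inverse)
          (simp add: add_nonneg_eq_0_iff root_powr_inverse powr_def add_pos_nonneg)
      finally show ?thesis .
    qed
    have "norm (pochhammer (Complex y t) (Suc n)) = (\<Prod>j\<le>n. norm (Complex y t + of_nat j))"
      by (simp add: pochhammer_prod prod_norm[symmetric] lessThan_Suc_atMost atLeast0LessThan)
    also have "\<dots> = pochhammer y (Suc n) * exp (g n y / 2)"
      unfolding f by (simp add: prod.distrib pochhammer_prod g_def exp_sum sum_divide_distrib lessThan_Suc_atMost atLeast0LessThan)
    finally have 1: "norm (pochhammer (Complex y t) (Suc n)) = pochhammer y (Suc n) * exp (g n y / 2)" .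
    have 2: "norm (exp (Complex y t * of_real (ln (real n)))) = exp (y * ln (real n))"
      by simp
    have "pochhammer y (Suc n) > 0" using y by (rule pochhammer_pos)
    then show ?thesis
      unfolding rGamma_series_def using 1 2
      by (simp add: norm_divide norm_mult)
  qed
  have step: "exp (g n x / 2) \<le> exp (g n a / 2) powr (1 - \<mu>) * exp (g n b / 2) powr \<mu>" for n
  proof -
    have "g n x \<le> (\<Sum>j\<le>n. (1 - \<mu>) * h (a + real j) + \<mu> * h (b + real j))"
      unfolding g_def
    proof (rule sum_mono)
      fix j :: nat
      have "h ((1 - \<mu>) * (a + real j) + \<mu> * (b + real j)) \<le> (1 - \<mu>) * h (a + real j) + \<mu> * h (b + real j)"
        using convex_onD[OF convex_on_ln_one_plus_inverse_square[of t], of \<mu> "a + real j" "b + real j"] ab \<mu>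
        by (simp add: h_def)
      then show "h (x + real j) \<le> (1 - \<mu>) * h (a + real j) + \<mu> * h (b + real j)"
        by (simp add: x_def algebra_simps)
    qed
    also have "\<dots> = (1 - \<mu>) * g n a + \<mu> * g n b"
      by (simp add: g_def sum.distrib sum_distrib_left)
    finally show ?thesis by (simp add: powr_def exp_add[symmetric] field_simps)
  qed
  have lim: "(\<lambda>n. exp (g n y / 2)) \<longlonglongrightarrow> norm (rGamma (Complex y t)) / rGamma y" if "y > 0" for y
    unfolding quot[OF that, symmetric]
  proof (intro tendsto_intros)
    show "rGamma y \<noteq> 0" using Gamma_real_pos[OF that] by (metis less_irrefl rGamma_inverse_Gamma inverse_nonzero_iff_nonzero)
  qed
  have nz: "norm (rGamma (Complex y t)) / rGamma y \<noteq> 0" if "y > 0" for y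
  proof -
    have "Complex y t \<notin> \<int>\<^sub>\<le>\<^sub>0" using that by (auto elim!: nonpos_Ints_cases simp: complex_eq_iff)
    then have "rGamma (Complex y t) \<noteq> 0" by (simp add: rGamma_eq_zero_iff)
    moreover have "rGamma y \<noteq> 0" using Gamma_real_pos[OF that]
      by (metis less_irrefl rGamma_inverse_Gamma inverse_nonzero_iff_nonzero)
    ultimately show ?thesis by simp
  qed
  show ?thesis
  proof (rule LIMSEQ_le[OF lim[OF x]])
    show "(\<lambda>n. exp (g n a / 2) powr (1 - \<mu>) * exp (g n b / 2) powr \<mu>) \<longlonglongrightarrow>
      (norm (rGamma (Complex a t)) / rGamma a) powr (1 - \<mu>) * (norm (rGamma (Complex b t)) / rGamma b) powr \<mu>"
      using nz ab by (intro tendsto_intros lim) auto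
  qed (use step in auto)
qed

lemma norm_sin_le_exp: "norm (sin (z::complex)) \<le> exp \<bar>Im z\<bar>"
proof -
  have "norm (sin z) = norm (exp (\<i> * z) - exp (- (\<i> * z))) / 2"
    by (simp add: sin_exp_eq norm_divide norm_mult)
  also have "\<dots> \<le> (norm (exp (\<i> * z)) + norm (exp (- (\<i> * z)))) / 2"
    by (intro divide_right_mono norm_triangle_ineq4) simp
  also have "\<dots> \<le> (exp \<bar>Im z\<bar> + exp \<bar>Im z\<bar>) / 2"
    by (intro divide_right_mono add_mono) (auto simp: norm_exp_eq_Re)
  finally show ?thesis by simp
qed

text \<open>On Re z = 1/2 the map z -> 1 - z is complex conjugation, so the reflection formula
  evaluates the square of the modulus as |sin (pi z)| / pi.\<close>

lemma norm_rGamma_half_le: "norm (rGamma (Complex (1/2) t)) \<le> exp (pi * \<bar>t\<bar> / 2)"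
proof -
  let ?z = "Complex (1/2) t"
  have "1 - ?z = cnj ?z" by (simp add: complex_eq_iff)
  then have "norm (rGamma (1 - ?z)) = norm (rGamma ?z)"
    by (simp add: rGamma_complex_def[symmetric] cnj_rGamma[symmetric] del: cnj_rGamma)
  then have "(norm (rGamma ?z))\<^sup>2 = norm (rGamma ?z * rGamma (1 - ?z))"
    by (simp add: norm_mult power2_eq_square)
  also have "\<dots> = norm (sin (of_real pi * ?z)) / pi"
    by (simp add: rGamma_reflection_complex norm_divide)
  also have "\<dots> \<le> exp (pi * \<bar>t\<bar>) / 1"
    using norm_sin_le_exp[of "of_real pi * ?z"] pi_gt3 by (intro frac_le) (auto simp: abs_mult)
  also have "\<dots> = (exp (pi * \<bar>t\<bar> / 2))\<^sup>2" by (simp add: exp_double[symmetric])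
  finally show ?thesis by (rule power2_le_imp_le) simp
qed

text \<open>The lower bound for \<open>\<Gamma>\<close> in Stirling's formula, by interpolating between \<open>x = 1/2\<close> (reflection formula)
  and \<open>x = J + 1/2\<close> (functional equation).\<close>

lemma norm_rGamma_vertical_strip:
  fixes J :: nat
  assumes J: "J > 0"
  obtains C where "C > 0"
    "\<And>x t. 1/2 \<le> x \<Longrightarrow> x \<le> 1/2 + real J \<Longrightarrow> t > 0 \<Longrightarrow>
       norm (rGamma (Complex x t)) \<le> C * t powr (1/2 - x) * exp (pi * t / 2)"
proof -
  define b :: real where "b = 1/2 + real J"
  \<comment> \<open>The maximum with 1 here and in \<open>K0\<close> lets the interpolated constant
    be bounded by \<open>K0 * K\<close> uniformly in \<mu>.\<close>
  define K where "K = max 1 (1 / rGamma b)"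
  define Q where "Q y t = norm (rGamma (Complex y t)) / rGamma y" for y t :: real
  have rpos: "rGamma y > 0" if "y > 0" for y :: real
    using Gamma_real_pos[OF that] by (simp add: rGamma_inverse_Gamma)
  have "continuous_on {1/2..b} (rGamma :: real \<Rightarrow> real)"
    by (intro continuous_intros)
  then have "compact ((rGamma :: real \<Rightarrow> real) ` {1/2..b})" by (rule compact_continuous_image) simp
  then obtain B where B: "\<And>y. y \<in> {1/2..b} \<Longrightarrow> \<bar>rGamma y :: real\<bar> \<le> B"
    by (metis bounded_iff compact_imp_bounded imageI real_norm_def)
  define K0 where "K0 = max 1 (1 / rGamma (1/2 :: real))"
  show ?thesis
  proof (rule that)
    have B0: "B > 0" using B[of "1/2"] rpos[of "1/2"] J by (simp add: b_def)
    show "B * (K0 * K) > 0" using B0 by (simp add: K_def K0_def less_max_iff_disj)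
    fix x t :: real assume x: "1/2 \<le> x" "x \<le> 1/2 + real J" and t: "t > 0"
    define \<mu> where "\<mu> = (x - 1/2) / real J"
    have \<mu>: "0 \<le> \<mu>" "\<mu> \<le> 1" "real J * \<mu> = x - 1/2"
      using x J by (auto simp: \<mu>_def field_simps)
    have xe: "x = (1 - \<mu>) * (1/2) + \<mu> * b" using \<mu>(3) by (simp add: b_def field_simps)
    let ?E = "exp (pi * t / 2)"
    have Q0: "Q (1/2) t \<le> K0 * ?E"
    proof -
      have "Q (1/2) t = norm (rGamma (Complex (1/2) t)) * (1 / rGamma (1/2 :: real))" by (simp add: Q_def)
      also have "\<dots> \<le> ?E * K0"
        using norm_rGamma_half_le[of t] t by (intro mult_mono) (auto simp: K0_def less_imp_le[OF rpos])
      finally show ?thesis by (simp add: mult.commute)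
    qed
    have QJ: "Q b t \<le> K * (?E * t powr (- real J))"
    proof -
      have e: "Complex (1/2) t + of_nat J = Complex b t" by (simp add: complex_eq_iff b_def)
      have "norm (pochhammer (Complex (1/2) t) J) * norm (rGamma (Complex b t)) = norm (rGamma (Complex (1/2) t))"
        using pochhammer_rGamma[of "Complex (1/2) t" J] by (simp add: e norm_mult)
      \<comment> \<open>Each of the J factors 1/2 + j + it has imaginary part t; this is the source
        of the extra power t^(-J) at the right end of the strip.\<close>
      moreover have "norm (pochhammer (Complex (1/2) t) J) \<ge> t ^ J"
      proof -
        have "(\<Prod>j<J. t) \<le> (\<Prod>j<J. norm (Complex (1/2) t + of_nat j))"
        proof (intro prod_mono conjI)
          fix j
          show "t \<le> norm (Complex (1/2) t + of_nat j)"
            using abs_Im_le_cmod[of "Complex (1/2) t + of_nat j"] t by simp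
        qed (use t in auto)
        then show ?thesis by (simp add: pochhammer_prod prod_norm[symmetric] atLeast0LessThan)
      qed
      ultimately have "t ^ J * norm (rGamma (Complex b t)) \<le> norm (rGamma (Complex (1/2) t))"
        by (metis mult_right_mono norm_ge_zero)
      also have "\<dots> \<le> ?E" using norm_rGamma_half_le[of t] t by simp
      finally have *: "norm (rGamma (Complex b t)) \<le> ?E * t powr (- real J)"
        using t by (simp add: powr_minus powr_realpow field_simps)
      have "Q b t = (1 / rGamma b) * norm (rGamma (Complex b t))" by (simp add: Q_def)
      also have "\<dots> \<le> K * (?E * t powr (- real J))"
        using * rpos[of b] by (intro mult_mono) (auto simp: K_def b_def)
      finally show ?thesis .
    qed
    have "Q x t \<le> Q (1/2) t powr (1 - \<mu>) * Q b t powr \<mu>"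
      unfolding Q_def xe by (rule rGamma_quotient_log_convex) (use \<mu> in \<open>auto simp: b_def\<close>)
    also have "\<dots> \<le> (K0 * ?E) powr (1 - \<mu>) * (K * (?E * t powr (- real J))) powr \<mu>"
      using Q0 QJ \<mu> rpos[of "1/2"] rpos[of b]
      by (intro mult_mono powr_mono2) (auto simp: Q_def b_def)
    also have "\<dots> = (K0 powr (1 - \<mu>) * K powr \<mu>) * (?E powr (1 - \<mu>) * ?E powr \<mu>) * t powr (- real J * \<mu>)"
      by (simp add: powr_mult powr_powr K_def K0_def)
    also have "?E powr (1 - \<mu>) * ?E powr \<mu> = ?E" by (simp add: powr_add[symmetric])
    also have "t powr (- real J * \<mu>) = t powr (1/2 - x)" using \<mu>(3) by simp
    also have "K0 powr (1 - \<mu>) * K powr \<mu> * ?E * t powr (1/2 - x) \<le> K0 * K * ?E * t powr (1/2 - x)"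
    proof -
      have "K0 powr (1 - \<mu>) \<le> K0 powr 1" "K powr \<mu> \<le> K powr 1"
        using \<mu> by (intro powr_mono; simp add: K_def K0_def)+
      then have "K0 powr (1 - \<mu>) * K powr \<mu> \<le> K0 powr 1 * K powr 1"
        by (intro mult_mono) auto
      also have "\<dots> = K0 * K" by (simp add: K_def K0_def)
      finally have "K0 powr (1 - \<mu>) * K powr \<mu> \<le> K0 * K" .
      then show ?thesis by (intro mult_right_mono) auto
    qed
    finally have Qx: "Q x t \<le> K0 * K * ?E * t powr (1/2 - x)" .
    have "norm (rGamma (Complex x t)) = rGamma x * Q x t"
      using rpos[of x] x by (simp add: Q_def)
    also have "\<dots> \<le> B * (K0 * K * ?E * t powr (1/2 - x))"
      using B[of x] x rpos[of x] Qx B0 by (intro mult_mono) (auto simp: b_def Q_def)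
    finally show "norm (rGamma (Complex x t)) \<le> B * (K0 * K) * t powr (1/2 - x) * exp (pi * t / 2)"
      by (simp add: mult_ac)
  qed
qed

section \<open>Bessel's inequality for the Fourier transform\<close>

lemma poisson_kernel_integral:
  fixes a :: real assumes a: "a > 0"
  shows "integrable lborel (\<lambda>w. 2 * a / (a\<^sup>2 + w\<^sup>2))" "(\<integral>w. 2 * a / (a\<^sup>2 + w\<^sup>2) \<partial>lborel) = 2 * pi"
proof -
  have pos: "a\<^sup>2 + w\<^sup>2 > 0" for w using a by (simp add: add_pos_nonneg)
  have top: "((\<lambda>w. 2 * arctan (w / a)) \<longlongrightarrow> 2 * (pi / 2)) at_top"
    using a by real_asymp
  have bot: "((\<lambda>w. 2 * arctan (w / a)) \<longlongrightarrow> 2 * (- (pi / 2))) at_bot"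
    using a by real_asymp
  have der: "((\<lambda>w. 2 * arctan (w / a)) has_real_derivative 2 * a / (a\<^sup>2 + w\<^sup>2)) (at w)" for w
  proof -
    have "a * (1 + (w / a)\<^sup>2) * a = a\<^sup>2 + w\<^sup>2" using a by (simp add: field_simps power2_eq_square)
    then show ?thesis using a pos[of w]
      by (auto intro!: derivative_eq_intros simp: field_simps power2_eq_square add_eq_0_iff)
  qed
  have "set_integrable lborel (einterval (-\<infinity>) \<infinity>) (\<lambda>w. 2 * a / (a\<^sup>2 + w\<^sup>2))"
    and "(LBINT w=-\<infinity>..\<infinity>. 2 * a / (a\<^sup>2 + w\<^sup>2)) = 2 * (pi / 2) - 2 * (- (pi / 2))"
    using pos a
    by (intro interval_integral_FTC_nonneg[where F = "\<lambda>w. 2 * arctan (w / a)"];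
        use der top bot in \<open>auto simp: ereal_tendsto_simps less_imp_le[OF pos] pos[THEN less_imp_neq, symmetric] intro!: continuous_intros\<close>)+
  then show "integrable lborel (\<lambda>w. 2 * a / (a\<^sup>2 + w\<^sup>2))" "(\<integral>w. 2 * a / (a\<^sup>2 + w\<^sup>2) \<partial>lborel) = 2 * pi"
    by (simp_all add: set_integrable_def interval_lebesgue_integral_def set_lebesgue_integral_def)
qed

lemma exp_kernel_half:
  fixes a w :: real assumes a: "a > 0"
  shows "set_integrable lborel {0<..} (\<lambda>t. exp (- a * t) :: real)"
    "set_integrable lborel {0<..} (\<lambda>t. exp (of_real t * Complex (-a) w))"
    "(LBINT t:{0<..}. exp (of_real t * Complex (-a) w)) = 1 / Complex a (-w)"
proof -
  have ein: "einterval (ereal 0) \<infinity> = {0<..}" by (auto simp: einterval_def)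
  have top: "((\<lambda>t. - exp (- a * t) / a) \<longlongrightarrow> 0) at_top"
    using a by real_asymp
  have 0: "((\<lambda>t. - exp (- a * t) / a) \<longlongrightarrow> - 1 / a) (at_right 0)"
    using a by (auto intro!: tendsto_eq_intros)
  have der: "((\<lambda>t. - exp (- a * t) / a) has_real_derivative exp (- a * t)) (at t)" for t
    using a by (auto intro!: derivative_eq_intros)
  have "set_integrable lborel (einterval (ereal 0) \<infinity>) (\<lambda>t. exp (- a * t) :: real)"
    by (rule interval_integral_FTC_nonneg[where F = "\<lambda>t. - exp (- a * t) / a" and A = "- 1 / a" and B = 0])
      (use der top 0 in \<open>auto simp: ereal_tendsto_simps intro!: continuous_intros\<close>)
  then show i: "set_integrable lborel {0<..} (\<lambda>t. exp (- a * t) :: real)"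
    by (simp add: ein)
  have nz: "Complex (-a) w \<noteq> 0" using a by (simp add: complex_eq_iff)
  show ci: "set_integrable lborel {0<..} (\<lambda>t. exp (of_real t * Complex (-a) w))"
    unfolding set_integrable_def
  proof (rule Bochner_Integration.integrable_bound[OF i[unfolded set_integrable_def]])
    show "AE t in lborel. norm (indicator {0<..} t *\<^sub>R exp (of_real t * Complex (-a) w)) \<le> norm (indicator {0<..} t *\<^sub>R exp (- a * t))"
      by (simp add: indicator_def norm_exp_eq_Re mult.commute)
  qed measurable
  let ?F = "\<lambda>t. exp (of_real t * Complex (-a) w) / Complex (-a) w"
  have vd: "(?F has_vector_derivative exp (of_real t * Complex (-a) w)) (at t)" for t
  proof -
    have "((\<lambda>z. exp (z * Complex (-a) w) / Complex (-a) w) has_field_derivative exp (of_real t * Complex (-a) w)) (at (of_real t))"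
      using nz by (auto intro!: derivative_eq_intros)
    from has_vector_derivative_real_field[OF this] show ?thesis by simp
  qed
  have l0: "(?F \<longlongrightarrow> 1 / Complex (-a) w) (at_right 0)"
    using nz by (auto intro!: tendsto_eq_intros)
  have l1: "(?F \<longlongrightarrow> 0) at_top"
  proof (rule Lim_null_comparison)
    show "eventually (\<lambda>t. norm (?F t) \<le> exp (- a * t) / norm (Complex (-a) w)) at_top"
      by (simp add: norm_divide norm_exp_eq_Re mult.commute)
    have "((\<lambda>t. exp (- a * t)) \<longlongrightarrow> 0) at_top" using a by real_asymp
    from tendsto_divide[OF this tendsto_const, of "norm (Complex (-a) w)"] nz
    show "((\<lambda>t. exp (- a * t) / norm (Complex (-a) w)) \<longlongrightarrow> 0) at_top" by simp
  qed
  have "(LBINT t=ereal 0..\<infinity>. exp (of_real t * Complex (-a) w)) = 0 - 1 / Complex (-a) w"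
    by (rule interval_integral_FTC_integrable[where F = ?F])
      (use vd l0 l1 ci ein in \<open>auto simp: ereal_tendsto_simps simp del: of_real_mult intro!: continuous_intros\<close>)
  then show "(LBINT t:{0<..}. exp (of_real t * Complex (-a) w)) = 1 / Complex a (-w)"
  proof -
    have "- Complex (-a) w = Complex a (-w)" by (simp add: complex_eq_iff)
    then have "0 - 1 / Complex (-a) w = 1 / Complex a (-w)" by (metis diff_0 minus_divide_right)
    then show ?thesis using \<open>(LBINT t=ereal 0..\<infinity>. _ t) = _\<close>
      by (simp add: interval_lebesgue_integral_def ein)
  qed
qed

text \<open>The half-lines t > 0 and t < 0 contribute 1/(a - iw) and 1/(a + iw), whose sum is the
  Poisson kernel.\<close>

lemma exp_kernel_integral:
  fixes a w :: real assumes a: "a > 0"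
  shows "integrable lborel (\<lambda>t. exp (- a * \<bar>t\<bar>))"
    "(\<integral>t. of_real (exp (- a * \<bar>t\<bar>)) * exp (\<i> * of_real (t * w)) \<partial>lborel) = of_real (2 * a / (a\<^sup>2 + w\<^sup>2))"
proof -
  let ?f = "\<lambda>t. indicator {0<..} t *\<^sub>R exp (- a * t) :: real"
  let ?g = "\<lambda>w t. indicator {0<..} t *\<^sub>R exp (of_real t * Complex (-a) w)"
  have f: "integrable lborel ?f" using exp_kernel_half(1)[OF a] by (simp add: set_integrable_def)
  have f': "integrable lborel (\<lambda>t. ?f (- t))"
    using lborel_integrable_real_affine[OF f, of "-1" 0] by simp
  have AE0: "AE t in lborel. t \<noteq> (0::real)" by (rule AE_lborel_singleton)
  have "integrable lborel (\<lambda>t. ?f t + ?f (- t))" using f f' by (rule Bochner_Integration.integrable_add)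
  then show "integrable lborel (\<lambda>t. exp (- a * \<bar>t\<bar>))"
    by (rule integrable_cong_AE_imp) (use AE0 in \<open>auto simp: indicator_def\<close>)
  have g: "integrable lborel (?g w)" for w using exp_kernel_half(2)[OF a] by (simp add: set_integrable_def)
  have g': "integrable lborel (\<lambda>t. ?g (-w) (- t))"
    using lborel_integrable_real_affine[OF g[of "-w"], of "-1" 0] by simp
  have "(\<integral>t. of_real (exp (- a * \<bar>t\<bar>)) * exp (\<i> * of_real (t * w)) \<partial>lborel) = (\<integral>t. ?g w t + ?g (-w) (- t) \<partial>lborel)"
  proof (rule integral_cong_AE)
    have e: "exp (of_real t * Complex (-a) w) = of_real (exp (- a * t)) * exp (\<i> * of_real (t * w))" for t w
    proof -
      have "of_real t * Complex (-a) w = of_real (- a * t) + \<i> * of_real (t * w)" by (simp add: complex_eq_iff)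
      then show ?thesis by (simp only: exp_add exp_of_real)
    qed
    show "AE t in lborel. of_real (exp (- a * \<bar>t\<bar>)) * exp (\<i> * of_real (t * w)) = ?g w t + ?g (-w) (- t)"
      using AE0
    proof eventually_elim
      case (elim t)
      then show ?case using e[of t w] e[of "-t" "-w"] by (cases "t > 0") (auto simp: indicator_def)
    qed
  qed measurable
  also have "\<dots> = (\<integral>t. ?g w t \<partial>lborel) + (\<integral>t. ?g (-w) (- t) \<partial>lborel)"
    using g g' by (rule Bochner_Integration.integral_add)
  also have "(\<integral>t. ?g (-w) (- t) \<partial>lborel) = (\<integral>t. ?g (-w) t \<partial>lborel)"
    using lborel_integral_real_affine[of "-1" "?g (-w)" 0] by simp
  also have "(\<integral>t. ?g w t \<partial>lborel) + (\<integral>t. ?g (-w) t \<partial>lborel) = 1 / Complex a (-w) + 1 / Complex a w"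
    using exp_kernel_half(3)[OF a, of w] exp_kernel_half(3)[OF a, of "-w"] by (simp add: set_lebesgue_integral_def)
  also have "\<dots> = of_real (2 * a / (a\<^sup>2 + w\<^sup>2))"
  proof -
    have nz: "Complex a (-w) \<noteq> 0" "Complex a w \<noteq> 0" using a by (auto simp: complex_eq_iff)
    have "Complex a (-w) * Complex a w = of_real (a\<^sup>2 + w\<^sup>2)" "Complex a w + Complex a (-w) = of_real (2 * a)"
      by (auto simp: complex_eq_iff power2_eq_square)
    moreover have "1 / Complex a (-w) + 1 / Complex a w = (Complex a w + Complex a (-w)) / (Complex a (-w) * Complex a w)"
      using nz by (simp add: add_frac_eq)
    ultimately show ?thesis by (simp only: of_real_divide)
  qed
  finally show "(\<integral>t. of_real (exp (- a * \<bar>t\<bar>)) * exp (\<i> * of_real (t * w)) \<partial>lborel) = of_real (2 * a / (a\<^sup>2 + w\<^sup>2))" .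
qed

text \<open>The exchanges of Bochner integrals below all concern integrands dominated by a product
  of integrable functions of one variable each.\<close>

lemma integrable_pair_dominated:
  fixes F :: "real \<times> real \<Rightarrow> complex"
  assumes F: "F \<in> borel_measurable (lborel \<Otimes>\<^sub>M lborel)"
    and a: "integrable lborel a" and b: "integrable lborel b"
    and le: "\<And>x y. norm (F (x, y)) \<le> (a x :: real) * b y"
  shows "integrable (lborel \<Otimes>\<^sub>M lborel) F"
proof (rule Bochner_Integration.integrable_bound[OF _ F])
  have [measurable]: "a \<in> borel_measurable borel" "b \<in> borel_measurable borel" using a b by auto
  show "integrable (lborel \<Otimes>\<^sub>M lborel) (\<lambda>(x, y). a x * b y)"
    by (rule lborel_pair.Fubini_integrable) (use a b in \<open>auto simp: abs_mult\<close>)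
  show "AE p in lborel \<Otimes>\<^sub>M lborel. norm (F p) \<le> norm (case p of (x, y) \<Rightarrow> a x * b y)"
  proof (rule AE_I2)
    fix p :: "real \<times> real"
    obtain x y where p: "p = (x, y)" by (cases p)
    show "norm (F p) \<le> norm (case p of (x, y) \<Rightarrow> a x * b y)"
      using order_trans[OF le[of x y] abs_ge_self] by (simp add: p)
  qed
qed

text \<open>The weight \<open>e\<^sup>-\<^sup>a\<^sup>|\<^sup>t\<^sup>|\<close> turns the left-hand side into a quadratic form in \<open>\<psi>\<close> whose kernel, the Poisson
  kernel, has total mass \<open>2\<pi>\<close>; so no Plancherel theorem is needed.\<close>

lemma fourier_bessel:
  fixes \<psi> :: "real \<Rightarrow> complex" and a :: real
  assumes \<psi>: "integrable lborel \<psi>" and \<psi>2: "integrable lborel (\<lambda>u. (norm (\<psi> u))\<^sup>2)" and a: "a > 0"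
  defines "\<Psi> \<equiv> \<lambda>t. \<integral>u. \<psi> u * exp (\<i> * of_real (t * u)) \<partial>lborel"
  shows "integrable lborel (\<lambda>t. exp (- a * \<bar>t\<bar>) * (norm (\<Psi> t))\<^sup>2)"
    "(\<integral>t. exp (- a * \<bar>t\<bar>) * (norm (\<Psi> t))\<^sup>2 \<partial>lborel) \<le> 2 * pi * (\<integral>u. (norm (\<psi> u))\<^sup>2 \<partial>lborel)"
proof -
  have [measurable]: "\<psi> \<in> borel_measurable borel" using \<psi> by auto
  have [measurable]: "cnj \<in> borel_measurable borel"
    by (intro borel_measurable_continuous_onI continuous_intros)
  define K where "K = (\<integral>u. norm (\<psi> u) \<partial>lborel)"
  have n1: "norm (exp (\<i> * of_real x)) = 1" for x by simp
  have [measurable]: "\<Psi> \<in> borel_measurable borel"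
    unfolding \<Psi>_def by measurable
  have \<Psi>K: "norm (\<Psi> t) \<le> K" for t
    unfolding \<Psi>_def K_def by (rule order_trans[OF integral_norm_bound]) (simp add: norm_mult n1)
  have K0: "K \<ge> 0" unfolding K_def by simp
  note e = exp_kernel_integral(1)[OF a]
  show I: "integrable lborel (\<lambda>t. exp (- a * \<bar>t\<bar>) * (norm (\<Psi> t))\<^sup>2)"
  proof (rule Bochner_Integration.integrable_bound[OF Bochner_Integration.integrable_mult_right[OF e, of "K\<^sup>2"]])
    show "AE t in lborel. norm (exp (- a * \<bar>t\<bar>) * (norm (\<Psi> t))\<^sup>2) \<le> norm (K\<^sup>2 * exp (- a * \<bar>t\<bar>))"
      using \<Psi>K K0 by (intro AE_I2) (simp add: abs_mult mult.commute power_mono)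
  qed measurable
  define k where "k w = 2 * a / (a\<^sup>2 + w\<^sup>2)" for w :: real
  have [measurable]: "k \<in> borel_measurable borel" unfolding k_def by measurable
  have k0: "k w \<ge> 0" for w using a by (simp add: k_def)
  have cnj\<Psi>: "cnj (\<Psi> t) = (\<integral>v. cnj (\<psi> v) * exp (- (\<i> * of_real (t * v))) \<partial>lborel)" for t
  proof -
    have "cnj (\<Psi> t) = (\<integral>v. cnj (\<psi> v * exp (\<i> * of_real (t * v))) \<partial>lborel)"
      unfolding \<Psi>_def by (simp only: Bochner_Integration.integral_cnj)
    also have "\<dots> = (\<integral>v. cnj (\<psi> v) * exp (- (\<i> * of_real (t * v))) \<partial>lborel)"
      by (intro Bochner_Integration.integral_cong[OF refl]) (simp add: exp_cnj)
    finally show ?thesis .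
  qed
  \<comment> \<open>Integrating over t first replaces the conjugate of \<Psi> by the convolution of
    the conjugate of \<psi> with the Poisson kernel.\<close>
  have inner: "(\<integral>t. of_real (exp (- a * \<bar>t\<bar>)) * exp (\<i> * of_real (t * u)) * cnj (\<Psi> t) \<partial>lborel)
       = (\<integral>v. cnj (\<psi> v) * of_real (k (u - v)) \<partial>lborel)" for u
  proof -
    let ?F = "\<lambda>t v. of_real (exp (- a * \<bar>t\<bar>)) * exp (\<i> * of_real (t * u)) * (cnj (\<psi> v) * exp (- (\<i> * of_real (t * v))))"
    have "(\<integral>t. of_real (exp (- a * \<bar>t\<bar>)) * exp (\<i> * of_real (t * u)) * cnj (\<Psi> t) \<partial>lborel) = (\<integral>t. \<integral>v. ?F t v \<partial>lborel \<partial>lborel)"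
      unfolding cnj\<Psi> by (simp only: integral_mult_right_zero)
    also have "\<dots> = (\<integral>v. \<integral>t. ?F t v \<partial>lborel \<partial>lborel)"
    proof (rule lborel_pair.Fubini_integral[symmetric], rule integrable_pair_dominated[OF _ e integrable_norm[OF \<psi>]])
      show "(\<lambda>(t, v). ?F t v) \<in> borel_measurable (lborel \<Otimes>\<^sub>M lborel)" by measurable
    qed (auto simp: norm_mult norm_exp_eq_Re)
    also have "\<dots> = (\<integral>v. cnj (\<psi> v) * of_real (k (u - v)) \<partial>lborel)"
    proof (rule Bochner_Integration.integral_cong[OF refl])
      fix v
      have "(\<integral>t. ?F t v \<partial>lborel) = (\<integral>t. cnj (\<psi> v) * (of_real (exp (- a * \<bar>t\<bar>)) * exp (\<i> * of_real (t * (u - v)))) \<partial>lborel)"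
        by (intro Bochner_Integration.integral_cong[OF refl])
           (simp add: exp_minus right_diff_distrib exp_diff field_simps)
      then show "(\<integral>t. ?F t v \<partial>lborel) = cnj (\<psi> v) * of_real (k (u - v))"
        by (simp only: integral_mult_right_zero exp_kernel_integral(2)[OF a] k_def)
    qed
    finally show ?thesis .
  qed
  have "of_real (\<integral>t. exp (- a * \<bar>t\<bar>) * (norm (\<Psi> t))\<^sup>2 \<partial>lborel) = (\<integral>t. of_real (exp (- a * \<bar>t\<bar>)) * cnj (\<Psi> t) * \<Psi> t \<partial>lborel)"
    unfolding integral_complex_of_real[symmetric]
    by (intro Bochner_Integration.integral_cong[OF refl]) (simp add: complex_norm_square mult_ac flip: of_real_power)
  also have "\<dots> = (\<integral>t. \<integral>u. of_real (exp (- a * \<bar>t\<bar>)) * cnj (\<Psi> t) * (\<psi> u * exp (\<i> * of_real (t * u))) \<partial>lborel \<partial>lborel)"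
    unfolding \<Psi>_def by (simp only: integral_mult_right_zero)
  also have "\<dots> = (\<integral>u. \<integral>t. of_real (exp (- a * \<bar>t\<bar>)) * cnj (\<Psi> t) * (\<psi> u * exp (\<i> * of_real (t * u))) \<partial>lborel \<partial>lborel)"
  proof (rule lborel_pair.Fubini_integral[symmetric],
        rule integrable_pair_dominated[OF _ Bochner_Integration.integrable_mult_right[OF e, of K] integrable_norm[OF \<psi>]])
    show "(\<lambda>(t, u). of_real (exp (- a * \<bar>t\<bar>)) * cnj (\<Psi> t) * (\<psi> u * exp (\<i> * of_real (t * u)))) \<in> borel_measurable (lborel \<Otimes>\<^sub>M lborel)"
      by measurable
  qed (use \<Psi>K in \<open>auto simp: norm_mult norm_exp_eq_Re mult.commute intro!: mult_right_mono mult_left_mono\<close>)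
  also have "\<dots> = (\<integral>u. \<psi> u * (\<integral>t. of_real (exp (- a * \<bar>t\<bar>)) * exp (\<i> * of_real (t * u)) * cnj (\<Psi> t) \<partial>lborel) \<partial>lborel)"
    by (simp only: integral_mult_right_zero[symmetric]) (simp only: mult_ac)
  also have "\<dots> = (\<integral>u. \<psi> u * (\<integral>v. cnj (\<psi> v) * of_real (k (u - v)) \<partial>lborel) \<partial>lborel)"
    unfolding inner ..
  finally have eq: "of_real (\<integral>t. exp (- a * \<bar>t\<bar>) * (norm (\<Psi> t))\<^sup>2 \<partial>lborel) = (\<integral>u. \<psi> u * (\<integral>v. cnj (\<psi> v) * of_real (k (u - v)) \<partial>lborel) \<partial>lborel)" (is "_ = ?R") .
  have nk: "(\<integral>\<^sup>+w. ennreal (k w) \<partial>lborel) = ennreal (2 * pi)"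
    using nn_integral_eq_integral[OF poisson_kernel_integral(1)[OF a]] poisson_kernel_integral(2)[OF a] k0
    by (simp add: k_def)
  have nk1: "(\<integral>\<^sup>+v. ennreal (k (u - v)) \<partial>lborel) = ennreal (2 * pi)" for u
    using nn_integral_real_affine[of "\<lambda>w. ennreal (k w)" "-1" u] nk by simp
  have nk2: "(\<integral>\<^sup>+u. ennreal (k (u - v)) \<partial>lborel) = ennreal (2 * pi)" for v
    using nn_integral_real_affine[of "\<lambda>w. ennreal (k w)" 1 "-v"] nk by (simp add: add.commute)
  \<comment> \<open>A function that is not integrable has Bochner integral 0, so this inequality
    holds for every f and the integrability of the inner convolution need not be discussed.\<close>
  have nb: "ennreal (norm (integral\<^sup>L lborel f)) \<le> (\<integral>\<^sup>+x. ennreal (norm (f x)) \<partial>lborel)" for f :: "real \<Rightarrow> complex"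
    by (cases "integrable lborel f") (auto intro: integral_norm_bound_ennreal simp: not_integrable_integral_eq)
  define S where "S = (\<integral>\<^sup>+u. ennreal ((norm (\<psi> u))\<^sup>2) \<partial>lborel)"
  have "ennreal (norm ?R) \<le> (\<integral>\<^sup>+u. ennreal (norm (\<psi> u * (\<integral>v. cnj (\<psi> v) * of_real (k (u - v)) \<partial>lborel))) \<partial>lborel)"
    by (rule nb)
  also have "\<dots> \<le> (\<integral>\<^sup>+u. ennreal (norm (\<psi> u)) * (\<integral>\<^sup>+v. ennreal (norm (\<psi> v) * k (u - v)) \<partial>lborel) \<partial>lborel)"
  proof (rule nn_integral_mono)
    fix u
    have "ennreal (norm (\<integral>v. cnj (\<psi> v) * of_real (k (u - v)) \<partial>lborel)) \<le> (\<integral>\<^sup>+v. ennreal (norm (\<psi> v) * k (u - v)) \<partial>lborel)"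
      using nb[of "\<lambda>v. cnj (\<psi> v) * of_real (k (u - v))"] k0 by (simp add: norm_mult)
    then show "ennreal (norm (\<psi> u * (\<integral>v. cnj (\<psi> v) * of_real (k (u - v)) \<partial>lborel))) \<le> ennreal (norm (\<psi> u)) * (\<integral>\<^sup>+v. ennreal (norm (\<psi> v) * k (u - v)) \<partial>lborel)"
      unfolding norm_mult by (simp add: ennreal_mult mult_left_mono)
  qed
  also have "\<dots> = (\<integral>\<^sup>+u. (\<integral>\<^sup>+v. ennreal (norm (\<psi> u)) * ennreal (norm (\<psi> v) * k (u - v)) \<partial>lborel) \<partial>lborel)"
    by (simp add: nn_integral_cmult)
  \<comment> \<open>Schur's test: the product of the two values of \<psi> is at most half the sum of
    their squares, and in each half the remaining variable occurs only in the kernel, of mass 2 pi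
    in either variable.\<close>
  also have "\<dots> \<le> (\<integral>\<^sup>+u. (\<integral>\<^sup>+v. ennreal (1/2) * (ennreal ((norm (\<psi> u))\<^sup>2) * ennreal (k (u - v))) + ennreal (1/2) * (ennreal ((norm (\<psi> v))\<^sup>2) * ennreal (k (u - v))) \<partial>lborel) \<partial>lborel)"
  proof (intro nn_integral_mono)
    fix u v
    have "norm (\<psi> u) * norm (\<psi> v) \<le> 1/2 * (norm (\<psi> u))\<^sup>2 + 1/2 * (norm (\<psi> v))\<^sup>2"
      using zero_le_power2[of "norm (\<psi> u) - norm (\<psi> v)"] by (simp add: power2_diff)
    then have "norm (\<psi> u) * norm (\<psi> v) * k (u - v) \<le> (1/2 * (norm (\<psi> u))\<^sup>2 + 1/2 * (norm (\<psi> v))\<^sup>2) * k (u - v)"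
      using k0 by (rule mult_right_mono)
    then have "norm (\<psi> u) * (norm (\<psi> v) * k (u - v)) \<le> 1/2 * ((norm (\<psi> u))\<^sup>2 * k (u - v)) + 1/2 * ((norm (\<psi> v))\<^sup>2 * k (u - v))"
      by (simp add: algebra_simps)
    then have le: "ennreal (norm (\<psi> u) * (norm (\<psi> v) * k (u - v))) \<le> ennreal (1/2 * ((norm (\<psi> u))\<^sup>2 * k (u - v)) + 1/2 * ((norm (\<psi> v))\<^sup>2 * k (u - v)))"
      by (rule ennreal_leI)
    have h: "ennreal (1/2 * (x * k (u - v))) = ennreal (1/2) * (ennreal x * ennreal (k (u - v)))" if "x \<ge> 0" for x
      using that k0[of "u - v"] by (subst ennreal_mult, simp, simp, subst ennreal_mult, simp_all)
    have "ennreal (norm (\<psi> u)) * ennreal (norm (\<psi> v) * k (u - v)) = ennreal (norm (\<psi> u) * (norm (\<psi> v) * k (u - v)))"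
      using k0 by (intro ennreal_mult[symmetric]) auto
    also note le
    also have "ennreal (1/2 * ((norm (\<psi> u))\<^sup>2 * k (u - v)) + 1/2 * ((norm (\<psi> v))\<^sup>2 * k (u - v)))
        = ennreal (1/2 * ((norm (\<psi> u))\<^sup>2 * k (u - v))) + ennreal (1/2 * ((norm (\<psi> v))\<^sup>2 * k (u - v)))"
      using k0 by (intro ennreal_plus) auto
    finally show "ennreal (norm (\<psi> u)) * ennreal (norm (\<psi> v) * k (u - v)) \<le> ennreal (1/2) * (ennreal ((norm (\<psi> u))\<^sup>2) * ennreal (k (u - v))) + ennreal (1/2) * (ennreal ((norm (\<psi> v))\<^sup>2) * ennreal (k (u - v)))"
      unfolding h[OF zero_le_power2] .
  qed
  also have "\<dots> = (\<integral>\<^sup>+u. \<integral>\<^sup>+v. ennreal (1/2) * (ennreal ((norm (\<psi> u))\<^sup>2) * ennreal (k (u - v))) \<partial>lborel \<partial>lborel)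
      + (\<integral>\<^sup>+u. \<integral>\<^sup>+v. ennreal (1/2) * (ennreal ((norm (\<psi> v))\<^sup>2) * ennreal (k (u - v))) \<partial>lborel \<partial>lborel)"
    by (simp add: nn_integral_add)
  also have "(\<integral>\<^sup>+u. \<integral>\<^sup>+v. ennreal (1/2) * (ennreal ((norm (\<psi> v))\<^sup>2) * ennreal (k (u - v))) \<partial>lborel \<partial>lborel)
     = (\<integral>\<^sup>+v. \<integral>\<^sup>+u. ennreal (1/2) * (ennreal ((norm (\<psi> v))\<^sup>2) * ennreal (k (u - v))) \<partial>lborel \<partial>lborel)"
    by (rule lborel_pair.Fubini') measurable
  also have "\<dots> = ennreal (1/2) * (S * ennreal (2 * pi))"
    by (simp add: nn_integral_cmult nk2 nn_integral_multc S_def)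
  also have "(\<integral>\<^sup>+u. \<integral>\<^sup>+v. ennreal (1/2) * (ennreal ((norm (\<psi> u))\<^sup>2) * ennreal (k (u - v))) \<partial>lborel \<partial>lborel) = ennreal (1/2) * (S * ennreal (2 * pi))"
    by (simp add: nn_integral_cmult nk1 nn_integral_multc S_def)
  also have "S = ennreal (\<integral>u. (norm (\<psi> u))\<^sup>2 \<partial>lborel)"
    unfolding S_def by (rule nn_integral_eq_integral[OF \<psi>2]) simp
  also have "ennreal (1/2) * (ennreal V * ennreal (2 * pi)) + ennreal (1/2) * (ennreal V * ennreal (2 * pi)) = ennreal (2 * pi * V)"
    if "V \<ge> 0" for V
  proof -
    have "ennreal (1/2) * (ennreal V * ennreal (2 * pi)) = ennreal (1/2 * (V * (2 * pi)))"
      using that by (subst ennreal_mult, simp, simp, subst ennreal_mult, simp_all)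
    then have "ennreal (1/2) * (ennreal V * ennreal (2 * pi)) = ennreal (pi * V)" by (simp add: mult.commute)
    then show ?thesis using that by (simp only:) (subst ennreal_plus[symmetric], simp_all)
  qed
  finally have "ennreal (norm ?R) \<le> ennreal (2 * pi * (\<integral>u. (norm (\<psi> u))\<^sup>2 \<partial>lborel))"
    by simp
  then have "norm ?R \<le> 2 * pi * (\<integral>u. (norm (\<psi> u))\<^sup>2 \<partial>lborel)"
    by (subst (asm) ennreal_le_iff) auto
  then show "(\<integral>t. exp (- a * \<bar>t\<bar>) * (norm (\<Psi> t))\<^sup>2 \<partial>lborel) \<le> 2 * pi * (\<integral>u. (norm (\<psi> u))\<^sup>2 \<partial>lborel)"
    unfolding eq[symmetric] by (simp add: abs_le_iff)
qed

section \<open>Laplace transforms of functions on a strip\<close>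

text \<open>In the application \<open>\<phi>(w)\<close> is \<open>f(i e\<^sup>w / \<surd>M) e\<^sup>\<kappa>\<^sup>w\<^sup>/\<^sup>2\<close>, so that the edges
  of the strip correspond to the real axis.\<close>

locale strip_function =
  fixes \<phi> :: "complex \<Rightarrow> complex" and \<kappa> :: real
  assumes holo: "\<phi> holomorphic_on {w. \<bar>Im w\<bar> < pi / 2}"
    and decay: "\<And>B. \<exists>C. \<forall>u \<theta> m. \<bar>\<theta>\<bar> < pi / 2 \<longrightarrow> 0 \<le> m \<longrightarrow> m \<le> B \<longrightarrow>
      norm (\<phi> (Complex u \<theta>)) \<le> C * cos \<theta> powr (- \<kappa> / 2 - m) * exp (- m * \<bar>u\<bar>)"
begin

definition laplace :: "complex \<Rightarrow> complex" where
  "laplace z = (\<integral>u. \<phi> (of_real u) * exp (z * of_real u) \<partial>lborel)"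

lemma decay':
  obtains C where "C > 0" "\<And>u \<theta> m. \<bar>\<theta>\<bar> < pi / 2 \<Longrightarrow> 0 \<le> m \<Longrightarrow> m \<le> B \<Longrightarrow>
      norm (\<phi> (Complex u \<theta>)) \<le> C * cos \<theta> powr (- \<kappa> / 2 - m) * exp (- m * \<bar>u\<bar>)"
proof -
  obtain C where C: "\<And>u \<theta> m. \<bar>\<theta>\<bar> < pi / 2 \<Longrightarrow> 0 \<le> m \<Longrightarrow> m \<le> B \<Longrightarrow>
      norm (\<phi> (Complex u \<theta>)) \<le> C * cos \<theta> powr (- \<kappa> / 2 - m) * exp (- m * \<bar>u\<bar>)"
    using decay[of B] by blast
  show ?thesis
  proof (rule that)
    show "max C 1 > 0" by simp
    fix u \<theta> m :: real assume *: "\<bar>\<theta>\<bar> < pi / 2" "0 \<le> m" "m \<le> B"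
    have "C * cos \<theta> powr (- \<kappa> / 2 - m) * exp (- m * \<bar>u\<bar>) \<le> max C 1 * cos \<theta> powr (- \<kappa> / 2 - m) * exp (- m * \<bar>u\<bar>)"
      by (intro mult_right_mono) auto
    then show "norm (\<phi> (Complex u \<theta>)) \<le> max C 1 * cos \<theta> powr (- \<kappa> / 2 - m) * exp (- m * \<bar>u\<bar>)"
      using C[OF *, of u] by linarith
  qed
qed

lemma cos_strip_pos: "\<bar>\<theta>\<bar> < pi / 2 \<Longrightarrow> cos \<theta> > 0"
  by (intro cos_gt_zero_pi) auto

lemma continuous_phi:
  assumes "\<bar>\<theta>\<bar> < pi / 2"
  shows "continuous_on UNIV (\<lambda>u. \<phi> (Complex u \<theta>))"
proof -
  have "continuous_on UNIV (\<phi> \<circ> (\<lambda>u. Complex u \<theta>))"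
  proof (rule continuous_on_compose)
    show "continuous_on UNIV (\<lambda>u. Complex u \<theta>)"
      unfolding Complex_eq by (intro continuous_intros)
    show "continuous_on (range (\<lambda>u. Complex u \<theta>)) \<phi>"
      by (rule continuous_on_subset[OF holomorphic_on_imp_continuous_on[OF holo]]) (use assms in auto)
  qed
  then show ?thesis by (simp add: o_def)
qed

lemma measurable_phi [measurable]:
  assumes "\<bar>\<theta>\<bar> < pi / 2"
  shows "(\<lambda>u. \<phi> (Complex u \<theta>)) \<in> borel_measurable borel"
  using continuous_phi[OF assms] by (rule borel_measurable_continuous_onI)

text \<open>The freedom in the decay rate m beats the factor exp (zw) for any fixed z, uniformly on
  closed substrips.\<close>

lemma strip_bound:
  assumes \<theta>0: "0 \<le> \<theta>0" "\<theta>0 < pi / 2"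
  obtains C where "C > 0"
    "\<And>\<eta> u. \<bar>\<eta>\<bar> \<le> \<theta>0 \<Longrightarrow> norm (\<phi> (Complex u \<eta>) * exp (z * Complex u \<eta>)) \<le> C * exp (- \<bar>u\<bar>)"
proof -
  define m where "m = norm z + 1"
  obtain C where C: "C > 0" "\<And>u \<theta> m'. \<bar>\<theta>\<bar> < pi / 2 \<Longrightarrow> 0 \<le> m' \<Longrightarrow> m' \<le> max m (\<bar>\<kappa>\<bar> + 1) \<Longrightarrow>
      norm (\<phi> (Complex u \<theta>)) \<le> C * cos \<theta> powr (- \<kappa> / 2 - m') * exp (- m' * \<bar>u\<bar>)"
    using decay'[of "max m (\<bar>\<kappa>\<bar> + 1)"] by blast
  \<comment> \<open>The second entry makes the exponent -\<kappa>/2 - M negative, so that the bound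
    is worst at the edge \<theta>0, where the cosine is smallest.\<close>
  define M where "M = max m (\<bar>\<kappa>\<bar> + 1)"
  have M: "M \<ge> m" "M \<ge> \<bar>\<kappa>\<bar> + 1" by (auto simp: M_def)
  have m0: "m > 0" by (simp add: m_def add_nonneg_pos)
  show ?thesis
  proof (rule that)
    show "C * cos \<theta>0 powr (- \<kappa> / 2 - M) * exp (norm z * (pi / 2)) > 0" using C(1) cos_strip_pos[of \<theta>0] \<theta>0 by simp
    fix \<eta> u assume \<eta>: "\<bar>\<eta>\<bar> \<le> \<theta>0"
    have cc: "0 < cos \<theta>0" "cos \<theta>0 \<le> cos \<eta>"
      using \<theta>0 \<eta> cos_strip_pos[of \<theta>0] cos_monotone_0_pi_le[of "\<bar>\<eta>\<bar>" \<theta>0] by (auto simp: cos_abs_real)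
    have "norm (\<phi> (Complex u \<eta>)) \<le> C * cos \<eta> powr (- \<kappa> / 2 - M) * exp (- M * \<bar>u\<bar>)"
      using C(2)[of \<eta> M u] \<eta> \<theta>0 M by (simp add: M_def)
    also have "\<dots> \<le> C * cos \<theta>0 powr (- \<kappa> / 2 - M) * exp (- M * \<bar>u\<bar>)"
      using cc M C by (intro mult_right_mono mult_left_mono powr_mono2') auto
    finally have 1: "norm (\<phi> (Complex u \<eta>)) \<le> C * cos \<theta>0 powr (- \<kappa> / 2 - M) * exp (- M * \<bar>u\<bar>)" .
    have "norm (exp (z * Complex u \<eta>)) \<le> exp (norm (z * Complex u \<eta>))" by (rule norm_exp)
    also have "\<dots> \<le> exp (norm z * (\<bar>u\<bar> + pi / 2))"
      using cmod_le[of "Complex u \<eta>"] \<eta> \<theta>0 by (auto simp: norm_mult intro!: mult_left_mono)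
    finally have 2: "norm (exp (z * Complex u \<eta>)) \<le> exp (norm z * (\<bar>u\<bar> + pi / 2))" .
    have "norm (\<phi> (Complex u \<eta>) * exp (z * Complex u \<eta>)) \<le> (C * cos \<theta>0 powr (- \<kappa> / 2 - M) * exp (- M * \<bar>u\<bar>)) * exp (norm z * (\<bar>u\<bar> + pi / 2))"
      unfolding norm_mult using 1 2 C by (intro mult_mono) auto
    also have "\<dots> = C * cos \<theta>0 powr (- \<kappa> / 2 - M) * exp (norm z * (pi / 2)) * exp (norm z * \<bar>u\<bar> - M * \<bar>u\<bar>)"
      by (simp add: exp_add[symmetric] exp_diff exp_minus field_simps)
    also have "\<dots> \<le> C * cos \<theta>0 powr (- \<kappa> / 2 - M) * exp (norm z * (pi / 2)) * exp (- \<bar>u\<bar>)"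
    proof -
      have "(norm z + 1) * \<bar>u\<bar> \<le> M * \<bar>u\<bar>" using M by (intro mult_right_mono) (auto simp: m_def)
      then show ?thesis using C by (intro mult_left_mono) (auto simp: algebra_simps)
    qed
    finally show "norm (\<phi> (Complex u \<eta>) * exp (z * Complex u \<eta>)) \<le> C * cos \<theta>0 powr (- \<kappa> / 2 - M) * exp (norm z * (pi / 2)) * exp (- \<bar>u\<bar>)" .
  qed
qed

lemma integrable_exp_abs: "a > 0 \<Longrightarrow> integrable lborel (\<lambda>u::real. exp (- a * \<bar>u\<bar>))"
  by (rule exp_kernel_integral(1))

lemma integrable_strip:
  assumes "\<bar>\<theta>\<bar> < pi / 2"
  shows "integrable lborel (\<lambda>u. \<phi> (Complex u \<theta>) * exp (z * Complex u \<theta>))"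
proof -
  note [measurable] = measurable_phi[OF assms]
  obtain C where C: "\<And>\<eta> u. \<bar>\<eta>\<bar> \<le> \<bar>\<theta>\<bar> \<Longrightarrow> norm (\<phi> (Complex u \<eta>) * exp (z * Complex u \<eta>)) \<le> C * exp (- \<bar>u\<bar>)"
    using strip_bound[of "\<bar>\<theta>\<bar>" z] assms by (metis abs_ge_zero)
  have "integrable lborel (\<lambda>u::real. C * exp (- \<bar>u\<bar>))"
    using integrable_exp_abs[of 1] by simp
  then show ?thesis
  proof (rule Bochner_Integration.integrable_bound)
    have [measurable]: "(\<lambda>u. exp (z * Complex u \<theta>)) \<in> borel_measurable borel"
      unfolding Complex_eq by (intro borel_measurable_continuous_onI continuous_intros)
    show "(\<lambda>u. \<phi> (Complex u \<theta>) * exp (z * Complex u \<theta>)) \<in> borel_measurable lborel" by measurable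
    show "AE u in lborel. norm (\<phi> (Complex u \<theta>) * exp (z * Complex u \<theta>)) \<le> norm (C * exp (- \<bar>u\<bar>))"
      using order_trans[OF C[of \<theta>] abs_ge_self] by (intro AE_I2) simp
  qed
qed

text \<open>Contour shift by means of a primitive of \<open>\<phi> w * exp (z * w)\<close> on the
  convex strip: the truncated integrals over the two lines are differences of its endpoint values,
  and they differ by vertical increments of size O(e^(-n)).\<close>

lemma laplace_rotate:
  assumes \<theta>: "\<bar>\<theta>\<bar> < pi / 2"
  shows "laplace z = (\<integral>u. \<phi> (Complex u \<theta>) * exp (z * Complex u \<theta>) \<partial>lborel)"
proof -
  define S where "S = {w :: complex. \<bar>Im w\<bar> < pi / 2}"
  define \<Phi> where "\<Phi> w = \<phi> w * exp (z * w)" for w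
  have S: "convex S" "open S"
  proof -
    have "S = {w. Im w < pi / 2} \<inter> {w. Im w > - (pi / 2)}" by (auto simp: S_def abs_less_iff)
    then show "convex S" "open S"
      by (simp_all only: convex_Int convex_halfspace_Im_lt convex_halfspace_Im_gt open_Int open_halfspace_Im_lt open_halfspace_Im_gt)
  qed
  have "\<Phi> holomorphic_on S" unfolding \<Phi>_def S_def by (intro holomorphic_intros holo)
  then obtain P where P0: "\<And>w. w \<in> S \<Longrightarrow> (P has_field_derivative \<Phi> w) (at w within S)"
    using holomorphic_convex_primitive'[OF S] by blast
  have P: "(P has_field_derivative \<Phi> w) (at w)" if "w \<in> S" for w
    using P0[OF that] at_within_open[OF that S(2)] by simp
  obtain C where C: "C > 0" "\<And>\<eta> u. \<bar>\<eta>\<bar> \<le> \<bar>\<theta>\<bar> \<Longrightarrow> norm (\<Phi> (Complex u \<eta>)) \<le> C * exp (- \<bar>u\<bar>)"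
    using strip_bound[of "\<bar>\<theta>\<bar>" z] \<theta> unfolding \<Phi>_def by auto
  have vert: "norm (P (Complex u \<theta>) - P (Complex u 0)) \<le> C * exp (- \<bar>u\<bar>) * \<bar>\<theta>\<bar>" for u
  proof -
    have seg: "Re w = u \<and> \<bar>Im w\<bar> \<le> \<bar>\<theta>\<bar>" if w: "w \<in> closed_segment (Complex u 0) (Complex u \<theta>)" for w
    proof -
      obtain r where r: "0 \<le> r" "r \<le> 1" "w = (1 - r) *\<^sub>R Complex u 0 + r *\<^sub>R Complex u \<theta>"
        using w by (auto simp: closed_segment_def)
      have "Re w = u" unfolding r(3) by (simp add: left_diff_distrib)
      moreover have "\<bar>Im w\<bar> = r * \<bar>\<theta>\<bar>" using r by (simp add: abs_mult)
      ultimately show ?thesis using r mult_right_mono[of r 1 "\<bar>\<theta>\<bar>"] by simp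
    qed
    have "norm (P (Complex u \<theta>) - P (Complex u 0)) \<le> C * exp (- \<bar>u\<bar>) * norm (Complex u \<theta> - Complex u 0)"
    proof (rule field_differentiable_bound[of "closed_segment (Complex u 0) (Complex u \<theta>)" P \<Phi>])
      fix w assume w: "w \<in> closed_segment (Complex u 0) (Complex u \<theta>)"
      have "w \<in> S" using seg[OF w] \<theta> by (auto simp: S_def)
      then show "(P has_field_derivative \<Phi> w) (at w within closed_segment (Complex u 0) (Complex u \<theta>))"
        using P has_field_derivative_at_within by blast
      show "norm (\<Phi> w) \<le> C * exp (- \<bar>u\<bar>)"
      proof -
        have "Complex u (Im w) = w" using seg[OF w] by (simp add: complex_eq_iff)
        then show ?thesis using seg[OF w] C(2)[of "Im w" u] by simp
      qed
    qed auto
    also have "norm (Complex u \<theta> - Complex u 0) = \<bar>\<theta>\<bar>" by (simp add: cmod_def)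
    finally show ?thesis .
  qed
  have int: "integrable lborel (\<lambda>u. \<Phi> (Complex u \<eta>))" if "\<bar>\<eta>\<bar> < pi / 2" for \<eta>
    unfolding \<Phi>_def using integrable_strip[OF that] .
  have FTC: "(\<integral>u. indicator {- real n..real n} u *\<^sub>R \<Phi> (Complex u \<eta>) \<partial>lborel) = P (Complex (real n) \<eta>) - P (Complex (- real n) \<eta>)"
    if \<eta>: "\<bar>\<eta>\<bar> < pi / 2" for \<eta> n
  proof (rule integral_FTC_Icc)
    show "((\<lambda>u. P (Complex u \<eta>)) has_vector_derivative \<Phi> (Complex u \<eta>)) (at u within {- real n..real n})" for u
    proof -
      have "((\<lambda>z. P (z + \<i> * of_real \<eta>)) has_field_derivative \<Phi> (Complex u \<eta>)) (at (of_real u))"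
      proof -
        have "(P has_field_derivative \<Phi> (Complex u \<eta>)) (at (of_real u + \<i> * of_real \<eta>))"
          using P[of "Complex u \<eta>"] \<eta> by (simp add: S_def Complex_eq)
        then show ?thesis using DERIV_shift by (metis add.commute)
      qed
      from has_vector_derivative_real_field[OF this]
      show ?thesis by (simp add: Complex_eq)
    qed
    have "continuous_on UNIV (\<lambda>u. \<Phi> (Complex u \<eta>))"
      unfolding \<Phi>_def by (intro continuous_intros continuous_phi \<eta>)
    then show "continuous_on {- real n..real n} (\<lambda>u. \<Phi> (Complex u \<eta>))" by (rule continuous_on_subset) simp
  qed simp
  have lim: "(\<lambda>n. P (Complex (real n) \<eta>) - P (Complex (- real n) \<eta>)) \<longlonglongrightarrow> (\<integral>u. \<Phi> (Complex u \<eta>) \<partial>lborel)"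
    if \<eta>: "\<bar>\<eta>\<bar> < pi / 2" for \<eta>
    unfolding FTC[OF \<eta>, symmetric]
  proof (rule integral_dominated_convergence[where w = "\<lambda>u. norm (\<Phi> (Complex u \<eta>))"])
    note [measurable] = borel_measurable_integrable[OF int[OF \<eta>]]
    show "(\<lambda>u. \<Phi> (Complex u \<eta>)) \<in> borel_measurable lborel" by measurable
    show "(\<lambda>u. indicator {- real n..real n} u *\<^sub>R \<Phi> (Complex u \<eta>)) \<in> borel_measurable lborel" for n by measurable
    show "integrable lborel (\<lambda>u. norm (\<Phi> (Complex u \<eta>)))" using int[OF \<eta>] by simp
    show "AE u in lborel. (\<lambda>n. indicator {- real n..real n} u *\<^sub>R \<Phi> (Complex u \<eta>)) \<longlonglongrightarrow> \<Phi> (Complex u \<eta>)"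
    proof (rule AE_I2, rule tendsto_eventually)
      fix u :: real
      obtain N :: nat where "\<bar>u\<bar> \<le> real N" using real_arch_simple by blast
      then show "eventually (\<lambda>n. indicator {- real n..real n} u *\<^sub>R \<Phi> (Complex u \<eta>) = \<Phi> (Complex u \<eta>)) sequentially"
        by (intro eventually_sequentiallyI[of N]) (auto simp: indicator_def)
    qed
  qed (auto simp: indicator_def)
  have "(\<lambda>n. (P (Complex (real n) \<theta>) - P (Complex (- real n) \<theta>)) - (P (Complex (real n) 0) - P (Complex (- real n) 0))) \<longlonglongrightarrow> 0"
  proof (rule Lim_null_comparison)
    show "eventually (\<lambda>n. norm ((P (Complex (real n) \<theta>) - P (Complex (- real n) \<theta>)) - (P (Complex (real n) 0) - P (Complex (- real n) 0))) \<le> 2 * (C * \<bar>\<theta>\<bar>) * exp (- real n)) sequentially"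
    proof (rule always_eventually, rule allI)
      fix n :: nat
      have "norm ((P (Complex (real n) \<theta>) - P (Complex (real n) 0)) - (P (Complex (- real n) \<theta>) - P (Complex (- real n) 0))) \<le> C * exp (- \<bar>real n\<bar>) * \<bar>\<theta>\<bar> + C * exp (- \<bar>- real n\<bar>) * \<bar>\<theta>\<bar>"
        by (rule order_trans[OF norm_triangle_ineq4 add_mono[OF vert vert]])
      then show "norm ((P (Complex (real n) \<theta>) - P (Complex (- real n) \<theta>)) - (P (Complex (real n) 0) - P (Complex (- real n) 0))) \<le> 2 * (C * \<bar>\<theta>\<bar>) * exp (- real n)"
        by (simp add: algebra_simps)
    qed
    have "((\<lambda>n. exp (- real n)) \<longlongrightarrow> 0) sequentially" by real_asymp
    from tendsto_mult_left[OF this, of "2 * (C * \<bar>\<theta>\<bar>)"]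
    show "((\<lambda>n. 2 * (C * \<bar>\<theta>\<bar>) * exp (- real n)) \<longlongrightarrow> 0) sequentially" by simp
  qed
  moreover have "(\<lambda>n. (P (Complex (real n) \<theta>) - P (Complex (- real n) \<theta>)) - (P (Complex (real n) 0) - P (Complex (- real n) 0))) \<longlonglongrightarrow>
       (\<integral>u. \<Phi> (Complex u \<theta>) \<partial>lborel) - (\<integral>u. \<Phi> (Complex u 0) \<partial>lborel)"
    using \<theta> by (intro tendsto_diff lim) auto
  ultimately have "(\<integral>u. \<Phi> (Complex u \<theta>) \<partial>lborel) - (\<integral>u. \<Phi> (Complex u 0) \<partial>lborel) = 0"
    using LIMSEQ_unique by blast
  then show ?thesis by (simp add: laplace_def \<Phi>_def complex_of_real_def)
qed

text \<open>For z = b + it the factor exp (zw) on Im w = \<theta> has modulus exp (bu - \<theta>t),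
  so multiplying the transform by exp (\<theta>t) leaves an ordinary Fourier transform. The last
  identity keeps the phase, because short integrals are formed before taking absolute
  values.\<close>

lemma laplace_rotated_fourier:
  assumes \<theta>: "\<bar>\<theta>\<bar> < pi / 2"
  shows "integrable lborel (\<lambda>u. \<phi> (Complex u \<theta>) * exp (of_real (b * u)))"
    "norm (laplace (Complex b t)) * exp (\<theta> * t) =
       norm (\<integral>u. \<phi> (Complex u \<theta>) * exp (of_real (b * u)) * exp (\<i> * of_real (t * u)) \<partial>lborel)"
    "laplace (Complex 0 t) * of_real (exp (\<theta> * t)) = (\<integral>u. \<phi> (Complex u \<theta>) * exp (\<i> * of_real (t * u)) \<partial>lborel)"
proof -
  have e: "exp (Complex b t * Complex u \<theta>) = exp (Complex (- (\<theta> * t)) (b * \<theta>)) * (exp (of_real (b * u)) * exp (\<i> * of_real (t * u)))" for u b t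
  proof -
    have "Complex b t * Complex u \<theta> = Complex (- (\<theta> * t)) (b * \<theta>) + (of_real (b * u) + \<i> * of_real (t * u))"
      by (simp add: complex_eq_iff algebra_simps)
    then show ?thesis by (simp only: exp_add)
  qed
  have L: "laplace (Complex b t) = exp (Complex (- (\<theta> * t)) (b * \<theta>)) * (\<integral>u. \<phi> (Complex u \<theta>) * exp (of_real (b * u)) * exp (\<i> * of_real (t * u)) \<partial>lborel)" for b t
    unfolding laplace_rotate[OF \<theta>] e by (simp only: integral_mult_right_zero[symmetric]) (simp only: mult_ac)
  show "norm (laplace (Complex b t)) * exp (\<theta> * t) =
       norm (\<integral>u. \<phi> (Complex u \<theta>) * exp (of_real (b * u)) * exp (\<i> * of_real (t * u)) \<partial>lborel)"
    unfolding L norm_mult by (simp add: norm_exp_eq_Re exp_minus)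
  show "laplace (Complex 0 t) * of_real (exp (\<theta> * t)) = (\<integral>u. \<phi> (Complex u \<theta>) * exp (\<i> * of_real (t * u)) \<partial>lborel)"
  proof -
    have "Complex (- (\<theta> * t)) (0 * \<theta>) = of_real (- (\<theta> * t))" by (simp add: complex_eq_iff)
    then have "exp (Complex (- (\<theta> * t)) (0 * \<theta>)) * of_real (exp (\<theta> * t)) = 1"
      by (simp only: exp_of_real of_real_mult[symmetric]) (simp add: exp_minus)
    then have "laplace (Complex 0 t) * of_real (exp (\<theta> * t)) = (\<integral>u. \<phi> (Complex u \<theta>) * exp (of_real (0 * u)) * exp (\<i> * of_real (t * u)) \<partial>lborel)"
      unfolding L by (metis (no_types, lifting) mult.assoc mult.commute mult.right_neutral)
    then show ?thesis by simp
  qed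
  have "integrable lborel (\<lambda>u. exp (- (\<i> * of_real (b * \<theta>))) * (\<phi> (Complex u \<theta>) * exp (of_real b * Complex u \<theta>)))"
    by (intro Bochner_Integration.integrable_mult_right integrable_strip \<theta>)
  moreover have "exp (- (\<i> * of_real (b * \<theta>))) * (\<phi> (Complex u \<theta>) * exp (of_real b * Complex u \<theta>)) = \<phi> (Complex u \<theta>) * exp (of_real (b * u))" for u
  proof -
    have "of_real b * Complex u \<theta> = of_real (b * u) + \<i> * of_real (b * \<theta>)" by (simp add: complex_eq_iff)
    then show ?thesis by (simp add: exp_add exp_minus del: of_real_mult)
  qed
  ultimately show "integrable lborel (\<lambda>u. \<phi> (Complex u \<theta>) * exp (of_real (b * u)))" by (simp only:)
qed

lemma integrable_phi_exp: "integrable lborel (\<lambda>u. norm (\<phi> (of_real u)) * exp (r * \<bar>u\<bar>))"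
proof -
  note [measurable] = measurable_phi[of 0, folded complex_of_real_def]
  have i: "integrable lborel (\<lambda>u. norm (\<phi> (of_real u) * exp (of_real (b * u))))" for b
    using laplace_rotated_fourier(1)[of 0 b] by (simp add: complex_of_real_def del: of_real_mult)
  show ?thesis
  proof (rule Bochner_Integration.integrable_bound[OF Bochner_Integration.integrable_add[OF i[of r] i[of "-r"]]])
    show "AE u in lborel. norm (norm (\<phi> (of_real u)) * exp (r * \<bar>u\<bar>)) \<le>
      norm (norm (\<phi> (of_real u) * exp (of_real (r * u))) + norm (\<phi> (of_real u) * exp (of_real (- r * u))))"
    proof (rule AE_I2)
      fix u :: real
      have "exp (r * \<bar>u\<bar>) \<le> exp (r * u) + exp (- r * u)" by (cases "u \<ge> 0") auto
      then have "norm (\<phi> (of_real u)) * exp (r * \<bar>u\<bar>) \<le> norm (\<phi> (of_real u)) * (exp (r * u) + exp (- r * u))"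
        by (rule mult_left_mono) simp
      then show "norm (norm (\<phi> (of_real u)) * exp (r * \<bar>u\<bar>)) \<le>
      norm (norm (\<phi> (of_real u) * exp (of_real (r * u))) + norm (\<phi> (of_real u) * exp (of_real (- r * u))))"
        by (simp add: norm_mult norm_exp_eq_Re distrib_left)
    qed
  qed measurable
qed

text \<open>Expanding exp (zu) under the integral, with majorant exp (|z| |u|), gives a power series
  in z that converges everywhere.\<close>

lemma laplace_entire: "laplace holomorphic_on UNIV"
proof -
  note [measurable] = measurable_phi[of 0, folded complex_of_real_def]
  define c where "c n = (\<integral>u. \<phi> (of_real u) * of_real (u ^ n / fact n) \<partial>lborel)" for n
  have sums: "(\<lambda>n. c n * (z - 0) ^ n) sums laplace z" for z
  proof -
    define f where "f n u = \<phi> (of_real u) * of_real (u ^ n / fact n) * z ^ n" for n u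
    have expn: "(\<lambda>n. (norm z * \<bar>u\<bar>) ^ n / fact n) sums exp (norm z * \<bar>u\<bar>)" for u
      using exp_converges[of "norm z * \<bar>u\<bar>"] by (simp add: divide_inverse mult.commute)
    have nf: "norm (f n u) = norm (\<phi> (of_real u)) * ((norm z * \<bar>u\<bar>) ^ n / fact n)" for n u
      by (simp add: f_def norm_mult norm_divide norm_power power_mult_distrib)
    have part: "(\<Sum>n<N. norm (f n u)) \<le> norm (\<phi> (of_real u)) * exp (norm z * \<bar>u\<bar>)" for N u
    proof -
      have "(\<Sum>n<N. (norm z * \<bar>u\<bar>) ^ n / fact n) \<le> exp (norm z * \<bar>u\<bar>)"
        by (rule sum_le_suminf[OF sums_summable[OF expn], unfolded sums_unique[OF expn, symmetric]]) auto
      then show ?thesis unfolding nf sum_distrib_left[symmetric] by (rule mult_left_mono) simp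
    qed
    have int: "integrable lborel (f n)" for n
    proof (rule Bochner_Integration.integrable_bound[OF integrable_phi_exp[of "norm z"]])
      show "AE u in lborel. norm (f n u) \<le> norm (norm (\<phi> (of_real u)) * exp (norm z * \<bar>u\<bar>))"
      proof (rule AE_I2)
        fix u
        have "norm (f n u) \<le> (\<Sum>n<Suc n. norm (f n u))" by (simp add: sum_nonneg)
        also have "\<dots> \<le> norm (\<phi> (of_real u)) * exp (norm z * \<bar>u\<bar>)" by (rule part)
        finally show "norm (f n u) \<le> norm (norm (\<phi> (of_real u)) * exp (norm z * \<bar>u\<bar>))" by simp
      qed
      show "f n \<in> borel_measurable lborel" unfolding f_def by measurable
    qed
    have s: "(\<lambda>n. integral\<^sup>L lborel (f n)) sums (\<integral>u. (\<Sum>n. f n u) \<partial>lborel)"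
    proof (rule sums_integral)
      show "AE u in lborel. summable (\<lambda>n. norm (f n u))"
        unfolding nf by (intro AE_I2 summable_mult sums_summable[OF expn])
      show "summable (\<lambda>n. \<integral>u. norm (f n u) \<partial>lborel)"
      proof (rule summableI_nonneg_bounded)
        fix N
        have "(\<Sum>n<N. \<integral>u. norm (f n u) \<partial>lborel) = (\<integral>u. (\<Sum>n<N. norm (f n u)) \<partial>lborel)"
          by (rule Bochner_Integration.integral_sum[symmetric]) (use int in auto)
        also have "\<dots> \<le> (\<integral>u. norm (\<phi> (of_real u)) * exp (norm z * \<bar>u\<bar>) \<partial>lborel)"
          by (rule integral_mono) (use int integrable_phi_exp part in auto)
        finally show "(\<Sum>n<N. \<integral>u. norm (f n u) \<partial>lborel) \<le> (\<integral>u. norm (\<phi> (of_real u)) * exp (norm z * \<bar>u\<bar>) \<partial>lborel)" .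
      qed simp
    qed (rule int)
    have "(\<Sum>n. f n u) = \<phi> (of_real u) * exp (z * of_real u)" for u
    proof -
      have "(\<lambda>n. \<phi> (of_real u) * ((z * of_real u) ^ n /\<^sub>R fact n)) sums (\<phi> (of_real u) * exp (z * of_real u))"
        by (intro sums_mult exp_converges)
      moreover have "\<phi> (of_real u) * ((z * of_real u) ^ n /\<^sub>R fact n) = f n u" for n
        by (simp add: f_def scaleR_conv_of_real power_mult_distrib field_simps)
      ultimately show ?thesis by (simp add: sums_iff)
    qed
    moreover have "integral\<^sup>L lborel (f n) = c n * (z - 0) ^ n" for n
      unfolding f_def c_def by simp
    ultimately show ?thesis using s by (simp add: laplace_def)
  qed
  show ?thesis
    unfolding holomorphic_on_def
  proof
    fix z :: complex
    have "laplace holomorphic_on ball 0 (norm z + 1)"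
      by (rule power_series_holomorphic) (rule sums)
    then have "laplace field_differentiable at z"
      by (rule holomorphic_on_imp_differentiable_at) auto
    then show "laplace field_differentiable at z within UNIV" by simp
  qed
qed

section \<open>Mean squares of the transform\<close>

lemma integral_exp_shift:
  assumes "b > (0::real)"
  shows "integrable lborel (\<lambda>u. exp (- b * \<bar>u + l\<bar>))" "(\<integral>u. exp (- b * \<bar>u + l\<bar>) \<partial>lborel) = 2 / b"
proof -
  \<comment> \<open>The Poisson kernel at frequency 0 has the value 2/b.\<close>
  have "(\<integral>t. of_real (exp (- b * \<bar>t\<bar>)) * exp (\<i> * of_real (t * 0)) \<partial>lborel) = complex_of_real (2 * b / (b\<^sup>2 + 0\<^sup>2))"
    by (rule exp_kernel_integral(2)[OF assms])
  then have "complex_of_real (\<integral>t. exp (- b * \<bar>t\<bar>) \<partial>lborel) = of_real (2 * b / b\<^sup>2)"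
    by simp
  then have "(\<integral>t. exp (- b * \<bar>t\<bar>) \<partial>lborel) = 2 / b"
    using assms unfolding of_real_eq_iff by (simp add: power2_eq_square)
  then show "(\<integral>u. exp (- b * \<bar>u + l\<bar>) \<partial>lborel) = 2 / b"
    using lborel_integral_real_affine[of 1 "\<lambda>u. exp (- b * \<bar>u\<bar>)" l] by (simp add: add.commute)
  show "integrable lborel (\<lambda>u. exp (- b * \<bar>u + l\<bar>))"
    using lborel_integrable_real_affine[OF exp_kernel_integral(1)[OF assms], of 1 l] by (simp add: add.commute)
qed

text \<open>With l = -ln (cos \<theta>) the best decay rate changes at |u| = l. Taking m = b/2
  inside and m = 3b/2 outside bounds the squared function by a multiple of exp (-b | |u| - l |),
  whose integral is O(1/b). At b = 0 it would be flat for |u| < l, and its integral would grow like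
  l, a logarithm of cos \<theta>.\<close>

lemma laplace_mean_square:
  obtains C where "C > 0" "\<And>b \<theta> a. 0 < b \<Longrightarrow> b \<le> B \<Longrightarrow> \<bar>\<theta>\<bar> < pi / 2 \<Longrightarrow> a > 0 \<Longrightarrow>
    integrable lborel (\<lambda>t. exp (- a * \<bar>t\<bar>) * (norm (laplace (Complex b t)) * exp (\<theta> * t))\<^sup>2) \<and>
    (\<integral>t. exp (- a * \<bar>t\<bar>) * (norm (laplace (Complex b t)) * exp (\<theta> * t))\<^sup>2 \<partial>lborel) \<le> C / b * cos \<theta> powr (- \<kappa> - 2 * b)"
proof -
  obtain C where C: "C > 0" "\<And>u \<theta> m. \<bar>\<theta>\<bar> < pi / 2 \<Longrightarrow> 0 \<le> m \<Longrightarrow> m \<le> 3 / 2 * B \<Longrightarrow>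
      norm (\<phi> (Complex u \<theta>)) \<le> C * cos \<theta> powr (- \<kappa> / 2 - m) * exp (- m * \<bar>u\<bar>)"
    using decay'[of "3 / 2 * B"] by blast
  show ?thesis
  proof (rule that)
    show "8 * pi * C\<^sup>2 > 0" using C(1) by simp
    fix b \<theta> a :: real assume b: "0 < b" "b \<le> B" and \<theta>: "\<bar>\<theta>\<bar> < pi / 2" and a: "a > 0"
    note [measurable] = measurable_phi[OF \<theta>]
    define c where "c = cos \<theta>"
    have c: "0 < c" "c \<le> 1" using cos_strip_pos[OF \<theta>] by (auto simp: c_def)
    define l where "l = - ln c"
    have l0: "l \<ge> 0" using c by (simp add: l_def)
    have cl: "c powr x = exp (- x * l)" for x using c by (simp add: l_def powr_def)
    define \<psi> where "\<psi> u = \<phi> (Complex u \<theta>) * exp (of_real (b * u))" for u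
    have \<psi>: "integrable lborel \<psi>" unfolding \<psi>_def by (rule laplace_rotated_fourier(1)[OF \<theta>])
    let ?g = "\<lambda>u. C\<^sup>2 * c powr (- \<kappa> - 2 * b) * (exp (- b * \<bar>u + (- l)\<bar>) + exp (- b * \<bar>u + l\<bar>))"
    have mb: "(norm (\<psi> u))\<^sup>2 \<le> C\<^sup>2 * exp ((\<kappa> + 2 * m) * l + 2 * (b - m) * \<bar>u\<bar>)"
      if m: "0 \<le> m" "m \<le> 3 / 2 * b" for m u
    proof -
      have "norm (exp (of_real (b * u) :: complex)) \<le> exp (b * \<bar>u\<bar>)"
        using b by (simp add: norm_exp_eq_Re mult_left_mono)
      moreover have "norm (\<phi> (Complex u \<theta>)) \<le> C * c powr (- \<kappa> / 2 - m) * exp (- m * \<bar>u\<bar>)"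
        unfolding c_def using m b by (intro C(2) \<theta>) auto
      ultimately have "norm (\<psi> u) \<le> (C * c powr (- \<kappa> / 2 - m) * exp (- m * \<bar>u\<bar>)) * exp (b * \<bar>u\<bar>)"
        unfolding \<psi>_def norm_mult using C(1) by (intro mult_mono) auto
      also have "\<dots> = C * exp ((\<kappa> / 2 + m) * l + (b - m) * \<bar>u\<bar>)"
        unfolding cl by (simp add: exp_add[symmetric] mult.assoc) (simp add: algebra_simps)
      finally have "(norm (\<psi> u))\<^sup>2 \<le> (C * exp ((\<kappa> / 2 + m) * l + (b - m) * \<bar>u\<bar>))\<^sup>2"
        by (rule power_mono) simp
      also have "\<dots> = C\<^sup>2 * exp ((\<kappa> + 2 * m) * l + 2 * (b - m) * \<bar>u\<bar>)"
        by (simp add: power_mult_distrib exp_double[symmetric] algebra_simps)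
      finally show ?thesis .
    qed
    have \<psi>g: "(norm (\<psi> u))\<^sup>2 \<le> ?g u" for u
    proof -
      have "(norm (\<psi> u))\<^sup>2 \<le> C\<^sup>2 * exp ((\<kappa> + 2 * b) * l - b * \<bar>\<bar>u\<bar> - l\<bar>)"
      proof (cases "\<bar>u\<bar> \<ge> l")
        case True
        have "(norm (\<psi> u))\<^sup>2 \<le> C\<^sup>2 * exp ((\<kappa> + 2 * (3 / 2 * b)) * l + 2 * (b - 3 / 2 * b) * \<bar>u\<bar>)"
          using b by (intro mb) auto
        also have "(\<kappa> + 2 * (3 / 2 * b)) * l + 2 * (b - 3 / 2 * b) * \<bar>u\<bar> = (\<kappa> + 2 * b) * l - b * \<bar>\<bar>u\<bar> - l\<bar>"
          using True by (simp add: algebra_simps)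
        finally show ?thesis .
      next
        case False
        have "(norm (\<psi> u))\<^sup>2 \<le> C\<^sup>2 * exp ((\<kappa> + 2 * (1 / 2 * b)) * l + 2 * (b - 1 / 2 * b) * \<bar>u\<bar>)"
          using b by (intro mb) auto
        also have "(\<kappa> + 2 * (1 / 2 * b)) * l + 2 * (b - 1 / 2 * b) * \<bar>u\<bar> = (\<kappa> + 2 * b) * l - b * \<bar>\<bar>u\<bar> - l\<bar>"
          using False by (simp add: algebra_simps)
        finally show ?thesis .
      qed
      also have "\<dots> = C\<^sup>2 * c powr (- \<kappa> - 2 * b) * exp (- b * \<bar>\<bar>u\<bar> - l\<bar>)"
        unfolding cl by (simp add: exp_add[symmetric] mult.assoc algebra_simps)
      also have "\<dots> \<le> ?g u"
      proof (intro mult_left_mono)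
        show "exp (- b * \<bar>\<bar>u\<bar> - l\<bar>) \<le> exp (- b * \<bar>u + (- l)\<bar>) + exp (- b * \<bar>u + l\<bar>)"
        proof (cases "u \<ge> 0")
          case False
          then have "\<bar>\<bar>u\<bar> - l\<bar> = \<bar>u + l\<bar>" by linarith
          then show ?thesis by simp
        qed auto
      qed auto
      finally show ?thesis .
    qed
    have g: "integrable lborel ?g" "integral\<^sup>L lborel ?g = C\<^sup>2 * c powr (- \<kappa> - 2 * b) * (2 / b + 2 / b)"
      using integral_exp_shift[OF b(1), of "-l"] integral_exp_shift[OF b(1), of l] by simp_all
    have \<psi>2: "integrable lborel (\<lambda>u. (norm (\<psi> u))\<^sup>2)"
    proof (rule Bochner_Integration.integrable_bound[OF g(1)])
      show "AE u in lborel. norm ((norm (\<psi> u))\<^sup>2) \<le> norm (?g u)"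
        using \<psi>g by (intro AE_I2) (metis abs_ge_self abs_power2 order_trans real_norm_def)
      show "(\<lambda>u. (norm (\<psi> u))\<^sup>2) \<in> borel_measurable lborel"
        using borel_measurable_integrable[OF \<psi>] by measurable
    qed
    have eq: "exp (- a * \<bar>t\<bar>) * (norm (\<integral>u. \<psi> u * exp (\<i> * of_real (t * u)) \<partial>lborel))\<^sup>2
        = exp (- a * \<bar>t\<bar>) * (norm (laplace (Complex b t)) * exp (\<theta> * t))\<^sup>2" for t
      unfolding laplace_rotated_fourier(2)[OF \<theta>] \<psi>_def ..
    have "2 * pi * (\<integral>u. (norm (\<psi> u))\<^sup>2 \<partial>lborel) \<le> 2 * pi * integral\<^sup>L lborel ?g"
      by (intro mult_left_mono integral_mono \<psi>2 g(1) \<psi>g) auto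
    also have "\<dots> = 8 * pi * C\<^sup>2 / b * cos \<theta> powr (- \<kappa> - 2 * b)"
      unfolding g(2) by (simp add: c_def field_simps)
    finally show "integrable lborel (\<lambda>t. exp (- a * \<bar>t\<bar>) * (norm (laplace (Complex b t)) * exp (\<theta> * t))\<^sup>2) \<and>
    (\<integral>t. exp (- a * \<bar>t\<bar>) * (norm (laplace (Complex b t)) * exp (\<theta> * t))\<^sup>2 \<partial>lborel) \<le> 8 * pi * C\<^sup>2 / b * cos \<theta> powr (- \<kappa> - 2 * b)"
      using fourier_bessel[OF \<psi> \<psi>2 a] unfolding eq by auto
  qed
qed

text \<open>Integrating over v in [0, H] multiplies \<phi> by k(u), the integral of exp (ivu), and
  |k(u)| is at most min (H, 2/|u|). So |k|^2 has integral O(H), instead of the H^2 that a trivial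
  estimate would cost. Since the saving comes from k, the bound m = 0 for \<phi> is enough.\<close>

lemma laplace_short_mean_square:
  obtains C where "C > 0" "\<And>H \<theta> a. H > 0 \<Longrightarrow> \<bar>\<theta>\<bar> < pi / 2 \<Longrightarrow> a > 0 \<Longrightarrow>
    integrable lborel (\<lambda>t. exp (- a * \<bar>t\<bar>) * (norm (\<integral>v. indicator {0..H} v *\<^sub>R (laplace (Complex 0 (t + v)) * of_real (exp (\<theta> * (t + v)))) \<partial>lborel))\<^sup>2) \<and>
    (\<integral>t. exp (- a * \<bar>t\<bar>) * (norm (\<integral>v. indicator {0..H} v *\<^sub>R (laplace (Complex 0 (t + v)) * of_real (exp (\<theta> * (t + v)))) \<partial>lborel))\<^sup>2 \<partial>lborel)
      \<le> C * H * cos \<theta> powr (- \<kappa>)"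
proof -
  obtain C where C: "C > 0" "\<And>u \<theta> m. \<bar>\<theta>\<bar> < pi / 2 \<Longrightarrow> 0 \<le> m \<Longrightarrow> m \<le> 0 \<Longrightarrow>
      norm (\<phi> (Complex u \<theta>)) \<le> C * cos \<theta> powr (- \<kappa> / 2 - m) * exp (- m * \<bar>u\<bar>)"
    using decay'[of 0] by blast
  show ?thesis
  proof (rule that)
    show "8 * pi\<^sup>2 * C\<^sup>2 > 0" using C(1) by simp
    fix H \<theta> a :: real assume H: "H > 0" and \<theta>: "\<bar>\<theta>\<bar> < pi / 2" and a: "a > 0"
    note [measurable] = measurable_phi[OF \<theta>]
    define c where "c = cos \<theta>"
    have c: "0 < c" using cos_strip_pos[OF \<theta>] by (auto simp: c_def)
    define k :: "real \<Rightarrow> complex" where "k u = (\<integral>v. indicator {0..H} v *\<^sub>R exp (\<i> * of_real (v * u)) \<partial>lborel)" for u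
    have [measurable]: "k \<in> borel_measurable borel" unfolding k_def by measurable
    have k1: "norm (k u) \<le> H" for u
    proof -
      have "norm (k u) \<le> (\<integral>v. norm (indicator {0..H} v *\<^sub>R exp (\<i> * of_real (v * u)) :: complex) \<partial>lborel)"
        unfolding k_def by (rule integral_norm_bound)
      also have "\<dots> = (\<integral>v. indicator {0..H} v \<partial>lborel)"
        by (simp add: norm_exp_eq_Re)
      finally show ?thesis using H by simp
    qed
    \<comment> \<open>The antiderivative of exp (ivu) gives |u k(u)| = |exp (iHu) - 1|.\<close>
    have k2: "\<bar>u\<bar> * norm (k u) \<le> 2" for u
    proof -
      have "(\<integral>v. indicator {0..H} v *\<^sub>R (\<i> * of_real u * exp (\<i> * of_real (v * u))) \<partial>lborel) = exp (\<i> * of_real (H * u)) - exp (\<i> * of_real (0 * u))"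
      proof (rule integral_FTC_Icc)
        show "((\<lambda>v. exp (\<i> * of_real (v * u))) has_vector_derivative \<i> * of_real u * exp (\<i> * of_real (v * u))) (at v within {0..H})" for v
        proof -
          have "((\<lambda>z. exp (\<i> * (z * of_real u))) has_field_derivative \<i> * of_real u * exp (\<i> * (of_real v * of_real u))) (at (of_real v))"
            by (auto intro!: derivative_eq_intros)
          from has_vector_derivative_real_field[OF this] show ?thesis
            by (simp add: has_vector_derivative_at_within)
        qed
        show "continuous_on {0..H} (\<lambda>v. \<i> * of_real u * exp (\<i> * of_real (v * u)))"
          by (intro continuous_intros)
      qed (use H in simp)
      moreover have "(\<integral>v. indicator {0..H} v *\<^sub>R (\<i> * of_real u * exp (\<i> * of_real (v * u))) \<partial>lborel) = \<i> * of_real u * k u"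
        unfolding k_def by (simp only: mult_scaleR_right[symmetric] integral_mult_right_zero)
      ultimately have "norm (\<i> * of_real u * k u) = norm (exp (\<i> * of_real (H * u)) - exp (\<i> * of_real (0 * u)))" by simp
      also have "\<dots> \<le> norm (exp (\<i> * of_real (H * u))) + norm (exp (\<i> * complex_of_real (0 * u)))"
        by (rule norm_triangle_ineq4)
      finally show ?thesis by (simp add: norm_mult norm_exp_eq_Re)
    qed
    \<comment> \<open>The bounds H and 2/|u| cross at |u| = 2/H; the Poisson kernel of this width
      majorizes |k|^2 and has a known integral.\<close>
    define h where "h = 2 / H"
    have h: "h > 0" using H by (simp add: h_def)
    have kk: "(norm (k u))\<^sup>2 \<le> 2 * H * (2 * h / (h\<^sup>2 + u\<^sup>2))" for u
    proof -
      have "(norm (k u))\<^sup>2 \<le> H\<^sup>2" "(\<bar>u\<bar> * norm (k u))\<^sup>2 \<le> 2\<^sup>2"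
        using k1[of u] k2[of u] by (intro power_mono; simp)+
      then have "4 * (norm (k u))\<^sup>2 + H\<^sup>2 * (u\<^sup>2 * (norm (k u))\<^sup>2) \<le> 4 * H\<^sup>2 + H\<^sup>2 * 4"
        by (intro add_mono mult_left_mono) (auto simp: power_mult_distrib)
      then have "(norm (k u))\<^sup>2 * (4 + H\<^sup>2 * u\<^sup>2) \<le> 8 * H\<^sup>2" by (simp add: algebra_simps)
      moreover have p: "4 + H\<^sup>2 * u\<^sup>2 > 0" by (simp add: add_pos_nonneg)
      ultimately have "(norm (k u))\<^sup>2 \<le> 8 * H\<^sup>2 / (4 + H\<^sup>2 * u\<^sup>2)" by (simp add: field_simps)
      also have "\<dots> = 2 * H * (2 * h / (h\<^sup>2 + u\<^sup>2))"
      proof -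
        have "h\<^sup>2 + u\<^sup>2 = (4 + H\<^sup>2 * u\<^sup>2) / H\<^sup>2" using H by (simp add: h_def field_simps)
        then show ?thesis using H p by (simp add: h_def power2_eq_square)
      qed
      finally show ?thesis .
    qed
    define \<psi> where "\<psi> u = \<phi> (Complex u \<theta>) * k u" for u
    have \<phi>i: "integrable lborel (\<lambda>u. \<phi> (Complex u \<theta>))"
      using laplace_rotated_fourier(1)[OF \<theta>, of 0] by simp
    have \<psi>: "integrable lborel \<psi>"
    proof (rule Bochner_Integration.integrable_bound)
      show "integrable lborel (\<lambda>u. H * norm (\<phi> (Complex u \<theta>)))" using \<phi>i by simp
      show "\<psi> \<in> borel_measurable lborel" unfolding \<psi>_def by measurable
      show "AE u in lborel. norm (\<psi> u) \<le> norm (H * norm (\<phi> (Complex u \<theta>)))"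
        using H k1 by (intro AE_I2) (auto simp: \<psi>_def norm_mult mult.commute[of H] intro!: mult_left_mono)
    qed
    let ?g = "\<lambda>u. C\<^sup>2 * c powr (- \<kappa>) * (2 * H) * (2 * h / (h\<^sup>2 + u\<^sup>2))"
    have \<psi>g: "(norm (\<psi> u))\<^sup>2 \<le> ?g u" for u
    proof -
      have "(norm (\<phi> (Complex u \<theta>)))\<^sup>2 \<le> (C * c powr (- \<kappa> / 2))\<^sup>2"
        using C(2)[OF \<theta>, of 0 u] by (intro power_mono) (auto simp: c_def)
      also have "\<dots> = C\<^sup>2 * c powr (- \<kappa>)"
        using c by (simp add: power_mult_distrib powr_power)
      finally show ?thesis
        unfolding \<psi>_def norm_mult power_mult_distrib mult.assoc[of _ "2 * H"] using kk[of u] by (intro mult_mono) auto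
    qed
    have g: "integrable lborel ?g" "integral\<^sup>L lborel ?g = C\<^sup>2 * c powr (- \<kappa>) * (2 * H) * (2 * pi)"
      using poisson_kernel_integral[OF h] by (simp_all only: Bochner_Integration.integrable_mult_right integral_mult_right_zero)
    have \<psi>2: "integrable lborel (\<lambda>u. (norm (\<psi> u))\<^sup>2)"
    proof (rule Bochner_Integration.integrable_bound[OF g(1)])
      show "AE u in lborel. norm ((norm (\<psi> u))\<^sup>2) \<le> norm (?g u)"
        using \<psi>g by (intro AE_I2) (metis abs_ge_self abs_power2 order_trans real_norm_def)
      show "(\<lambda>u. (norm (\<psi> u))\<^sup>2) \<in> borel_measurable lborel"
        using borel_measurable_integrable[OF \<psi>] by measurable
    qed
    have eq: "(\<integral>v. indicator {0..H} v *\<^sub>R (laplace (Complex 0 (t + v)) * of_real (exp (\<theta> * (t + v)))) \<partial>lborel)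
      = (\<integral>u. \<psi> u * exp (\<i> * of_real (t * u)) \<partial>lborel)" for t
    proof -
      let ?F = "\<lambda>v u. indicator {0..H} v *\<^sub>R (\<phi> (Complex u \<theta>) * exp (\<i> * of_real ((t + v) * u)))"
      have "(\<integral>v. indicator {0..H} v *\<^sub>R (laplace (Complex 0 (t + v)) * of_real (exp (\<theta> * (t + v)))) \<partial>lborel) = (\<integral>v. \<integral>u. ?F v u \<partial>lborel \<partial>lborel)"
        unfolding laplace_rotated_fourier(3)[OF \<theta>] by (simp only: integral_scaleR_right)
      also have "\<dots> = (\<integral>u. \<integral>v. ?F v u \<partial>lborel \<partial>lborel)"
      proof (rule lborel_pair.Fubini_integral[symmetric], rule integrable_pair_dominated[OF _ _ integrable_norm[OF \<phi>i]])
        show "integrable lborel (indicator {0..H} :: real \<Rightarrow> real)"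
          by (rule integrable_real_indicator) (simp_all add: emeasure_lborel_Icc_eq)
        show "(\<lambda>(v, u). ?F v u) \<in> borel_measurable (lborel \<Otimes>\<^sub>M lborel)" by measurable
      qed (auto simp: norm_mult norm_exp_eq_Re indicator_def)
      also have "\<dots> = (\<integral>u. \<psi> u * exp (\<i> * of_real (t * u)) \<partial>lborel)"
      proof (rule Bochner_Integration.integral_cong[OF refl])
        fix u
        have "(\<integral>v. ?F v u \<partial>lborel) = (\<integral>v. (\<phi> (Complex u \<theta>) * exp (\<i> * of_real (t * u))) * (indicator {0..H} v *\<^sub>R exp (\<i> * of_real (v * u))) \<partial>lborel)"
          by (intro Bochner_Integration.integral_cong[OF refl]) (simp add: distrib_left distrib_right exp_add)
        then show "(\<integral>v. ?F v u \<partial>lborel) = \<psi> u * exp (\<i> * of_real (t * u))"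
          by (simp only: integral_mult_right_zero \<psi>_def k_def mult_ac)
      qed
      finally show ?thesis .
    qed
    have "2 * pi * (\<integral>u. (norm (\<psi> u))\<^sup>2 \<partial>lborel) \<le> 2 * pi * integral\<^sup>L lborel ?g"
      by (intro mult_left_mono integral_mono \<psi>2 g(1) \<psi>g) auto
    also have "\<dots> = 8 * pi\<^sup>2 * C\<^sup>2 * H * cos \<theta> powr (- \<kappa>)"
      unfolding g(2) by (simp add: c_def power2_eq_square)
    finally show "integrable lborel (\<lambda>t. exp (- a * \<bar>t\<bar>) * (norm (\<integral>v. indicator {0..H} v *\<^sub>R (laplace (Complex 0 (t + v)) * of_real (exp (\<theta> * (t + v)))) \<partial>lborel))\<^sup>2) \<and>
    (\<integral>t. exp (- a * \<bar>t\<bar>) * (norm (\<integral>v. indicator {0..H} v *\<^sub>R (laplace (Complex 0 (t + v)) * of_real (exp (\<theta> * (t + v)))) \<partial>lborel))\<^sup>2 \<partial>lborel)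
      \<le> 8 * pi\<^sup>2 * C\<^sup>2 * H * cos \<theta> powr (- \<kappa>)"
      unfolding eq using fourier_bessel(1)[OF \<psi> \<psi>2 a] order_trans[OF fourier_bessel(2)[OF \<psi> \<psi>2 a]] by blast
  qed
qed

end

section \<open>Dirichlet series\<close>

text \<open>The definite description needs uniqueness: the difference of two expansions is a power
  series in q = exp (2 pi i z) that vanishes on the unit disc.\<close>

lemma fourier_coeff_eqI:
  assumes a0: "a 0 = 0"
    and a: "\<And>z. Im z > 0 \<Longrightarrow> (\<lambda>n. a n * exp (2 * of_real pi * \<i> * of_nat n * z)) sums p z"
  shows "fourier_coeff p = a"
  unfolding fourier_coeff_def
proof (rule the_equality)
  show "a 0 = 0 \<and> (\<forall>z\<in>upper_half_plane. (\<lambda>n. a n * exp (2 * of_real pi * \<i> * of_nat n * z)) sums p z)"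
    using a0 a by (simp add: upper_half_plane_def)
  fix b assume b: "b 0 = 0 \<and> (\<forall>z\<in>upper_half_plane. (\<lambda>n. b n * exp (2 * of_real pi * \<i> * of_nat n * z)) sums p z)"
  show "b = a"
  proof (rule ccontr)
    assume "b \<noteq> a"
    then obtain m where m: "b m - a m \<noteq> 0" by (auto simp: fun_eq_iff)
    then have m0: "m > 0" using a0 b by (cases "m = 0") auto
    have "(\<lambda>n. (b n - a n) * (q - 0) ^ n) sums 0" if q: "norm (q - 0) < 1" for q
    proof (cases "q = 0")
      case True
      \<comment> \<open>At q = 0 no z is available; there the series reduces to its term n = 0,
        which vanishes because both sequences start with 0.\<close>
      have "(\<lambda>n. (b n - a n) * (q - 0) ^ n) = (\<lambda>n. 0)" using True a0 b by (auto simp: fun_eq_iff power_0_left)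
      then show ?thesis by simp
    next
      case False
      define z where "z = Ln q / (2 * of_real pi * \<i>)"
      have "Im z = - ln (norm q) / (2 * pi)"
        unfolding z_def by (simp add: Im_divide power2_eq_square field_simps False)
      then have z: "Im z > 0" using q False by (simp add: divide_neg_pos)
      have "exp (2 * of_real pi * \<i> * of_nat n * z) = q ^ n" for n
      proof -
        have "exp (2 * of_real pi * \<i> * of_nat n * z) = exp (2 * of_real pi * \<i> * z) ^ n"
          by (simp add: exp_of_nat_mult[symmetric] mult_ac)
        also have "exp (2 * of_real pi * \<i> * z) = q" unfolding z_def using False by simp
        finally show ?thesis .
      qed
      note e = this
      have "(\<lambda>n. b n * exp (2 * of_real pi * \<i> * of_nat n * z)) sums p z"
        using b z by (simp add: upper_half_plane_def)
      from sums_diff[OF this a[OF z]] show ?thesis unfolding e by (simp add: algebra_simps)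
    qed
    then obtain s where "0 < s" "\<And>z::complex. z \<in> cball 0 s - {0} \<Longrightarrow> (0::complex) \<noteq> 0"
      using powser_0_nonzero[of 1 0 "\<lambda>n. b n - a n" "\<lambda>_. 0" m] m m0 by auto
    moreover have "of_real s \<in> cball 0 s - {0::complex}" using \<open>0 < s\<close> by simp
    ultimately show False by blast
  qed
qed

lemma entire_eqI:
  assumes F: "F holomorphic_on UNIV" and G: "G holomorphic_on UNIV"
    and eq: "\<And>s. Re s > \<sigma> \<Longrightarrow> F s = (G s :: complex)"
  shows "F = G"
proof
  fix w
  have "F w - G w = 0"
  proof (rule analytic_continuation[of "\<lambda>s. F s - G s" UNIV "{s. Re s > \<sigma>}" "of_real (\<sigma> + 1)"])
    show "(\<lambda>s. F s - G s) holomorphic_on UNIV" by (intro holomorphic_intros F G)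
    show "of_real (\<sigma> + 1) islimpt {s. Re s > \<sigma>}"
      by (rule interior_limit_point) (simp add: interior_open open_halfspace_Re_gt)
  qed (use eq in auto)
  then show "F w = G w" by simp
qed

text \<open>Two candidates may come with different abscissas; they agree to the right of the larger
  one, hence everywhere.\<close>

lemma L_function_eqI:
  assumes F: "F holomorphic_on UNIV"
    and sums: "\<And>s. Re s > \<sigma> \<Longrightarrow> (\<lambda>n. fourier_coeff p (Suc n) * of_nat (Suc n) powr (- s)) sums F s"
  shows "L_function p = F"
  unfolding L_function_def
proof (rule the_equality)
  show "F holomorphic_on UNIV \<and>
     (\<exists>\<sigma>::real. \<forall>s. Re s > \<sigma> \<longrightarrow> (\<lambda>n. fourier_coeff p (Suc n) * of_nat (Suc n) powr (- s)) sums F s)"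
    using F sums by blast
  fix G assume G: "G holomorphic_on UNIV \<and>
     (\<exists>\<sigma>::real. \<forall>s. Re s > \<sigma> \<longrightarrow> (\<lambda>n. fourier_coeff p (Suc n) * of_nat (Suc n) powr (- s)) sums G s)"
  then obtain \<tau> :: real where \<tau>: "\<And>s. Re s > \<tau> \<Longrightarrow> (\<lambda>n. fourier_coeff p (Suc n) * of_nat (Suc n) powr (- s)) sums G s"
    by blast
  show "G = F"
  proof (rule entire_eqI[of _ _ "max \<sigma> \<tau>"])
    fix s assume "Re s > max \<sigma> \<tau>"
    then show "G s = F s" using sums[of s] \<tau>[of s] sums_unique2 by auto
  qed (use F G in auto)
qed

text \<open>Euler's integral after the substitution t = l exp u, made in two steps: first t = exp u,
  then a translation by ln l. In this variable the Mellin transform of a form is the Laplace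
  transform of its restriction to the imaginary axis.\<close>

lemma gamma_exp_integral:
  assumes s: "Re s > 0" and l: "l > 0"
  shows "integrable lborel (\<lambda>u. exp (- of_real (l * exp u)) * exp (s * of_real u))"
    "(\<integral>u. exp (- of_real (l * exp u)) * exp (s * of_real u) \<partial>lborel) = of_real l powr (- s) * Gamma s"
proof -
  define f where "f t = of_real t powr (s - 1) / of_real (exp t)" for t :: real
  define g where "g u = exp (- of_real (exp u)) * exp (s * of_real u)" for u :: real
  have ge: "\<bar>exp u\<bar> *\<^sub>R f (exp u) = g u" for u
  proof -
    have "of_real (exp u) powr (s - 1) = exp ((s - 1) * of_real u)"
      by (simp add: powr_def Ln_of_real exp_of_real[symmetric] del: exp_of_real)
    then have "\<bar>exp u\<bar> *\<^sub>R f (exp u) = of_real (exp u) * exp ((s - 1) * of_real u) / of_real (exp (exp u))"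
      by (simp add: f_def scaleR_conv_of_real)
    also have "\<dots> = g u"
      by (simp add: g_def exp_of_real[symmetric] exp_minus exp_add[symmetric] left_diff_distrib field_simps del: exp_of_real)
    finally show ?thesis .
  qed
  have rng: "range exp = {0::real<..}"
  proof -
    have "x \<in> range exp" if "x > 0" for x :: real using exp_ln[OF that] by (metis rangeI)
    then show ?thesis by auto
  qed
  have fa: "f absolutely_integrable_on {0<..}"
    using absolutely_integrable_Gamma_integral'[OF s] unfolding f_def .
  have fi: "integral {0<..} f = Gamma s"
    using Gamma_integral_complex'[OF s] unfolding f_def by (rule integral_unique)
  have "(\<lambda>u. \<bar>exp u\<bar> *\<^sub>R f (exp u)) absolutely_integrable_on UNIV \<and> integral UNIV (\<lambda>u. \<bar>exp u\<bar> *\<^sub>R f (exp u)) = Gamma s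
     \<longleftrightarrow> f absolutely_integrable_on (exp ` UNIV) \<and> integral (exp ` UNIV) f = Gamma s"
    by (rule has_absolute_integral_change_of_variables_real) (auto intro!: derivative_eq_intros inj_onI)
  then have g: "g absolutely_integrable_on UNIV" "integral UNIV g = Gamma s"
    unfolding ge rng using fa fi by auto
  have [measurable]: "g \<in> borel_measurable borel"
    unfolding g_def by (intro borel_measurable_continuous_onI continuous_intros)
  have gi: "integrable lborel g"
    using g(1) by (simp add: set_integrable_def integrable_completion)
  have gI: "integral\<^sup>L lborel g = Gamma s"
  proof -
    have "integral\<^sup>L lborel g = integral\<^sup>L lebesgue g" by (simp add: integral_completion)
    also have "\<dots> = integral UNIV g"
      using set_lebesgue_integral_eq_integral(2)[OF g(1)] by (simp add: set_lebesgue_integral_def)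
    finally show ?thesis by (simp add: g(2))
  qed
  have sh: "g (ln l + 1 * u) = of_real l powr s * (exp (- of_real (l * exp u)) * exp (s * of_real u))" for u
  proof -
    have "exp (ln l + 1 * u) = l * exp u" using l by (simp add: exp_add)
    moreover have "of_real l powr s = exp (s * of_real (ln l))" using l by (simp add: powr_def Ln_of_real)
    moreover have "exp (s * of_real (ln l + 1 * u)) = exp (s * of_real (ln l)) * exp (s * of_real u)"
      by (simp add: distrib_left exp_add)
    ultimately show ?thesis by (simp only: g_def mult_ac)
  qed
  have nz: "of_real l powr s \<noteq> (0::complex)" using l by simp
  have "integrable lborel (\<lambda>u. of_real l powr s * (exp (- of_real (l * exp u)) * exp (s * of_real u)))"
    using lborel_integrable_real_affine[OF gi, of 1 "ln l"] unfolding sh by simp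
  then show "integrable lborel (\<lambda>u. exp (- of_real (l * exp u)) * exp (s * of_real u))"
  proof -
    assume "integrable lborel (\<lambda>u. of_real l powr s * (exp (- of_real (l * exp u)) * exp (s * of_real u)))"
    then have i: "integrable lborel (\<lambda>u. inverse (of_real l powr s) * (of_real l powr s * (exp (- of_real (l * exp u)) * exp (s * of_real u))))"
      by (rule Bochner_Integration.integrable_mult_right)
    have cancel: "inverse A * (A * x) = x" if "A \<noteq> 0" for A x :: complex using that by simp
    show ?thesis using i unfolding cancel[OF nz] .
  qed
  have "Gamma s = (\<integral>u. of_real l powr s * (exp (- of_real (l * exp u)) * exp (s * of_real u)) \<partial>lborel)"
    using lborel_integral_real_affine[of 1 g "ln l"] gI unfolding sh by simp
  also have "\<dots> = of_real l powr s * (\<integral>u. exp (- of_real (l * exp u)) * exp (s * of_real u) \<partial>lborel)"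
    by (rule integral_mult_right_zero)
  finally show "(\<integral>u. exp (- of_real (l * exp u)) * exp (s * of_real u) \<partial>lborel) = of_real l powr (- s) * Gamma s"
    using nz by (simp add: powr_minus)
qed

lemma gamma_exp_integral_real:
  assumes s: "s > 0" and l: "l > (0::real)"
  shows "(\<integral>u. exp (- (l * exp u)) * exp (s * u) \<partial>lborel) = l powr (- s) * Gamma s"
proof -
  have "complex_of_real (\<integral>u. exp (- (l * exp u)) * exp (s * u) \<partial>lborel) = (\<integral>u. exp (- of_real (l * exp u)) * exp (of_real s * of_real u) \<partial>lborel)"
    by (simp flip: integral_complex_of_real exp_of_real)
  also have "\<dots> = of_real l powr (- of_real s) * Gamma (of_real s)"
    using s l by (intro gamma_exp_integral(2)) auto
  also have "\<dots> = of_real (l powr (- s) * Gamma s)"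
    using l by (simp add: powr_of_real[symmetric] Gamma_complex_of_real)
  finally show ?thesis using of_real_eq_iff by blast
qed

text \<open>Termwise integration of the Fourier expansion on the imaginary axis. Shifting s by
  \<kappa>/2 accounts for the factor exp (\<kappa>u/2) in \<phi>, and \<open>rGamma\<close> removes
  the Gamma function.\<close>

lemma (in strip_function) dirichlet_series:
  fixes p :: "complex \<Rightarrow> complex" and r \<alpha> :: real
  assumes r: "r > 0" and \<alpha>: "\<alpha> > 0"
    and a0: "a 0 = 0"
    and a: "\<And>z. Im z > 0 \<Longrightarrow> (\<lambda>n. a n * exp (2 * of_real pi * \<i> * of_nat n * z)) sums p z"
    and bd: "\<And>n. norm (a n) \<le> K * real n powr \<alpha>"
    and \<phi>: "\<And>u. \<phi> (of_real u) = p (\<i> * of_real (r * exp u)) * exp (of_real (\<kappa> / 2 * u))"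
    and s: "Re s > \<alpha> + 1"
  shows "(\<lambda>n. a (Suc n) * of_nat (Suc n) powr (- s)) sums
     (of_real (2 * pi * r) powr s * rGamma s * laplace (s - of_real (\<kappa> / 2)))"
proof -
  define c where "c = 2 * pi * r"
  have c: "c > 0" using r by (simp add: c_def)
  define \<sigma> where "\<sigma> = Re s"
  have \<sigma>: "\<sigma> > \<alpha> + 1" "\<sigma> > 0" using s \<alpha> by (auto simp: \<sigma>_def)
  define l where "l n = c * real (Suc n)" for n
  have l: "l n > 0" for n using c by (simp add: l_def)
  have K: "K \<ge> 0" using order_trans[OF norm_ge_zero bd[of 1]] by simp
  define f where "f n u = a (Suc n) * (exp (- of_real (l n * exp u)) * exp (s * of_real u))" for n and u :: real
  have int: "integrable lborel (f n)" for n
    unfolding f_def using gamma_exp_integral(1)[of s "l n"] l \<sigma> by (simp add: \<sigma>_def)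
  have fI: "integral\<^sup>L lborel (f n) = a (Suc n) * (of_real (l n) powr (- s) * Gamma s)" for n
    unfolding f_def using gamma_exp_integral(2)[of s "l n"] l \<sigma> by (simp add: \<sigma>_def)
  have nf: "norm (f n u) = norm (a (Suc n)) * (exp (- (l n * exp u)) * exp (\<sigma> * u))" for n u
    by (simp add: f_def norm_mult norm_exp_eq_Re \<sigma>_def)
  have nI: "(\<integral>u. norm (f n u) \<partial>lborel) = norm (a (Suc n)) * (l n powr (- \<sigma>) * Gamma \<sigma>)" for n
    unfolding nf using gamma_exp_integral_real[OF \<sigma>(2) l] by simp
  have fsum: "f n u = a (Suc n) * exp (2 * of_real pi * \<i> * of_nat (Suc n) * (\<i> * of_real (r * exp u))) * exp (s * of_real u)" for n u
  proof -
    have "2 * of_real pi * \<i> * of_nat (Suc n) * (\<i> * of_real (r * exp u)) = - complex_of_real (l n * exp u)"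
      by (simp add: l_def c_def algebra_simps)
    then show ?thesis by (simp only: f_def mult.assoc)
  qed
  have ser: "(\<lambda>n. a (Suc n) * exp (2 * of_real pi * \<i> * of_nat (Suc n) * z)) sums p z" if "Im z > 0" for z
    using a[OF that] sums_Suc_iff[of "\<lambda>n. a n * exp (2 * of_real pi * \<i> * of_nat n * z)" "p z"] a0 by simp
  have S: "(\<lambda>n. f n u) sums (\<phi> (of_real u) * exp ((s - of_real (\<kappa> / 2)) * of_real u))" for u
  proof -
    have "(\<lambda>n. f n u) sums (p (\<i> * of_real (r * exp u)) * exp (s * of_real u))"
      unfolding fsum by (intro sums_mult2 ser) (use r in simp)
    moreover have "p (\<i> * of_real (r * exp u)) * exp (s * of_real u) = \<phi> (of_real u) * exp ((s - of_real (\<kappa> / 2)) * of_real u)"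
      unfolding \<phi> by (simp add: exp_add[symmetric] left_diff_distrib mult.assoc)
    ultimately show ?thesis by simp
  qed
  have "(\<lambda>n. integral\<^sup>L lborel (f n)) sums (\<integral>u. (\<Sum>n. f n u) \<partial>lborel)"
  proof (rule sums_integral)
    show "AE u in lborel. summable (\<lambda>n. norm (f n u))"
    proof (rule AE_I2)
      fix u :: real
      define y where "y = r * exp u"
      have y: "y > 0" using r by (simp add: y_def)
      have e: "exp (2 * of_real pi * \<i> * of_nat n * (\<i> * of_real y)) = of_real (exp (- 2 * pi * y)) ^ n" for n y
      proof -
        have "2 * of_real pi * \<i> * of_nat n * (\<i> * of_real y) = of_nat n * complex_of_real (- 2 * pi * y)"
          by (simp add: algebra_simps)
        then show ?thesis by (simp only: exp_of_nat_mult exp_of_real)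
      qed
      \<comment> \<open>Convergence of the expansion at half the height gives absolute convergence
        at height y.\<close>
      have "summable (\<lambda>n. a n * of_real (exp (- 2 * pi * (y / 2))) ^ n)"
        using sums_summable[OF a[of "\<i> * of_real (y / 2)"]] y unfolding e by simp
      then have "summable (\<lambda>n. norm (a n * of_real (exp (- 2 * pi * y)) ^ n))"
        by (rule powser_insidea) (use y in simp)
      then have "summable (\<lambda>n. norm (a (Suc n) * of_real (exp (- 2 * pi * y)) ^ Suc n) * norm (exp (s * of_real u)))"
        by (intro summable_mult2) (subst summable_Suc_iff)
      then show "summable (\<lambda>n. norm (f n u))"
        unfolding fsum norm_mult[symmetric] e[symmetric] y_def .
    qed
    \<comment> \<open>The exponent \<alpha> - \<sigma> is below -1, which is where the half-plane Re
      s > \<alpha> + 1 comes from.\<close>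
    have "summable (\<lambda>n. K * c powr (- \<sigma>) * Gamma \<sigma> * (real (Suc n) powr (\<alpha> - \<sigma>)))"
      using \<sigma> by (intro summable_mult) (subst summable_Suc_iff, simp add: summable_real_powr_iff)
    then show "summable (\<lambda>n. \<integral>u. norm (f n u) \<partial>lborel)"
    proof (rule summable_comparison_test')
      fix n :: nat
      have "norm (a (Suc n)) * (l n powr (- \<sigma>) * Gamma \<sigma>) \<le> (K * real (Suc n) powr \<alpha>) * (l n powr (- \<sigma>) * Gamma \<sigma>)"
        using Gamma_real_pos[OF \<sigma>(2)] by (intro mult_right_mono bd) auto
      also have "\<dots> = K * c powr (- \<sigma>) * Gamma \<sigma> * (real (Suc n) powr (\<alpha> - \<sigma>))"
      proof -
        have "l n powr (- \<sigma>) = c powr (- \<sigma>) * real (Suc n) powr (- \<sigma>)"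
          unfolding l_def using c by (simp add: powr_mult)
        then have "K * real (Suc n) powr \<alpha> * (l n powr (- \<sigma>) * Gamma \<sigma>)
            = K * c powr (- \<sigma>) * Gamma \<sigma> * (real (Suc n) powr \<alpha> * real (Suc n) powr (- \<sigma>))"
          by (simp only: mult_ac)
        then show ?thesis by (simp only: powr_add[symmetric]) simp
      qed
      finally show "norm (\<integral>u. norm (f n u) \<partial>lborel) \<le> K * c powr (- \<sigma>) * Gamma \<sigma> * (real (Suc n) powr (\<alpha> - \<sigma>))"
        unfolding nI using Gamma_real_pos[OF \<sigma>(2)] by simp
    qed
  qed (rule int)
  also have "(\<integral>u. (\<Sum>n. f n u) \<partial>lborel) = laplace (s - of_real (\<kappa> / 2))"
    unfolding laplace_def sums_unique[OF S, symmetric] ..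
  finally have "(\<lambda>n. of_real c powr s * rGamma s * integral\<^sup>L lborel (f n)) sums (of_real c powr s * rGamma s * laplace (s - of_real (\<kappa> / 2)))"
    by (rule sums_mult)
  moreover have "of_real c powr s * rGamma s * integral\<^sup>L lborel (f n) = a (Suc n) * of_nat (Suc n) powr (- s)" for n
  proof -
    have "of_real (l n) powr (- s) = of_real c powr (- s) * of_nat (Suc n) powr (- s)"
      unfolding l_def of_real_mult of_real_of_nat_eq using c by (intro powr_times_real) auto
    moreover have "Gamma s \<noteq> 0" using \<sigma> by (auto simp: Gamma_eq_zero_iff \<sigma>_def elim!: nonpos_Ints_cases)
    ultimately show ?thesis unfolding fI using c
      by (simp add: rGamma_inverse_Gamma powr_minus field_simps)
  qed
  ultimately show ?thesis by (simp only: c_def)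
qed

section \<open>Sign changes and zeros of odd order\<close>

text \<open>An arbitrary zero between a and b need not be a sign change, so t0 is the last point up
  to which X stays nonpositive. At a zero of even order n, X(t) is (t - t0)^n times a continuous
  nonvanishing real factor, and so keeps one sign on both sides of t0.\<close>

lemma sign_change_odd_zero:
  fixes F :: "complex \<Rightarrow> complex" and X :: "real \<Rightarrow> real" and g :: "real \<Rightarrow> complex"
  assumes F: "F holomorphic_on UNIV" "\<exists>s. F s \<noteq> 0"
    and X: "continuous_on UNIV X" and g: "continuous_on UNIV g" "\<And>t. g t \<noteq> 0"
    and FX: "\<And>t. F (Complex \<sigma> t) = g t * of_real (X t)"
    and ab: "a < b" "X a < 0" "X b > 0"
  shows "\<exists>t. a < t \<and> t < b \<and> F (Complex \<sigma> t) = 0 \<and> odd (zorder F (Complex \<sigma> t))"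
proof -
  have cX: "isCont X t" for t using X by (simp add: continuous_on_eq_continuous_at)
  define S where "S = {t \<in> {a..b}. \<forall>u\<in>{a..t}. X u \<le> 0}"
  have aS: "a \<in> S" using ab by (auto simp: S_def)
  have bdd: "bdd_above S" by (rule bdd_aboveI[of _ b]) (auto simp: S_def)
  define t0 where "t0 = Sup S"
  have t0: "a \<le> t0" "t0 \<le> b"
    unfolding t0_def using aS bdd by (auto intro!: cSup_upper cSup_least simp: S_def)
  have left: "X u \<le> 0" if "a \<le> u" and u: "u < t0" for u
  proof -
    have "S \<noteq> {}" using aS by auto
    then obtain t where "t \<in> S" "u < t" using u bdd less_cSup_iff[of S u] by (auto simp: t0_def)
    then show ?thesis using that by (auto simp: S_def)
  qed
  \<comment> \<open>Otherwise X would be nonpositive on a longer initial interval, against the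
    choice of t0 as a supremum.\<close>
  have right: "\<exists>u. t0 < u \<and> u < t0 + e \<and> X u > 0" if "e > 0" "t0 < b" for e
  proof (rule ccontr)
    assume neg: "\<not> (\<exists>u. t0 < u \<and> u < t0 + e \<and> X u > 0)"
    define t1 where "t1 = min (t0 + e / 2) b"
    have t1: "t0 < t1" "t1 < t0 + e" "t1 \<le> b" using that by (auto simp: t1_def)
    have X0: "X t0 \<le> 0"
    proof (cases "a = t0")
      case False
      have "(X \<longlongrightarrow> X t0) (at_left t0)" using cX[of t0] by (simp add: isCont_def filterlim_at_split)
      moreover have "eventually (\<lambda>u. X u \<le> 0) (at_left t0)"
        using left False t0 by (intro eventually_at_leftI[of a]) auto
      ultimately show ?thesis by (intro tendsto_upperbound) auto
    qed (use ab in auto)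
    have "X u \<le> 0" if "u \<in> {a..t1}" for u
    proof -
      consider "u < t0" | "u = t0" | "t0 < u" by linarith
      then show ?thesis
      proof cases
        case 3
        moreover have "u < t0 + e" using that t1 by simp
        ultimately show ?thesis using neg not_less by blast
      qed (use left[of u] X0 that in auto)
    qed
    then have "t1 \<in> S" using t1 t0 by (auto simp: S_def)
    then have "t1 \<le> t0" unfolding t0_def using bdd by (intro cSup_upper)
    then show False using t1 by simp
  qed
  have evl: "eventually (\<lambda>u. X u \<le> 0) (at_left t0)" if "a < t0"
    using left that by (intro eventually_at_leftI[of a]) auto
  have at0: "a < t0"
  proof (rule ccontr)
    assume "\<not> a < t0"
    then have e: "t0 = a" using t0 by simp
    have "eventually (\<lambda>u. X u < 0) (at a)" using cX[of a] ab by (intro order_tendstoD(2)[of X "X a"]) (auto simp: isCont_def)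
    then obtain d where "d > 0" "\<And>u. u \<noteq> a \<Longrightarrow> dist u a < d \<Longrightarrow> X u < 0" by (auto simp: eventually_at)
    moreover obtain u where "t0 < u" "u < t0 + d" "X u > 0" using right[of d] \<open>d > 0\<close> e ab by auto
    ultimately show False using e by (force simp: dist_real_def)
  qed
  have X0le: "X t0 \<le> 0"
  proof -
    have "(X \<longlongrightarrow> X t0) (at_left t0)" using cX[of t0] by (simp add: isCont_def filterlim_at_split)
    then show ?thesis using evl[OF at0] by (intro tendsto_upperbound) auto
  qed
  have t0b: "t0 < b" using X0le ab t0 by (cases "t0 = b") auto
  have Xt0: "X t0 = 0"
  proof (rule ccontr)
    assume "X t0 \<noteq> 0"
    then have "eventually (\<lambda>u. X u < 0) (at t0)" using cX[of t0] X0le by (intro order_tendstoD(2)[of X "X t0"]) (auto simp: isCont_def)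
    then obtain d where "d > 0" "\<And>u. u \<noteq> t0 \<Longrightarrow> dist u t0 < d \<Longrightarrow> X u < 0" by (auto simp: eventually_at)
    moreover obtain u where "t0 < u" "u < t0 + d" "X u > 0" using right[of d] \<open>d > 0\<close> t0b by auto
    ultimately show False by (force simp: dist_real_def)
  qed
  define z0 where "z0 = Complex \<sigma> t0"
  have Fz0: "F z0 = 0" by (simp add: z0_def FX Xt0)
  have "odd (zorder F z0)"
  proof (rule ccontr)
    assume "\<not> odd (zorder F z0)"
    then have ev: "even (zorder F z0)" by simp
    define n where "n = nat (zorder F z0)"
    define h where "h = zor_poly F z0"
    have zo: "(if F z0 = 0 then zorder F z0 > 0 else zorder F z0 = 0) \<and> (\<exists>r. r > 0 \<and> cball z0 r \<subseteq> UNIV \<and> h holomorphic_on cball z0 r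
      \<and> (\<forall>w\<in>cball z0 r. F w = h w * (w - z0) ^ nat (zorder F z0) \<and> h w \<noteq> 0))"
      unfolding h_def by (rule zorder_exist_zero) (use F in auto)
    then obtain r where r: "r > 0" "h holomorphic_on cball z0 r"
      "\<And>w. w \<in> cball z0 r \<Longrightarrow> F w = h w * (w - z0) ^ n \<and> h w \<noteq> 0"
      unfolding n_def by blast
    have "zorder F z0 > 0" using zo Fz0 by auto
    then have n: "even n" using ev by (simp add: n_def even_nat_iff)
    \<comment> \<open>On the line (s - z0)^n equals i^n (t - t0)^n. So K is the quotient X(t) / (t -
      t0)^n for t \<noteq> t0, continued to t0 with a nonzero value; being real off t0, it is real
      there too.\<close>
    define K where "K t = h (Complex \<sigma> t) * \<i> ^ n / g t" for t
    have KX: "of_real (X t) = K t * of_real ((t - t0) ^ n)" if "\<bar>t - t0\<bar> \<le> r" for t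
    proof -
      have d: "Complex \<sigma> t - z0 = \<i> * of_real (t - t0)" by (simp add: z0_def complex_eq_iff)
      have "norm (Complex \<sigma> t - z0) \<le> r" unfolding d using that by (simp add: norm_mult del: of_real_diff)
      then have "Complex \<sigma> t \<in> cball z0 r" by (simp add: dist_norm norm_minus_commute)
      then have "g t * of_real (X t) = h (Complex \<sigma> t) * (\<i> * of_real (t - t0)) ^ n"
        using r(3) by (simp only: FX[symmetric] d[symmetric])
      also have "\<dots> = g t * (K t * of_real ((t - t0) ^ n))"
        unfolding K_def power_mult_distrib using g(2)[of t] by simp
      finally show ?thesis using g(2)[of t] by (simp only: mult_cancel_left) simp
    qed
    have K0: "K t0 \<noteq> 0" using r(1) r(3)[of z0] g(2)[of t0] by (simp add: K_def z0_def)
    have "isCont K t0"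
    proof -
      have "isCont h z0"
        using holomorphic_on_imp_continuous_on[OF r(2)] r(1) by (intro continuous_on_interior[of "cball z0 r"]) auto
      then have "isCont h (Complex \<sigma> t0)" by (simp add: z0_def)
      moreover have "isCont (\<lambda>t. Complex \<sigma> t) t0" unfolding Complex_eq by (intro continuous_intros)
      ultimately have "isCont (\<lambda>t. h (Complex \<sigma> t)) t0" using isCont_o2[of t0 "\<lambda>t. Complex \<sigma> t" h] by simp
      moreover have "isCont g t0" using g(1) by (simp add: continuous_on_eq_continuous_at)
      ultimately show ?thesis unfolding K_def using g(2)[of t0] by (intro continuous_intros)
    qed
    then have Kt: "(K \<longlongrightarrow> K t0) (at t0)" by (simp add: isCont_def)
    have pos: "(t - t0) ^ n > 0" if "t \<noteq> t0" for t using n that by (simp add: zero_less_power_eq)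
    have KR: "K t = of_real (X t / (t - t0) ^ n)" if "\<bar>t - t0\<bar> \<le> r" "t \<noteq> t0" for t
    proof -
      have "complex_of_real ((t - t0) ^ n) \<noteq> 0" using pos[OF that(2)] by (simp only: of_real_eq_0_iff)
      then have "K t = K t * of_real ((t - t0) ^ n) / of_real ((t - t0) ^ n)" by (rule nonzero_mult_div_cancel_right[symmetric])
      then show ?thesis by (simp only: KX[OF that(1), symmetric] of_real_divide[symmetric])
    qed
    have Im0: "Im (K t0) = 0"
    proof -
      have "((\<lambda>t. Im (K t)) \<longlongrightarrow> Im (K t0)) (at t0)" using Kt by (intro tendsto_intros)
      moreover have "eventually (\<lambda>t. Im (K t) = 0) (at t0)"
        unfolding eventually_at using r(1) by (intro exI[of _ r]) (auto simp: KR dist_real_def)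
      ultimately have "((\<lambda>t. 0) \<longlongrightarrow> Im (K t0)) (at t0)" using tendsto_cong by fastforce
      then show ?thesis using LIM_const_eq by force
    qed
    \<comment> \<open>For even n the divisor is positive on either side, so the sign of X on the
      left passes to K and, in the limit, to its value at t0.\<close>
    have Rle: "Re (K t0) \<le> 0"
    proof -
      have "((\<lambda>t. Re (K t)) \<longlongrightarrow> Re (K t0)) (at_left t0)"
        using Kt by (intro tendsto_intros) (simp add: filterlim_at_split)
      moreover have "eventually (\<lambda>t. Re (K t) \<le> 0) (at_left t0)"
      proof (rule eventually_at_leftI[of "max a (t0 - r)"])
        fix t assume "t \<in> {max a (t0 - r)<..<t0}"
        then show "Re (K t) \<le> 0" using KR[of t] left[of t] pos[of t] by (simp add: divide_nonpos_pos)
      qed (use at0 r(1) in auto)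
      ultimately show ?thesis by (intro tendsto_upperbound) auto
    qed
    have "Re (K t0) \<noteq> 0" using K0 Im0 by (auto simp: complex_eq_iff)
    then have "Re (K t0) < 0" using Rle by simp
    moreover have "((\<lambda>t. Re (K t)) \<longlongrightarrow> Re (K t0)) (at t0)" using Kt by (intro tendsto_intros)
    ultimately have "eventually (\<lambda>t. Re (K t) < 0) (at t0)" by (intro order_tendstoD(2))
    then obtain d where d: "d > 0" "\<And>u. u \<noteq> t0 \<Longrightarrow> dist u t0 < d \<Longrightarrow> Re (K u) < 0" by (auto simp: eventually_at)
    \<comment> \<open>Continuity makes K negative on the right as well, but positive values of X
      accumulate at t0 from there.\<close>
    obtain u where u: "t0 < u" "u < t0 + min d r" "X u > 0" using right[of "min d r"] d(1) r(1) t0b by auto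
    then have "Re (K u) < 0" by (intro d(2)) (auto simp: dist_real_def)
    moreover have "Re (K u) > 0" using KR[of u] u pos[of u] by simp
    ultimately show False by simp
  qed
  then show ?thesis using at0 t0b Fz0 unfolding z0_def by blast
qed

lemma no_odd_zero_constant_sign:
  fixes F :: "complex \<Rightarrow> complex" and X :: "real \<Rightarrow> real" and g :: "real \<Rightarrow> complex"
  assumes F: "F holomorphic_on UNIV" "\<exists>s. F s \<noteq> 0"
    and X: "continuous_on UNIV X" and g: "continuous_on UNIV g" "\<And>t. g t \<noteq> 0"
    and FX: "\<And>t. F (Complex \<sigma> t) = g t * of_real (X t)"
    and no: "\<And>t. a \<le> t \<Longrightarrow> t \<le> b \<Longrightarrow> \<not> (F (Complex \<sigma> t) = 0 \<and> odd (zorder F (Complex \<sigma> t)))"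
  shows "(\<forall>t\<in>{a..b}. X t \<ge> 0) \<or> (\<forall>t\<in>{a..b}. X t \<le> 0)"
proof (rule ccontr)
  assume "\<not> ?thesis"
  then obtain t u where tu: "t \<in> {a..b}" "u \<in> {a..b}" "X t < 0" "X u > 0" by (auto simp: not_le)
  have "\<exists>v. min t u < v \<and> v < max t u \<and> F (Complex \<sigma> v) = 0 \<and> odd (zorder F (Complex \<sigma> v))"
  proof (cases "t < u")
    case True
    then show ?thesis using sign_change_odd_zero[OF F X g FX, of t u] tu by auto
  next
    case False
    then have "u < t" using tu by (cases "t = u") auto
    \<comment> \<open>Negating X and g together preserves the factorization of F and turns a descent
      from positive to negative into an ascent.\<close>
    moreover have "continuous_on UNIV (\<lambda>t. - X t)" "continuous_on UNIV (\<lambda>t. - g t)"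
      using X g by (auto intro: continuous_intros)
    ultimately show ?thesis using sign_change_odd_zero[OF F, of "\<lambda>t. - X t" "\<lambda>t. - g t" \<sigma> u t] g FX tu by auto
  qed
  then show False using no tu by (smt (verit) atLeastAtMost_iff)
qed

section \<open>The method of Hardy and Littlewood\<close>

text \<open>This isolates what the counting argument uses of L(s,f) +- L(s,f|W): a Dirichlet series
  with polynomially bounded coefficients, continued by 1/Gamma times a Laplace transform that is a
  fixed multiple of a real function on the imaginary axis. In the application \<rho> is 2 pi / sqrt
  M.\<close>

locale hardy_littlewood = strip_function +
  fixes \<rho> \<alpha> K :: real and c :: "nat \<Rightarrow> complex" and \<omega> :: complex and X :: "real \<Rightarrow> real"
    and F :: "complex \<Rightarrow> complex"
  assumes \<kappa>: "\<kappa> \<ge> 1" and \<rho>: "\<rho> > 0" and \<alpha>: "\<alpha> \<ge> 0"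
    and F_def: "\<And>s. F s = of_real \<rho> powr s * rGamma s * laplace (s - of_real (\<kappa> / 2))"
    and c_bound: "\<And>n. norm (c n) \<le> K * real n powr \<alpha>"
    and F_sums: "\<And>s. Re s > \<alpha> + 1 \<Longrightarrow> (\<lambda>n. c (Suc n) * of_nat (Suc n) powr (- s)) sums F s"
    and F_nz: "\<exists>s. F s \<noteq> 0"
    and \<omega>: "\<omega> \<noteq> 0" and real_on_line: "\<And>t. laplace (Complex 0 t) = \<omega> * of_real (X t)"
begin

section \<open>Analyticity of F and its leading Dirichlet coefficient\<close>

lemma F_holo: "F holomorphic_on UNIV"
proof -
  have "(laplace \<circ> (\<lambda>s. s - of_real (\<kappa> / 2))) holomorphic_on UNIV"
    by (rule holomorphic_on_compose_gen[OF _ laplace_entire]) (auto intro!: holomorphic_intros)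
  then have "(\<lambda>s. of_real \<rho> powr s * rGamma s * laplace (s - of_real (\<kappa> / 2))) holomorphic_on UNIV"
    unfolding o_def using \<rho> by (intro holomorphic_intros) auto
  moreover have "F = (\<lambda>s. of_real \<rho> powr s * rGamma s * laplace (s - of_real (\<kappa> / 2)))"
    by (rule ext) (rule F_def)
  ultimately show ?thesis by (simp only:)
qed

lemma F_cont: "continuous_on UNIV F"
  using F_holo by (rule holomorphic_on_imp_continuous_on)

lemma F_Complex_cont: "continuous_on A (\<lambda>u. F (Complex (x + b * u) (t + d * u)))"
  by (rule continuous_on_compose2[OF F_cont]) (auto simp: Complex_eq intro!: continuous_intros)

lemma norm_nat_powr: "n > 0 \<Longrightarrow> norm (of_nat n powr s :: complex) = real n powr Re s"
  by (subst norm_powr_real_powr) auto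

lemma exists_coeff: "\<exists>n>0. c n \<noteq> 0"
proof (rule ccontr)
  assume "\<not> ?thesis"
  then have z: "c (Suc n) = 0" for n by auto
  have "F = (\<lambda>_. 0)"
  proof (rule ext)
    fix w
    show "F w = 0"
    proof (rule analytic_continuation[of F UNIV "{s. Re s > \<alpha> + 1}" "of_real (\<alpha> + 2)"])
      show "of_real (\<alpha> + 2) islimpt {s. Re s > \<alpha> + 1}"
        by (rule interior_limit_point) (simp add: interior_open open_halfspace_Re_gt)
      show "F s = 0" if "s \<in> {s. Re s > \<alpha> + 1}" for s
        using F_sums[of s] that z by (simp add: sums_iff)
    qed (use F_holo in auto)
  qed
  then show False using F_nz by auto
qed

text \<open>With N the first index of a nonzero coefficient, multiplying by N^s makes the leading
  term constant, and moving far to the right makes the tail smaller than half of it.\<close>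

lemma leading_term:
  obtains N B where "N > 0" "c N \<noteq> 0" "B > 0"
    "\<And>t. norm (F (Complex (\<kappa> / 2 + B) t) * of_nat N powr Complex (\<kappa> / 2 + B) t - c N) \<le> norm (c N) / 2"
proof -
  define N where "N = (LEAST n. n > 0 \<and> c n \<noteq> 0)"
  have N: "N > 0" "c N \<noteq> 0" using LeastI_ex[OF exists_coeff] unfolding N_def by auto
  have Nl: "c n = 0" if "0 < n" "n < N" for n
    using not_less_Least[of n "\<lambda>n. n > 0 \<and> c n \<noteq> 0"] that unfolding N_def by auto
  have K: "K \<ge> 0" using order_trans[OF norm_ge_zero c_bound[of 1]] by simp
  \<comment> \<open>The largest of the ratios N/n with n > N.\<close>
  define q where "q = real N / (real N + 1)"
  have q: "0 \<le> q" "q < 1" by (auto simp: q_def)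
  define g where "g n = K * real N powr (\<alpha> + 2) * real (Suc n) powr (- 2)" for n
  have g: "summable g"
    unfolding g_def by (intro summable_mult) (subst summable_Suc_iff, simp add: summable_real_powr_iff)
  define S where "S = suminf g"
  have "(\<lambda>j. q ^ j * S) \<longlonglongrightarrow> 0 * S"
    using q by (intro tendsto_mult LIMSEQ_power_zero tendsto_const) auto
  then have "eventually (\<lambda>j. q ^ j * S < norm (c N) / 2) sequentially"
    using N by (intro order_tendstoD(2)[of _ 0]) auto
  moreover have "eventually (\<lambda>j. real j > \<kappa> / 2) sequentially"
    by real_asymp
  ultimately obtain j where j: "q ^ j * S < norm (c N) / 2" "real j > \<kappa> / 2"
    using eventually_happens[OF eventually_conj] by (metis (no_types, lifting) trivial_limit_sequentially)
  \<comment> \<open>\<alpha> absorbs the coefficient bound, 2 makes the tail summable, and the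
    remaining j supplies the geometric factor q^j.\<close>
  define \<sigma> where "\<sigma> = \<alpha> + 2 + real j"
  define B where "B = \<sigma> - \<kappa> / 2"
  have B: "B > 0" using j \<alpha> by (simp add: B_def \<sigma>_def)
  have "norm (F (Complex (\<kappa> / 2 + B) t) * of_nat N powr Complex (\<kappa> / 2 + B) t - c N) \<le> norm (c N) / 2" for t
  proof -
    define s where "s = Complex \<sigma> t"
    have Re_s: "Re s = \<sigma>" by (simp add: s_def)
    define d where "d n = c (Suc n) * of_nat (Suc n) powr (- s) * of_nat N powr s - (if n = N - 1 then c N else 0)" for n
    have "(\<lambda>n. c (Suc n) * of_nat (Suc n) powr (- s) * of_nat N powr s) sums (F s * of_nat N powr s)"
      by (intro sums_mult2 F_sums) (simp add: Re_s \<sigma>_def)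
    moreover have "(\<lambda>n. if n = N - 1 then c N else 0) sums c N"
      using sums_single[of "N - 1" "\<lambda>_. c N"] by simp
    ultimately have d: "d sums (F s * of_nat N powr s - c N)"
      unfolding d_def by (rule sums_diff)
    have bd: "norm (d n) \<le> q ^ j * g n" for n
    proof -
      consider "Suc n < N" | "Suc n = N" | "Suc n > N" by linarith
      then show ?thesis
      proof cases
        case 1
        then have "d n = 0" using Nl[of "Suc n"] by (auto simp: d_def)
        then show ?thesis using K q by (simp add: g_def)
      next
        case 2
        then have "d n = 0" using N by (auto simp: d_def powr_minus)
        then show ?thesis using K q by (simp add: g_def)
      next
        case 3
        have "norm (d n) = norm (c (Suc n)) * (real (Suc n) powr (- \<sigma>) * real N powr \<sigma>)"
          using 3 N by (simp add: d_def norm_mult norm_nat_powr Re_s del: of_nat_Suc)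
        also have "\<dots> \<le> (K * real (Suc n) powr \<alpha>) * (real (Suc n) powr (- \<sigma>) * real N powr \<sigma>)"
          by (intro mult_right_mono c_bound) simp
        also have "\<dots> = g n * (real N powr real j * real (Suc n) powr (- real j))"
        proof -
          have "real (Suc n) powr \<alpha> * real (Suc n) powr (- \<sigma>) = real (Suc n) powr (- 2) * real (Suc n) powr (- real j)"
            by (simp add: powr_add[symmetric] \<sigma>_def)
          moreover have "real N powr \<sigma> = real N powr (\<alpha> + 2) * real N powr real j"
            by (simp add: powr_add[symmetric] \<sigma>_def)
          moreover have "K * A * (E * D) = K * D' * Y * (Z * V)"
            if "A * E = Y * V" "D = D' * Z" for A E D D' Y Z V :: real
          proof -
            have "K * A * (E * D) = K * (A * E) * D" by simp
            also have "\<dots> = K * D' * Y * (Z * V)" unfolding that by simp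
            finally show ?thesis .
          qed
          ultimately show ?thesis unfolding g_def by blast
        qed
        also have "real N powr real j * real (Suc n) powr (- real j) = (real N / real (Suc n)) ^ j"
          using N by (simp add: powr_realpow powr_minus power_divide field_simps)
        also have "g n * (real N / real (Suc n)) ^ j \<le> g n * q ^ j"
          unfolding q_def using 3 K by (intro mult_left_mono power_mono frac_le) (auto simp: g_def)
        finally show ?thesis by (simp only: mult.commute)
      qed
    qed
    have "norm (suminf d) \<le> (\<Sum>n. q ^ j * g n)"
      by (rule norm_suminf_le[OF bd]) (intro summable_mult g)
    also have "\<dots> = q ^ j * S" unfolding S_def by (rule suminf_mult[OF g])
    finally have "norm (F s * of_nat N powr s - c N) \<le> norm (c N) / 2"
      using sums_unique[OF d] j by simp
    then show ?thesis by (simp add: s_def B_def)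
  qed
  then show ?thesis using that[of N B] N B by blast
qed

section \<open>The rotated line and the Gamma factor\<close>

definition \<theta> :: "real \<Rightarrow> real" where "\<theta> T = pi / 2 - 1 / T"

lemma theta_strip: "T \<ge> 1 \<Longrightarrow> \<bar>\<theta> T\<bar> < pi / 2"
proof -
  assume "T \<ge> 1"
  then have "0 < 1 / T" "1 / T \<le> 1" by auto
  then show ?thesis using pi_gt3 unfolding \<theta>_def by linarith
qed

lemma cos_theta: assumes T: "T \<ge> 1" shows "cos (\<theta> T) \<ge> 1 / (2 * T)"
proof -
  have x: "0 < 1 / T" "1 / T \<le> 1" using T by auto
  have "\<exists>z. 0 < z \<and> z < 1 / T \<and> sin (1 / T) - sin 0 = (1 / T - 0) * cos z"
    by (rule MVT2) (use x in \<open>auto intro!: derivative_eq_intros\<close>)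
  then obtain z where z: "0 < z" "z < 1 / T" "sin (1 / T) = 1 / T * cos z" by auto
  \<comment> \<open>1/T \<le> 1 < pi/3, and up to pi/3 the cosine is at least 1/2; this is the 2 in
    the bound.\<close>
  have "z \<le> pi / 3" using z(2) x(2) pi_gt3 by linarith
  then have "cos z \<ge> cos (pi / 3)" using z(1) pi_gt3 by (intro cos_monotone_0_pi_le) auto
  then have "sin (1 / T) \<ge> 1 / T * (1 / 2)" unfolding z(3) cos_60 using x by (intro mult_left_mono) auto
  moreover have "cos (\<theta> T) = sin (1 / T)" by (simp add: \<theta>_def cos_diff)
  ultimately show ?thesis by simp
qed

lemma cos_theta_powr: assumes "T \<ge> 1" "y \<ge> 0" shows "cos (\<theta> T) powr (- y) \<le> (2 * T) powr y"
proof -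
  have "cos (\<theta> T) powr (- y) \<le> (1 / (2 * T)) powr (- y)"
    using assms cos_theta[OF assms(1)] by (intro powr_mono2') auto
  also have "\<dots> = (2 * T) powr y" using assms by (simp add: powr_minus powr_divide)
  finally show ?thesis .
qed

lemma F_bound:
  assumes B: "B \<ge> 0"
  obtains C where "C > 0" "\<And>b T u. 0 \<le> b \<Longrightarrow> b \<le> B \<Longrightarrow> T \<ge> 1 \<Longrightarrow> T \<le> u \<Longrightarrow> u \<le> 3 * T \<Longrightarrow>
    norm (F (Complex (\<kappa> / 2 + b) u)) \<le> C * T powr (1/2 - \<kappa> / 2 - b) * (norm (laplace (Complex b u)) * exp (\<theta> T * u))"
proof -
  \<comment> \<open>Large enough for the strip of the Gamma bound to reach \<kappa>/2 + B; its left
    edge 1/2 is respected because \<kappa> \<ge> 1.\<close>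
  define J where "J = nat \<lceil>\<kappa> / 2 + B\<rceil> + 1"
  have J: "J > 0" "real J \<ge> \<kappa> / 2 + B" unfolding J_def by linarith+
  obtain C where C: "C > 0" "\<And>x t. 1/2 \<le> x \<Longrightarrow> x \<le> 1/2 + real J \<Longrightarrow> t > 0 \<Longrightarrow>
       norm (rGamma (Complex x t)) \<le> C * t powr (1/2 - x) * exp (pi * t / 2)"
    using norm_rGamma_vertical_strip[OF J(1)] by blast
  define R where "R = max 1 \<rho> powr (\<kappa> / 2 + B)"
  have R: "R > 0" by (simp add: R_def less_max_iff_disj)
  show ?thesis
  proof (rule that)
    show "R * C * exp 3 > 0" using R C by simp
    fix b T u :: real assume b: "0 \<le> b" "b \<le> B" and T: "T \<ge> 1" "T \<le> u" "u \<le> 3 * T"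
    let ?x = "\<kappa> / 2 + b" and ?y = "norm (laplace (Complex b u))"
    have "norm (of_real \<rho> powr Complex ?x u :: complex) = \<rho> powr ?x"
      using \<rho> by (subst norm_powr_real_powr) auto
    also have "\<dots> \<le> max 1 \<rho> powr ?x" using \<rho> b \<kappa> by (intro powr_mono2) auto
    also have "\<dots> \<le> R" unfolding R_def using b by (intro powr_mono) auto
    finally have 1: "norm (of_real \<rho> powr Complex ?x u :: complex) \<le> R" .
    have "norm (rGamma (Complex ?x u)) \<le> C * u powr (1/2 - ?x) * exp (pi * u / 2)"
      using b J \<kappa> T by (intro C(2)) auto
    also have "\<dots> \<le> C * T powr (1/2 - ?x) * exp (3 + \<theta> T * u)"
    proof (intro mult_mono mult_left_mono)
      show "u powr (1/2 - ?x) \<le> T powr (1/2 - ?x)" using T b \<kappa> by (intro powr_mono2') auto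
      \<comment> \<open>\<open>\<theta> T\<close> misses pi/2 by 1/T and u \<le> 3T, so the two
        exponentials differ by at most the factor e^3.\<close>
      have "pi * u / 2 = \<theta> T * u + u / T" by (simp add: \<theta>_def algebra_simps)
      moreover have "u / T \<le> 3" using T by (simp add: field_simps)
      ultimately have "pi * u / 2 \<le> 3 + \<theta> T * u" by linarith
      then show "exp (pi * u / 2) \<le> exp (3 + \<theta> T * u)" by simp
    qed (use C in auto)
    finally have 2: "norm (rGamma (Complex ?x u)) \<le> C * T powr (1/2 - ?x) * exp (3 + \<theta> T * u)" .
    have e: "Complex ?x u - of_real (\<kappa> / 2) = Complex b u" by (simp add: complex_eq_iff)
    have "norm (F (Complex ?x u)) = norm (of_real \<rho> powr Complex ?x u :: complex) * norm (rGamma (Complex ?x u)) * ?y"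
      unfolding F_def e norm_mult ..
    also have "\<dots> \<le> R * (C * T powr (1/2 - ?x) * exp (3 + \<theta> T * u)) * ?y"
      using 1 2 R C by (intro mult_right_mono mult_mono) auto
    also have "\<dots> = R * C * exp 3 * T powr (1/2 - \<kappa> / 2 - b) * (?y * exp (\<theta> T * u))"
      by (simp add: exp_add diff_diff_eq)
    finally show "norm (F (Complex ?x u)) \<le> R * C * exp 3 * T powr (1/2 - \<kappa> / 2 - b) * (?y * exp (\<theta> T * u))" .
  qed
qed

section \<open>Mean values on [T, 2T] and [T, 3T]\<close>

definition short_integral :: "real \<Rightarrow> real \<Rightarrow> real \<Rightarrow> complex" where
  "short_integral T H t = (\<integral>v. indicator {0..H} v *\<^sub>R (laplace (Complex 0 (t + v)) * of_real (exp (\<theta> T * (t + v)))) \<partial>lborel)"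

text \<open>Bessel's inequality is used with a = 1/T: on [T, mT] its weight is at least e^(-m), so
  removing it costs a constant.\<close>

lemma exp_weight:
  fixes T m :: real
  assumes T: "T \<ge> 1" and t: "t \<in> {T..m * T}" and y: "y \<ge> 0"
  shows "y \<le> exp m * (exp (- (1 / T) * \<bar>t\<bar>) * y)"
proof -
  have "t / T \<le> m" "t \<ge> 0" using t T by (auto simp: field_simps)
  then have "exp 0 \<le> exp (m - t / T)" by simp
  then have "1 \<le> exp m * exp (- (1 / T) * \<bar>t\<bar>)" using \<open>t \<ge> 0\<close> by (simp add: exp_diff exp_minus divide_inverse mult.commute)
  then have "1 * y \<le> (exp m * exp (- (1 / T) * \<bar>t\<bar>)) * y" using y by (rule mult_right_mono)
  then show ?thesis by (simp add: mult.assoc)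
qed

text \<open>After the Gamma normalization T^(1 - \<kappa>) the mean of the squared short integral is
  O(H), against the H^2 expected without cancellation.\<close>

lemma short_integral_mean_square:
  obtains C where "C > 0" "\<And>T H. T \<ge> 1 \<Longrightarrow> H > 0 \<Longrightarrow>
     integrable lborel (\<lambda>t. indicator {T..2 * T} t * (norm (short_integral T H t))\<^sup>2) \<and>
     (\<integral>t. indicator {T..2 * T} t * (norm (short_integral T H t))\<^sup>2 \<partial>lborel) \<le> C * H * T powr \<kappa>"
proof -
  obtain C where C: "C > 0" "\<And>H \<theta> a. H > 0 \<Longrightarrow> \<bar>\<theta>\<bar> < pi / 2 \<Longrightarrow> a > 0 \<Longrightarrow>
    integrable lborel (\<lambda>t. exp (- a * \<bar>t\<bar>) * (norm (\<integral>v. indicator {0..H} v *\<^sub>R (laplace (Complex 0 (t + v)) * of_real (exp (\<theta> * (t + v)))) \<partial>lborel))\<^sup>2) \<and>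
    (\<integral>t. exp (- a * \<bar>t\<bar>) * (norm (\<integral>v. indicator {0..H} v *\<^sub>R (laplace (Complex 0 (t + v)) * of_real (exp (\<theta> * (t + v)))) \<partial>lborel))\<^sup>2 \<partial>lborel)
      \<le> C * H * cos \<theta> powr (- \<kappa>)"
    using laplace_short_mean_square by blast
  show ?thesis
  proof (rule that)
    show "exp 2 * C * 2 powr \<kappa> > 0" using C by simp
    fix T H :: real assume T: "T \<ge> 1" and H: "H > 0"
    define w where "w t = exp (- (1 / T) * \<bar>t\<bar>) * (norm (short_integral T H t))\<^sup>2" for t
    have w: "integrable lborel w" "integral\<^sup>L lborel w \<le> C * H * cos (\<theta> T) powr (- \<kappa>)"
      using C(2)[OF H theta_strip[OF T], of "1 / T"] T unfolding w_def[abs_def] short_integral_def by auto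
    have [measurable]: "w \<in> borel_measurable borel" using w(1) by auto
    have le: "indicator {T..2 * T} t * (norm (short_integral T H t))\<^sup>2 \<le> exp 2 * w t" for t
      using exp_weight[OF T, of t 2 "(norm (short_integral T H t))\<^sup>2"] by (auto simp: w_def indicator_def)
    \<comment> \<open>\<open>w\<close> is integrable and hence measurable; dividing its positive
      weight out transfers measurability to the unweighted square.\<close>
    have eq: "indicator {T..2 * T} t * (norm (short_integral T H t))\<^sup>2 = indicator {T..2 * T} t * (exp (1 / T * \<bar>t\<bar>) * w t)" for t
      by (simp add: w_def exp_minus)
    have int: "integrable lborel (\<lambda>t. indicator {T..2 * T} t * (norm (short_integral T H t))\<^sup>2)"
    proof (rule Bochner_Integration.integrable_bound[OF Bochner_Integration.integrable_mult_right[OF w(1), of "exp 2"]])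
      show "(\<lambda>t. indicator {T..2 * T} t * (norm (short_integral T H t))\<^sup>2) \<in> borel_measurable lborel"
        unfolding eq by measurable
      show "AE t in lborel. norm (indicator {T..2 * T} t * (norm (short_integral T H t))\<^sup>2) \<le> norm (exp 2 * w t)"
        using le by (intro AE_I2) (auto simp: indicator_def w_def)
    qed
    have "(\<integral>t. indicator {T..2 * T} t * (norm (short_integral T H t))\<^sup>2 \<partial>lborel) \<le> (\<integral>t. exp 2 * w t \<partial>lborel)"
      using int w(1) le by (intro integral_mono) auto
    also have "\<dots> \<le> exp 2 * (C * H * cos (\<theta> T) powr (- \<kappa>))" using w(2) by simp
    also have "\<dots> \<le> exp 2 * (C * H * (2 * T) powr \<kappa>)"
      using C H cos_theta_powr[OF T, of \<kappa>] \<kappa> by (intro mult_left_mono) auto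
    also have "\<dots> = exp 2 * C * 2 powr \<kappa> * H * T powr \<kappa>" using T by (simp add: powr_mult)
    finally show "integrable lborel (\<lambda>t. indicator {T..2 * T} t * (norm (short_integral T H t))\<^sup>2) \<and>
     (\<integral>t. indicator {T..2 * T} t * (norm (short_integral T H t))\<^sup>2 \<partial>lborel) \<le> exp 2 * C * 2 powr \<kappa> * H * T powr \<kappa>"
      using int by simp
  qed
qed

lemma indicator_integrable: "integrable lborel (\<lambda>t. indicator {a..b::real} t :: real)"
  by (rule integrable_real_indicator) (simp_all add: emeasure_lborel_Icc_eq)

lemma integrable_indicator_cont:
  fixes f :: "real \<Rightarrow> 'a :: {banach, second_countable_topology}"
  assumes "continuous_on UNIV f"
  shows "integrable lborel (\<lambda>t. indicator {a..b} t *\<^sub>R f t)"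
  using borel_integrable_atLeastAtMost'[OF continuous_on_subset[OF assms subset_UNIV], of a b]
  unfolding set_integrable_def .

lemma F_norm_integrable: "integrable lborel (\<lambda>t. indicator {a..b} t * norm (F (Complex x (t0 + t))))"
proof -
  have "continuous_on UNIV (\<lambda>t. norm (F (Complex (x + 0 * t) (t0 + 1 * t))))"
    by (intro continuous_on_norm F_Complex_cont)
  from integrable_indicator_cont[OF this] show ?thesis by simp
qed

text \<open>The mean square of F on the line at distance b is O(T/b); the inequality f \<le> l/2 +
  f^2/(2l) turns it into a bound for the mean of |F|, in place of the Cauchy-Schwarz
  inequality.\<close>

lemma F_vertical_mean:
  assumes B: "B > 0"
  obtains C where "C > 0" "\<And>b T. 0 < b \<Longrightarrow> b \<le> B \<Longrightarrow> T \<ge> 1 \<Longrightarrow>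
    (\<integral>t. indicator {T..3 * T} t * norm (F (Complex (\<kappa> / 2 + b) t)) \<partial>lborel) \<le> C * T * b powr (- 1 / 2)"
proof -
  obtain C1 where C1: "C1 > 0" "\<And>b T u. 0 \<le> b \<Longrightarrow> b \<le> B \<Longrightarrow> T \<ge> 1 \<Longrightarrow> T \<le> u \<Longrightarrow> u \<le> 3 * T \<Longrightarrow>
    norm (F (Complex (\<kappa> / 2 + b) u)) \<le> C1 * T powr (1/2 - \<kappa> / 2 - b) * (norm (laplace (Complex b u)) * exp (\<theta> T * u))"
    using F_bound[of B] B by auto
  obtain C2 where C2: "C2 > 0" "\<And>b \<theta> a. 0 < b \<Longrightarrow> b \<le> B \<Longrightarrow> \<bar>\<theta>\<bar> < pi / 2 \<Longrightarrow> a > 0 \<Longrightarrow>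
    integrable lborel (\<lambda>t. exp (- a * \<bar>t\<bar>) * (norm (laplace (Complex b t)) * exp (\<theta> * t))\<^sup>2) \<and>
    (\<integral>t. exp (- a * \<bar>t\<bar>) * (norm (laplace (Complex b t)) * exp (\<theta> * t))\<^sup>2 \<partial>lborel) \<le> C2 / b * cos \<theta> powr (- \<kappa> - 2 * b)"
    using laplace_mean_square[of B] by blast
  define C where "C = 1 + C1\<^sup>2 * exp 3 * C2 * 2 powr (\<kappa> + 2 * B)"
  show ?thesis
  proof (rule that)
    show "C > 0" using C1(1) C2(1) unfolding C_def by (intro add_pos_pos mult_pos_pos) auto
    fix b T :: real assume b: "0 < b" "b \<le> B" and T: "T \<ge> 1"
    define w where "w t = exp (- (1 / T) * \<bar>t\<bar>) * (norm (laplace (Complex b t)) * exp (\<theta> T * t))\<^sup>2" for t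
    have w: "integrable lborel w" "integral\<^sup>L lborel w \<le> C2 / b * cos (\<theta> T) powr (- \<kappa> - 2 * b)"
      using C2(2)[OF b theta_strip[OF T], of "1 / T"] T unfolding w_def[abs_def] by auto
    define D where "D = C1\<^sup>2 * T powr (1 - \<kappa> - 2 * b) * exp 3"
    have D: "D \<ge> 0" by (simp add: D_def)
    \<comment> \<open>This l balances the two contributions l T and T/(b l).\<close>
    define l where "l = b powr (- 1 / 2)"
    have l: "l > 0" "l\<^sup>2 = 1 / b"
    proof -
      show "l > 0" using b by (simp add: l_def)
      have "l\<^sup>2 = b powr (- 1 / 2 + - 1 / 2)" unfolding l_def power2_eq_square powr_add ..
      then show "l\<^sup>2 = 1 / b" using b by (simp add: powr_neg_one)
    qed
    have Fsq: "(norm (F (Complex (\<kappa> / 2 + b) t)))\<^sup>2 \<le> D * w t" if t: "t \<in> {T..3 * T}" for t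
    proof -
      have "(norm (F (Complex (\<kappa> / 2 + b) t)))\<^sup>2 \<le> (C1 * T powr (1/2 - \<kappa> / 2 - b) * (norm (laplace (Complex b t)) * exp (\<theta> T * t)))\<^sup>2"
        using b T t by (intro power_mono C1(2)) auto
      also have "\<dots> = C1\<^sup>2 * T powr (1 - \<kappa> - 2 * b) * (norm (laplace (Complex b t)) * exp (\<theta> T * t))\<^sup>2"
      proof -
        have "(T powr (1/2 - \<kappa> / 2 - b))\<^sup>2 = T powr (1 - \<kappa> - 2 * b)"
          using T by (simp add: powr_power algebra_simps)
        then show ?thesis by (simp only: power_mult_distrib)
      qed
      also have "\<dots> \<le> C1\<^sup>2 * T powr (1 - \<kappa> - 2 * b) * (exp 3 * w t)"
        unfolding w_def using t T by (intro mult_left_mono exp_weight) auto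
      finally show ?thesis by (simp add: D_def mult_ac)
    qed
    have le: "indicator {T..3 * T} t * norm (F (Complex (\<kappa> / 2 + b) t)) \<le> l / 2 * indicator {T..3 * T} t + 1 / (2 * l) * (D * w t)" for t
    proof (cases "t \<in> {T..3 * T}")
      case True
      let ?f = "norm (F (Complex (\<kappa> / 2 + b) t))"
      have "2 * l * ?f \<le> l\<^sup>2 + ?f\<^sup>2" using zero_le_power2[of "l - ?f"] by (simp add: power2_diff)
      also have "\<dots> \<le> l\<^sup>2 + D * w t" using Fsq[OF True] by simp
      finally have "?f \<le> (l\<^sup>2 + D * w t) / (2 * l)" using l by (simp add: field_simps)
      also have "\<dots> = l / 2 + 1 / (2 * l) * (D * w t)" using l by (simp add: power2_eq_square field_simps)
      finally show ?thesis using True by simp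
    next
      case False
      then show ?thesis using l D by (simp add: w_def)
    qed
    have "(\<integral>t. indicator {T..3 * T} t * norm (F (Complex (\<kappa> / 2 + b) t)) \<partial>lborel)
       \<le> (\<integral>t. l / 2 * indicator {T..3 * T} t + 1 / (2 * l) * (D * w t) \<partial>lborel)"
      using F_norm_integrable[of T "3 * T" "\<kappa> / 2 + b" 0] w(1) indicator_integrable
      by (intro integral_mono le Bochner_Integration.integrable_add Bochner_Integration.integrable_mult_right) auto
    also have "\<dots> = l / 2 * (2 * T) + 1 / (2 * l) * (D * integral\<^sup>L lborel w)"
      using w(1) indicator_integrable T by (subst Bochner_Integration.integral_add) auto
    also have "\<dots> \<le> l / 2 * (2 * T) + 1 / (2 * l) * (D * (C2 / b * ((2 * T) powr (\<kappa> + 2 * b))))"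
    proof -
      have "integral\<^sup>L lborel w \<le> C2 / b * cos (\<theta> T) powr (- (\<kappa> + 2 * b))" using w(2) by simp
      also have "\<dots> \<le> C2 / b * ((2 * T) powr (\<kappa> + 2 * b))"
        using C2(1) b \<kappa> by (intro mult_left_mono cos_theta_powr T) auto
      finally show ?thesis using l D by (intro add_left_mono mult_left_mono) auto
    qed
    also have "\<dots> = l * T + (C1\<^sup>2 * exp 3 * C2 * 2 powr (\<kappa> + 2 * b)) / 2 * (T powr (1 - \<kappa> - 2 * b) * T powr (\<kappa> + 2 * b)) * (1 / (b * l))"
      unfolding D_def using T b l by (simp add: powr_mult field_simps)
    \<comment> \<open>The powers coming from the Gamma factor and from cos \<theta> cancel up to T
      for every b.\<close>
    also have "T powr (1 - \<kappa> - 2 * b) * T powr (\<kappa> + 2 * b) = T" using T by (simp add: powr_add[symmetric])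
    also have "1 / (b * l) = l" using l b by (simp add: power2_eq_square field_simps)
    also have "l * T + (C1\<^sup>2 * exp 3 * C2 * 2 powr (\<kappa> + 2 * b)) / 2 * T * l \<le> C * T * l"
    proof -
      have "C1\<^sup>2 * exp 3 * C2 * 2 powr (\<kappa> + 2 * b) \<le> C1\<^sup>2 * exp 3 * C2 * 2 powr (\<kappa> + 2 * B)"
        using b C2(1) by (intro mult_left_mono powr_mono) auto
      moreover have "C1\<^sup>2 * exp 3 * C2 * 2 powr (\<kappa> + 2 * b) \<ge> 0" using C2(1) by simp
      ultimately have "1 + (C1\<^sup>2 * exp 3 * C2 * 2 powr (\<kappa> + 2 * b)) / 2 \<le> C" unfolding C_def by linarith
      then have "(1 + (C1\<^sup>2 * exp 3 * C2 * 2 powr (\<kappa> + 2 * b)) / 2) * (T * l) \<le> C * (T * l)"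
        using l T by (intro mult_right_mono) auto
      then show ?thesis by (simp add: algebra_simps)
    qed
    finally show "(\<integral>t. indicator {T..3 * T} t * norm (F (Complex (\<kappa> / 2 + b) t)) \<partial>lborel) \<le> C * T * b powr (- 1 / 2)"
      by (simp add: l_def)
  qed
qed

section \<open>Horizontal integrals\<close>

definition \<Psi> :: "real \<Rightarrow> real \<Rightarrow> real" where
  "\<Psi> B t = (\<integral>b. indicator {0..B} b * norm (F (Complex (\<kappa> / 2 + b) t)) \<partial>lborel)"

lemma \<Psi>_nonneg: "\<Psi> B t \<ge> 0"
  unfolding \<Psi>_def by (rule Bochner_Integration.integral_nonneg) simp

lemma norm_F_bounded_rectangle:
  obtains M where "\<And>b t. b \<in> {0..B} \<Longrightarrow> t \<in> {s..u} \<Longrightarrow> norm (F (Complex (\<kappa> / 2 + b) t)) \<le> M" "M \<ge> 0"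
proof -
  have "continuous_on ({0..B} \<times> {s..u}) (\<lambda>p. F (Complex (\<kappa> / 2 + fst p) (snd p)))"
    by (rule continuous_on_compose2[OF F_cont]) (auto simp: Complex_eq intro!: continuous_intros)
  then have "compact ((\<lambda>p. F (Complex (\<kappa> / 2 + fst p) (snd p))) ` ({0..B} \<times> {s..u}))"
    by (rule compact_continuous_image) (intro compact_Times compact_Icc)
  then obtain M where M: "\<And>p. p \<in> {0..B} \<times> {s..u} \<Longrightarrow> norm (F (Complex (\<kappa> / 2 + fst p) (snd p))) \<le> M"
    using compact_imp_bounded bounded_iff by (metis (no_types, lifting) imageI)
  show ?thesis
  proof (rule that)
    show "norm (F (Complex (\<kappa> / 2 + b) t)) \<le> max M 0" if "b \<in> {0..B}" "t \<in> {s..u}" for b t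
      using M[of "(b, t)"] that by simp
  qed simp
qed

lemma horizontal_integral_Fubini:
  "integrable lborel (\<lambda>t. indicator {s..u} t * \<Psi> B t)"
  "(\<integral>t. indicator {s..u} t * \<Psi> B t \<partial>lborel) =
     (\<integral>b. indicator {0..B} b * (\<integral>t. indicator {s..u} t * norm (F (Complex (\<kappa> / 2 + b) t)) \<partial>lborel) \<partial>lborel)"
  "integrable lborel (\<lambda>b. indicator {0..B} b * (\<integral>t. indicator {s..u} t * norm (F (Complex (\<kappa> / 2 + b) t)) \<partial>lborel))"
proof -
  obtain M where M: "\<And>b t. b \<in> {0..B} \<Longrightarrow> t \<in> {s..u} \<Longrightarrow> norm (F (Complex (\<kappa> / 2 + b) t)) \<le> M" "M \<ge> 0"
    using norm_F_bounded_rectangle by blast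
  let ?G = "\<lambda>t b. indicator {s..u} t * (indicator {0..B} b * norm (F (Complex (\<kappa> / 2 + b) t)))"
  have [measurable]: "F \<in> borel_measurable borel" using F_cont by (rule borel_measurable_continuous_onI)
  have [measurable]: "(\<lambda>p. F (Complex (\<kappa> / 2 + snd p) (fst p))) \<in> borel_measurable (lborel \<Otimes>\<^sub>M lborel)"
    unfolding Complex_eq by measurable
  have "integrable (lborel \<Otimes>\<^sub>M lborel) (\<lambda>p. complex_of_real (case p of (t, b) \<Rightarrow> ?G t b))"
  proof (rule integrable_pair_dominated)
    show "(\<lambda>p. complex_of_real (case p of (t, b) \<Rightarrow> ?G t b)) \<in> borel_measurable (lborel \<Otimes>\<^sub>M lborel)"
      unfolding split_beta by measurable
    show "integrable lborel (\<lambda>t. M * indicator {s..u} t)" "integrable lborel (indicator {0..B} :: real \<Rightarrow> real)"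
      using indicator_integrable by auto
    show "norm (complex_of_real (case (t, b) of (t, b) \<Rightarrow> ?G t b)) \<le> M * indicator {s..u} t * indicator {0..B} b" for t b
      using M by (auto simp: indicator_def)
  qed
  then have i: "integrable (lborel \<Otimes>\<^sub>M lborel) (\<lambda>(t, b). ?G t b)"
    by (simp only: complex_of_real_integrable_eq)
  have e1: "(\<integral>b. ?G t b \<partial>lborel) = indicator {s..u} t * \<Psi> B t" for t
    unfolding \<Psi>_def by (rule integral_mult_right_zero)
  have e2: "(\<integral>t. ?G t b \<partial>lborel) = indicator {0..B} b * (\<integral>t. indicator {s..u} t * norm (F (Complex (\<kappa> / 2 + b) t)) \<partial>lborel)" for b
    by (simp only: integral_mult_right_zero[symmetric] mult.left_commute)
  show "integrable lborel (\<lambda>t. indicator {s..u} t * \<Psi> B t)"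
    using lborel_pair.integrable_fst[OF i] by (simp only: e1)
  show "integrable lborel (\<lambda>b. indicator {0..B} b * (\<integral>t. indicator {s..u} t * norm (F (Complex (\<kappa> / 2 + b) t)) \<partial>lborel))"
    using lborel_pair.integrable_snd[OF i] by (simp only: e2)
  show "(\<integral>t. indicator {s..u} t * \<Psi> B t \<partial>lborel) =
     (\<integral>b. indicator {0..B} b * (\<integral>t. indicator {s..u} t * norm (F (Complex (\<kappa> / 2 + b) t)) \<partial>lborel) \<partial>lborel)"
    using lborel_pair.Fubini_integral[OF i] by (simp only: e1 e2)
qed

lemma inverse_sqrt_integral:
  assumes B: "B > (0::real)"
  shows "integrable lborel (\<lambda>b. indicator {0<..<B} b * b powr (- 1 / 2))"
    "(\<integral>b. indicator {0<..<B} b * b powr (- 1 / 2) \<partial>lborel) = 2 * sqrt B"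
proof -
  have ein: "einterval (ereal 0) (ereal B) = {0<..<B}" by (simp add: einterval_eq_Icc)
  have l: "((\<lambda>b. 2 * sqrt b) \<longlongrightarrow> 0) (at_right 0)" "((\<lambda>b. 2 * sqrt b) \<longlongrightarrow> 2 * sqrt B) (at_left B)"
    by (auto intro!: tendsto_eq_intros)
  have d: "((\<lambda>b. 2 * sqrt b) has_real_derivative b powr (- 1 / 2)) (at b)" if "0 < b" for b
  proof -
    have "b powr (- (1 / 2)) = inverse (sqrt b)" unfolding powr_minus using that by (simp only: powr_half_sqrt)
    then have "b powr (- 1 / 2) = 2 * (inverse (sqrt b) / 2)" by simp
    then show ?thesis using DERIV_cmult[OF DERIV_real_sqrt[OF that], of 2] by (simp only:)
  qed
  have "set_integrable lborel (einterval (ereal 0) (ereal B)) (\<lambda>b. b powr (- 1 / 2))"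
    and "(LBINT b=ereal 0..ereal B. b powr (- 1 / 2)) = 2 * sqrt B - 0"
    by (rule interval_integral_FTC_nonneg[where F = "\<lambda>b. 2 * sqrt b" and A = 0 and B = "2 * sqrt B"];
        use B l d in \<open>auto simp: ereal_tendsto_simps intro!: continuous_intros\<close>)+
  then show "integrable lborel (\<lambda>b. indicator {0<..<B} b * b powr (- 1 / 2))"
    "(\<integral>b. indicator {0<..<B} b * b powr (- 1 / 2) \<partial>lborel) = 2 * sqrt B"
    using B by (simp_all add: set_integrable_def interval_lebesgue_integral_def set_lebesgue_integral_def ein)
qed

text \<open>The vertical means are singular only like b^(-1/2) at the critical line, which is
  integrable; so on average over t a horizontal segment costs O(1).\<close>

lemma horizontal_integral_mean:
  assumes B: "B > 0"
  obtains C where "C > 0" "\<And>T. T \<ge> 1 \<Longrightarrow> (\<integral>t. indicator {T..3 * T} t * \<Psi> B t \<partial>lborel) \<le> C * T"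
proof -
  obtain C where C: "C > 0" "\<And>b T. 0 < b \<Longrightarrow> b \<le> B \<Longrightarrow> T \<ge> 1 \<Longrightarrow>
    (\<integral>t. indicator {T..3 * T} t * norm (F (Complex (\<kappa> / 2 + b) t)) \<partial>lborel) \<le> C * T * b powr (- 1 / 2)"
    using F_vertical_mean[OF B] by blast
  show ?thesis
  proof (rule that)
    show "C * (2 * sqrt B) > 0" using C B by simp
    fix T :: real assume T: "T \<ge> 1"
    have "(\<integral>t. indicator {T..3 * T} t * \<Psi> B t \<partial>lborel) \<le> (\<integral>b. C * T * (indicator {0<..<B} b * b powr (- 1 / 2)) \<partial>lborel)"
      unfolding horizontal_integral_Fubini(2)
    proof (rule integral_mono_AE[OF horizontal_integral_Fubini(3)])
      show "integrable lborel (\<lambda>b. C * T * (indicator {0<..<B} b * b powr (- 1 / 2)))"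
        using inverse_sqrt_integral(1)[OF B] by simp
      \<comment> \<open>The vertical bound holds for b > 0 only; the endpoints form a null
        set.\<close>
      have "AE b in lborel. b \<noteq> (0::real)" "AE b in lborel. b \<noteq> B" by (rule AE_lborel_singleton)+
      then show "AE b in lborel. indicator {0..B} b * (\<integral>t. indicator {T..3 * T} t * norm (F (Complex (\<kappa> / 2 + b) t)) \<partial>lborel)
        \<le> C * T * (indicator {0<..<B} b * b powr (- 1 / 2))"
      proof eventually_elim
        case (elim b)
        then show ?case using C(2)[of b T] T by (auto simp: indicator_def)
      qed
    qed
    also have "\<dots> = C * (2 * sqrt B) * T" using inverse_sqrt_integral(2)[OF B] by simp
    finally show "(\<integral>t. indicator {T..3 * T} t * \<Psi> B t \<partial>lborel) \<le> C * (2 * sqrt B) * T" .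
  qed
qed

section \<open>Short integrals with absolute values\<close>

definition short_abs_integral :: "real \<Rightarrow> real \<Rightarrow> real" where
  "short_abs_integral H t = (\<integral>v. indicator {0..H} v * norm (F (Complex (\<kappa> / 2) (t + v))) \<partial>lborel)"

text \<open>Shifting the line of integration to \<open>Re s = \<kappa>/2 + B\<close>, where the first nonzero term of the Dirichlet
  series dominates, costs only the horizontal integrals \<open>\<Psi>\<close>.\<close>

lemma short_abs_integral_lower:
  obtains A C B where "A > 0" "C > 0" "B > 0"
    "\<And>t H. H > 0 \<Longrightarrow> short_abs_integral H t \<ge> A * H - C * (1 + \<Psi> B t + \<Psi> B (t + H))"
proof -
  obtain N B where NB: "N > 0" "c N \<noteq> 0" "B > 0"
    "\<And>t. norm (F (Complex (\<kappa> / 2 + B) t) * of_nat N powr Complex (\<kappa> / 2 + B) t - c N) \<le> norm (c N) / 2"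
    using leading_term by blast
  define a where "a = norm (c N)"
  have a: "a > 0" using NB by (simp add: a_def)
  \<comment> \<open>The factor N^s turns the leading term into the constant c N, so h - c N is small
    on the right-hand line and the average of h over the critical line can be compared with c
    N.\<close>
  define h where "h s = F s * of_nat N powr s" for s
  have "(\<lambda>s. h s - c N) holomorphic_on UNIV"
    unfolding h_def using NB(1) by (intro holomorphic_intros F_holo)
  then obtain P where P0: "\<And>s. (P has_field_derivative (h s - c N)) (at s within UNIV)"
    using holomorphic_convex_primitive'[of UNIV "\<lambda>s. h s - c N"] by auto
  have P: "(P has_field_derivative (h s - c N)) (at s)" for s using P0 by simp
  have hc: "continuous_on UNIV h"
    unfolding h_def using NB(1) by (intro holomorphic_on_imp_continuous_on holomorphic_intros F_holo)
  have hcC: "continuous_on A (\<lambda>u. h (Complex (x + b * u) (t + d * u)))" for A x b t d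
    by (rule continuous_on_compose2[OF hc]) (auto simp: Complex_eq intro!: continuous_intros)
  have nh: "norm (h (Complex x t)) = real N powr x * norm (F (Complex x t))" for x t
    using NB(1) by (simp add: h_def norm_mult norm_nat_powr)
  have vert: "(\<integral>v. indicator {0..H} v *\<^sub>R (\<i> * (h (Complex x (t + v)) - c N)) \<partial>lborel) = P (Complex x (t + H)) - P (Complex x t)"
    if H: "H > 0" for x t H
  proof -
    have "(\<integral>v. indicator {0..H} v *\<^sub>R (\<i> * (h (Complex x (t + v)) - c N)) \<partial>lborel) = P (Complex x (t + H)) - P (Complex x (t + 0))"
    proof (rule integral_FTC_Icc)
      show "((\<lambda>v. P (Complex x (t + v))) has_vector_derivative \<i> * (h (Complex x (t + v)) - c N)) (at v within {0..H})" for v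
      proof -
        have "((\<lambda>z. P (Complex x t + \<i> * z)) has_field_derivative (h (Complex x (t + v)) - c N) * \<i>) (at (of_real v))"
        proof (rule DERIV_chain2[where f = P and g = "\<lambda>z. Complex x t + \<i> * z"])
          have "Complex x t + \<i> * of_real v = Complex x (t + v)" by (simp add: complex_eq_iff)
          then show "(P has_field_derivative (h (Complex x (t + v)) - c N)) (at (Complex x t + \<i> * of_real v))"
            using P by simp
          show "((\<lambda>z. Complex x t + \<i> * z) has_field_derivative \<i>) (at (of_real v))"
            by (auto intro!: derivative_eq_intros)
        qed
        from has_vector_derivative_real_field[OF this]
        have "((\<lambda>v. P (Complex x t + \<i> * of_real v)) has_vector_derivative (h (Complex x (t + v)) - c N) * \<i>) (at v within {0..H})"
          by (rule has_vector_derivative_at_within)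
        moreover have "Complex x t + \<i> * of_real v = Complex x (t + v)" for v by (simp add: complex_eq_iff)
        ultimately show ?thesis by (simp add: mult.commute)
      qed
      have "continuous_on {0..H} (\<lambda>v. \<i> * (h (Complex (x + 0 * v) (t + 1 * v)) - c N))"
        by (intro continuous_intros hcC)
      then show "continuous_on {0..H} (\<lambda>v. \<i> * (h (Complex x (t + v)) - c N))" by simp
    qed (use H in simp)
    then show ?thesis by simp
  qed
  have hor: "norm (P (Complex (\<kappa> / 2 + B) t) - P (Complex (\<kappa> / 2) t)) \<le> real N powr (\<kappa> / 2 + B) * \<Psi> B t + a * B" for t
  proof -
    have "(\<integral>b. indicator {0..B} b *\<^sub>R (h (Complex (\<kappa> / 2 + b) t) - c N) \<partial>lborel) = P (Complex (\<kappa> / 2 + B) t) - P (Complex (\<kappa> / 2 + 0) t)"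
    proof (rule integral_FTC_Icc)
      show "((\<lambda>b. P (Complex (\<kappa> / 2 + b) t)) has_vector_derivative (h (Complex (\<kappa> / 2 + b) t) - c N)) (at b within {0..B})" for b
      proof -
        have "((\<lambda>z. P (Complex (\<kappa> / 2) t + z)) has_field_derivative (h (Complex (\<kappa> / 2 + b) t) - c N) * 1) (at (of_real b))"
        proof (rule DERIV_chain2[where f = P and g = "\<lambda>z. Complex (\<kappa> / 2) t + z"])
          have "Complex (\<kappa> / 2) t + of_real b = Complex (\<kappa> / 2 + b) t" by (simp add: complex_eq_iff)
          then show "(P has_field_derivative (h (Complex (\<kappa> / 2 + b) t) - c N)) (at (Complex (\<kappa> / 2) t + of_real b))"
            using P by simp
          show "((\<lambda>z. Complex (\<kappa> / 2) t + z) has_field_derivative 1) (at (of_real b))"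
            by (auto intro!: derivative_eq_intros)
        qed
        from has_vector_derivative_real_field[OF this]
        have "((\<lambda>b. P (Complex (\<kappa> / 2) t + of_real b)) has_vector_derivative (h (Complex (\<kappa> / 2 + b) t) - c N) * 1) (at b within {0..B})"
          by (rule has_vector_derivative_at_within)
        moreover have "Complex (\<kappa> / 2) t + of_real b = Complex (\<kappa> / 2 + b) t" for b by (simp add: complex_eq_iff)
        ultimately show ?thesis by simp
      qed
      have "continuous_on {0..B} (\<lambda>b. h (Complex (\<kappa> / 2 + 1 * b) (t + 0 * b)) - c N)"
        by (intro continuous_intros hcC)
      then show "continuous_on {0..B} (\<lambda>b. h (Complex (\<kappa> / 2 + b) t) - c N)" by simp
    qed (use NB in simp)
    then have "norm (P (Complex (\<kappa> / 2 + B) t) - P (Complex (\<kappa> / 2) t)) = norm (\<integral>b. indicator {0..B} b *\<^sub>R (h (Complex (\<kappa> / 2 + b) t) - c N) \<partial>lborel)"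
      by simp
    also have "\<dots> \<le> (\<integral>b. norm (indicator {0..B} b *\<^sub>R (h (Complex (\<kappa> / 2 + b) t) - c N)) \<partial>lborel)"
      by (rule integral_norm_bound)
    also have "\<dots> \<le> (\<integral>b. real N powr (\<kappa> / 2 + B) * (indicator {0..B} b * norm (F (Complex (\<kappa> / 2 + b) t))) + a * indicator {0..B} b \<partial>lborel)"
    proof (rule integral_mono)
      have "continuous_on UNIV (\<lambda>b. h (Complex (\<kappa> / 2 + 1 * b) (t + 0 * b)) - c N)"
        by (intro continuous_intros hcC)
      from integrable_norm[OF integrable_indicator_cont[OF this]]
      show "integrable lborel (\<lambda>b. norm (indicator {0..B} b *\<^sub>R (h (Complex (\<kappa> / 2 + b) t) - c N)))" by simp
      have "continuous_on UNIV (\<lambda>b. norm (F (Complex (\<kappa> / 2 + 1 * b) (t + 0 * b))))"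
        by (intro continuous_on_norm F_Complex_cont)
      from integrable_indicator_cont[OF this]
      have "integrable lborel (\<lambda>b. indicator {0..B} b * norm (F (Complex (\<kappa> / 2 + b) t)))" by simp
      then show "integrable lborel (\<lambda>b. real N powr (\<kappa> / 2 + B) * (indicator {0..B} b * norm (F (Complex (\<kappa> / 2 + b) t))) + a * indicator {0..B} b)"
        using indicator_integrable by (intro Bochner_Integration.integrable_add Bochner_Integration.integrable_mult_right)
      fix b
      show "norm (indicator {0..B} b *\<^sub>R (h (Complex (\<kappa> / 2 + b) t) - c N)) \<le> real N powr (\<kappa> / 2 + B) * (indicator {0..B} b * norm (F (Complex (\<kappa> / 2 + b) t))) + a * indicator {0..B} b"
      proof (cases "b \<in> {0..B}")
        case True
        have "norm (h (Complex (\<kappa> / 2 + b) t) - c N) \<le> norm (h (Complex (\<kappa> / 2 + b) t)) + a"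
          unfolding a_def by (rule norm_triangle_ineq4)
        also have "norm (h (Complex (\<kappa> / 2 + b) t)) \<le> real N powr (\<kappa> / 2 + B) * norm (F (Complex (\<kappa> / 2 + b) t))"
          unfolding nh using True NB(1) by (intro mult_right_mono powr_mono) auto
        finally show ?thesis using True by simp
      qed simp
    qed
    also have "\<dots> = real N powr (\<kappa> / 2 + B) * \<Psi> B t + a * B"
    proof -
      have "continuous_on UNIV (\<lambda>b. norm (F (Complex (\<kappa> / 2 + 1 * b) (t + 0 * b))))"
        by (intro continuous_on_norm F_Complex_cont)
      from integrable_indicator_cont[OF this]
      have "integrable lborel (\<lambda>b. indicator {0..B} b * norm (F (Complex (\<kappa> / 2 + b) t)))" by simp
      then show ?thesis
        unfolding \<Psi>_def using indicator_integrable[of 0 B] NB(3)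
        by (subst Bochner_Integration.integral_add) auto
    qed
    finally show ?thesis .
  qed
  define R where "R = real N powr (\<kappa> / 2 + B)"
  \<comment> \<open>Undoes the modulus N^(\<kappa>/2) of N^s on the critical line.\<close>
  define n where "n = real N powr (- (\<kappa> / 2))"
  have n: "n > 0" "R > 0" using NB by (auto simp: n_def R_def)
  show ?thesis
  proof (rule that)
    show "n * (a / 2) > 0" "n * max R (2 * a * B) > 0" "B > 0" using n a NB by (auto simp: less_max_iff_disj)
    fix t H :: real assume H: "H > 0"
    let ?D = "\<lambda>x. P (Complex x (t + H)) - P (Complex x t)"
    have D1: "norm (?D (\<kappa> / 2 + B)) \<le> a / 2 * H"
    proof -
      have "norm (?D (\<kappa> / 2 + B)) \<le> (\<integral>v. norm (indicator {0..H} v *\<^sub>R (\<i> * (h (Complex (\<kappa> / 2 + B) (t + v)) - c N))) \<partial>lborel)"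
        unfolding vert[OF H, symmetric] by (rule integral_norm_bound)
      also have "\<dots> \<le> (\<integral>v. a / 2 * indicator {0..H} v \<partial>lborel)"
      proof (rule integral_mono)
        have "continuous_on UNIV (\<lambda>v. \<i> * (h (Complex ((\<kappa> / 2 + B) + 0 * v) (t + 1 * v)) - c N))"
          by (intro continuous_intros hcC)
        from integrable_norm[OF integrable_indicator_cont[OF this]]
        show "integrable lborel (\<lambda>v. norm (indicator {0..H} v *\<^sub>R (\<i> * (h (Complex (\<kappa> / 2 + B) (t + v)) - c N))))" by simp
        show "integrable lborel (\<lambda>v. a / 2 * indicator {0..H} v)" using indicator_integrable by auto
        show "norm (indicator {0..H} v *\<^sub>R (\<i> * (h (Complex (\<kappa> / 2 + B) (t + v)) - c N))) \<le> a / 2 * indicator {0..H} v" for v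
          using NB(4)[of "t + v"] by (simp add: indicator_def norm_mult h_def a_def)
      qed
      also have "\<dots> = a / 2 * H" using H by simp
      finally show ?thesis .
    qed
    \<comment> \<open>Cauchy's theorem for the rectangle between the two vertical lines; in terms of
      the primitive P it is an identity between values at the corners.\<close>
    have "?D (\<kappa> / 2) = ?D (\<kappa> / 2 + B) - (P (Complex (\<kappa> / 2 + B) (t + H)) - P (Complex (\<kappa> / 2) (t + H))) + (P (Complex (\<kappa> / 2 + B) t) - P (Complex (\<kappa> / 2) t))"
      by simp
    also have "norm \<dots> \<le> a / 2 * H + (R * \<Psi> B (t + H) + a * B) + (R * \<Psi> B t + a * B)"
      unfolding R_def by (intro order_trans[OF norm_triangle_ineq] order_trans[OF norm_triangle_ineq4] add_mono D1 hor)
    finally have D2: "norm (?D (\<kappa> / 2)) \<le> a / 2 * H + R * (\<Psi> B t + \<Psi> B (t + H)) + 2 * a * B"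
      by (simp add: algebra_simps)
    have hi: "integrable lborel (\<lambda>v. indicator {0..H} v *\<^sub>R h (Complex (\<kappa> / 2) (t + v)))"
    proof -
      have "continuous_on UNIV (\<lambda>v. h (Complex (\<kappa> / 2 + 0 * v) (t + 1 * v)))" by (rule hcC)
      from integrable_indicator_cont[OF this] show ?thesis by simp
    qed
    have ci: "integrable lborel (\<lambda>v. indicator {0..H} v *\<^sub>R c N)"
      using integrable_indicator_cont[OF continuous_on_const[of UNIV "c N"]] .
    let ?Ih = "\<integral>v. indicator {0..H} v *\<^sub>R h (Complex (\<kappa> / 2) (t + v)) \<partial>lborel"
    have "?D (\<kappa> / 2) = (\<integral>v. \<i> * (indicator {0..H} v *\<^sub>R h (Complex (\<kappa> / 2) (t + v)) - indicator {0..H} v *\<^sub>R c N) \<partial>lborel)"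
      unfolding vert[OF H, symmetric] by (simp only: scaleR_diff_right[symmetric] mult_scaleR_right)
    also have "\<dots> = \<i> * (?Ih - (\<integral>v. indicator {0..H} v *\<^sub>R c N \<partial>lborel))"
      by (simp only: integral_mult_right_zero Bochner_Integration.integral_diff[OF hi ci])
    also have "(\<integral>v. indicator {0..H} v *\<^sub>R c N \<partial>lborel) = of_real H * c N"
      using H indicator_integrable[of 0 H] by (subst integral_scaleR_left) (auto simp: scaleR_conv_of_real)
    finally have "norm (?D (\<kappa> / 2)) = norm (?Ih - of_real H * c N)" by (simp add: norm_mult)
    moreover have "norm (of_real H * c N) - norm ?Ih \<le> norm (?Ih - of_real H * c N)"
      using norm_triangle_ineq2[of "of_real H * c N" ?Ih] by (simp only: norm_minus_commute)
    moreover have "norm (of_real H * c N) = a * H" using H by (simp add: norm_mult a_def)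
    moreover have "norm ?Ih \<le> real N powr (\<kappa> / 2) * short_abs_integral H t"
    proof -
      have "norm ?Ih \<le> (\<integral>v. norm (indicator {0..H} v *\<^sub>R h (Complex (\<kappa> / 2) (t + v))) \<partial>lborel)"
        by (rule integral_norm_bound)
      also have "\<dots> = (\<integral>v. real N powr (\<kappa> / 2) * (indicator {0..H} v * norm (F (Complex (\<kappa> / 2) (t + v)))) \<partial>lborel)"
        by (intro Bochner_Integration.integral_cong[OF refl]) (simp add: nh)
      also have "\<dots> = real N powr (\<kappa> / 2) * short_abs_integral H t" unfolding short_abs_integral_def by (rule integral_mult_right_zero)
      finally show ?thesis .
    qed
    ultimately have "real N powr (\<kappa> / 2) * short_abs_integral H t \<ge> a / 2 * H - R * (\<Psi> B t + \<Psi> B (t + H)) - 2 * a * B"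
      using D2 by linarith
    then have "n * (real N powr (\<kappa> / 2) * short_abs_integral H t) \<ge> n * (a / 2 * H - R * (\<Psi> B t + \<Psi> B (t + H)) - 2 * a * B)"
      using n by (intro mult_left_mono) auto
    moreover have "n * (real N powr (\<kappa> / 2) * short_abs_integral H t) = short_abs_integral H t"
      using NB(1) by (simp add: n_def powr_minus)
    \<comment> \<open>The maximum merges the coefficient of the horizontal integrals and the
      constant 2 a B into one factor.\<close>
    moreover have "n * (R * (\<Psi> B t + \<Psi> B (t + H)) + 2 * a * B) \<le> n * (max R (2 * a * B) * (1 + \<Psi> B t + \<Psi> B (t + H)))"
    proof (intro mult_left_mono)
      have "R * (\<Psi> B t + \<Psi> B (t + H)) \<le> max R (2 * a * B) * (\<Psi> B t + \<Psi> B (t + H))"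
        using \<Psi>_nonneg by (intro mult_right_mono add_nonneg_nonneg) auto
      then show "R * (\<Psi> B t + \<Psi> B (t + H)) + 2 * a * B \<le> max R (2 * a * B) * (1 + \<Psi> B t + \<Psi> B (t + H))"
        by (simp add: algebra_simps)
    qed (use n in auto)
    moreover have "n * (a / 2 * H - R * (\<Psi> B t + \<Psi> B (t + H)) - 2 * a * B) = n * (a / 2) * H - n * (R * (\<Psi> B t + \<Psi> B (t + H)) + 2 * a * B)"
      by (simp add: algebra_simps)
    moreover have "n * (max R (2 * a * B) * (1 + \<Psi> B t + \<Psi> B (t + H))) = n * max R (2 * a * B) * (1 + \<Psi> B t + \<Psi> B (t + H))"
      by (simp only: mult.assoc)
    ultimately show "short_abs_integral H t \<ge> n * (a / 2) * H - n * max R (2 * a * B) * (1 + \<Psi> B t + \<Psi> B (t + H))"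
      by linarith
  qed
qed

text \<open>Without a zero of odd order in [t, t+H] the real function X has constant sign there, so
  the integral of its absolute value equals the absolute value of its integral;
  \<open>F_bound\<close> at b = 0 passes from the transform to F.\<close>

lemma short_abs_integral_le:
  obtains C where "C > 0" "\<And>T H t. T \<ge> 1 \<Longrightarrow> 0 < H \<Longrightarrow> H \<le> T \<Longrightarrow> t \<in> {T..2 * T} \<Longrightarrow>
    (\<And>u. t \<le> u \<Longrightarrow> u \<le> t + H \<Longrightarrow> \<not> (F (Complex (\<kappa> / 2) u) = 0 \<and> odd (zorder F (Complex (\<kappa> / 2) u)))) \<Longrightarrow>
    short_abs_integral H t \<le> C * T powr (1/2 - \<kappa> / 2) * norm (short_integral T H t)"
proof -
  obtain C where C: "C > 0" "\<And>b T u. 0 \<le> b \<Longrightarrow> b \<le> 0 \<Longrightarrow> T \<ge> 1 \<Longrightarrow> T \<le> u \<Longrightarrow> u \<le> 3 * T \<Longrightarrow>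
    norm (F (Complex (\<kappa> / 2 + b) u)) \<le> C * T powr (1/2 - \<kappa> / 2 - b) * (norm (laplace (Complex b u)) * exp (\<theta> T * u))"
    using F_bound[of 0] by auto
  have lapc: "continuous_on UNIV (\<lambda>u. laplace (Complex 0 u))"
    by (rule continuous_on_compose2[OF holomorphic_on_imp_continuous_on[OF laplace_entire]])
       (auto simp: Complex_eq intro!: continuous_intros)
  have Xe: "X u = Re (laplace (Complex 0 u) / \<omega>)" for u
    using \<omega> by (simp add: real_on_line)
  have Xc: "continuous_on UNIV X"
    unfolding Xe[abs_def] using \<omega> by (intro continuous_intros lapc) auto
  have XcA: "continuous_on A (\<lambda>v. X (t + v))" for A t
    by (rule continuous_on_compose2[OF Xc]) (auto intro!: continuous_intros)
  \<comment> \<open>On the critical line F = g X. Here g has no zeros, since those of 1/Gamma are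
    the nonpositive integers while \<kappa>/2 > 0; so X and F have the same zeros there.\<close>
  define g where "g u = of_real \<rho> powr (Complex (\<kappa> / 2) u) * rGamma (Complex (\<kappa> / 2) u) * \<omega>" for u
  have gc: "continuous_on UNIV g"
  proof -
    have "(\<lambda>s. of_real \<rho> powr s * rGamma s * \<omega>) holomorphic_on UNIV"
      using \<rho> by (intro holomorphic_intros) auto
    moreover have "continuous_on UNIV (\<lambda>u. Complex (\<kappa> / 2) u)" unfolding Complex_eq by (intro continuous_intros)
    ultimately show ?thesis unfolding g_def
      using continuous_on_compose2[OF holomorphic_on_imp_continuous_on] by blast
  qed
  have gn: "g u \<noteq> 0" for u
  proof -
    have "Complex (\<kappa> / 2) u \<notin> \<int>\<^sub>\<le>\<^sub>0" using \<kappa> by (auto elim!: nonpos_Ints_cases simp: complex_eq_iff)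
    then show ?thesis using \<rho> \<omega> by (simp add: g_def rGamma_eq_zero_iff)
  qed
  have FX: "F (Complex (\<kappa> / 2) u) = g u * of_real (X u)" for u
  proof -
    have "Complex (\<kappa> / 2) u - of_real (\<kappa> / 2) = Complex 0 u" by (simp add: complex_eq_iff)
    then show ?thesis unfolding F_def g_def by (simp only: real_on_line mult.assoc)
  qed
  show ?thesis
  proof (rule that[OF C(1)])
    fix T H t :: real
    assume T: "T \<ge> 1" and H: "0 < H" "H \<le> T" and t: "t \<in> {T..2 * T}"
      and no: "\<And>u. t \<le> u \<Longrightarrow> u \<le> t + H \<Longrightarrow> \<not> (F (Complex (\<kappa> / 2) u) = 0 \<and> odd (zorder F (Complex (\<kappa> / 2) u)))"
    have sgn: "(\<forall>u\<in>{t..t + H}. X u \<ge> 0) \<or> (\<forall>u\<in>{t..t + H}. X u \<le> 0)"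
      by (rule no_odd_zero_constant_sign[OF F_holo F_nz Xc gc gn FX]) (use no in auto)
    let ?E = "\<lambda>v. exp (\<theta> T * (t + v))"
    let ?f = "\<lambda>v. indicator {0..H} v * (X (t + v) * ?E v)"
    have abs_int: "(\<integral>v. \<bar>?f v\<bar> \<partial>lborel) = \<bar>\<integral>v. ?f v \<partial>lborel\<bar>"
      using sgn
    proof
      assume *: "\<forall>u\<in>{t..t + H}. X u \<ge> 0"
      then have f: "?f v \<ge> 0" for v by (auto simp: indicator_def)
      then have "(\<integral>v. \<bar>?f v\<bar> \<partial>lborel) = (\<integral>v. ?f v \<partial>lborel)" by simp
      moreover have "(\<integral>v. ?f v \<partial>lborel) \<ge> 0" using f by (rule Bochner_Integration.integral_nonneg)
      ultimately show ?thesis by simp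
    next
      assume *: "\<forall>u\<in>{t..t + H}. X u \<le> 0"
      then have f: "- ?f v \<ge> 0" for v by (auto simp: indicator_def mult_nonpos_nonneg)
      then have "\<bar>?f v\<bar> = - ?f v" for v by (metis abs_of_nonpos neg_0_le_iff_le)
      then have "(\<integral>v. \<bar>?f v\<bar> \<partial>lborel) = - (\<integral>v. ?f v \<partial>lborel)" by simp
      moreover have "(\<integral>v. - ?f v \<partial>lborel) \<ge> 0" using f by (rule Bochner_Integration.integral_nonneg)
      ultimately show ?thesis by simp
    qed
    have "short_integral T H t = (\<integral>v. \<omega> * of_real (?f v) \<partial>lborel)"
      unfolding short_integral_def real_on_line by (intro Bochner_Integration.integral_cong[OF refl]) (simp add: scaleR_conv_of_real)
    also have "\<dots> = \<omega> * of_real (\<integral>v. ?f v \<partial>lborel)"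
      by (simp only: integral_mult_right_zero integral_complex_of_real)
    finally have nI: "norm (short_integral T H t) = norm \<omega> * (\<integral>v. \<bar>?f v\<bar> \<partial>lborel)"
      unfolding abs_int by (simp add: norm_mult)
    have "short_abs_integral H t \<le> (\<integral>v. C * T powr (1/2 - \<kappa> / 2) * (norm \<omega> * \<bar>?f v\<bar>) \<partial>lborel)"
      unfolding short_abs_integral_def
    proof (rule integral_mono)
      show "integrable lborel (\<lambda>v. indicator {0..H} v * norm (F (Complex (\<kappa> / 2) (t + v))))"
        by (rule F_norm_integrable)
      have "continuous_on UNIV (\<lambda>v. X (t + v) * ?E v)" by (intro continuous_intros XcA)
      from integrable_indicator_cont[OF this, of 0 H]
      have "integrable lborel ?f" by (simp only: real_scaleR_def)
      then have "integrable lborel (\<lambda>v. \<bar>?f v\<bar>)" by (rule integrable_abs)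
      then show "integrable lborel (\<lambda>v. C * T powr (1/2 - \<kappa> / 2) * (norm \<omega> * \<bar>?f v\<bar>))"
        by (intro Bochner_Integration.integrable_mult_right)
      fix v
      show "indicator {0..H} v * norm (F (Complex (\<kappa> / 2) (t + v))) \<le> C * T powr (1/2 - \<kappa> / 2) * (norm \<omega> * \<bar>?f v\<bar>)"
      proof (cases "v \<in> {0..H}")
        case True
        have "norm (F (Complex (\<kappa> / 2 + 0) (t + v))) \<le> C * T powr (1/2 - \<kappa> / 2 - 0) * (norm (laplace (Complex 0 (t + v))) * ?E v)"
          using True t H T by (intro C(2)) auto
        then show ?thesis using True by (simp add: real_on_line norm_mult abs_mult mult_ac)
      qed simp
    qed
    also have "\<dots> = C * T powr (1/2 - \<kappa> / 2) * norm (short_integral T H t)"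
      unfolding nI by (simp only: integral_mult_right_zero)
    finally show "short_abs_integral H t \<le> C * T powr (1/2 - \<kappa> / 2) * norm (short_integral T H t)" .
  qed
qed

text \<open>\<open>card\<close> of an infinite set is 0, so lower bounds for counts and their
  monotonicity rest on finiteness. A nonconstant entire function has finitely many zeros in a
  compact set.\<close>

lemma finite_zeros: "finite {s. Re s = \<sigma> \<and> a \<le> Im s \<and> Im s \<le> b \<and> F s = 0 \<and> Q s}"
proof -
  have "compact (cbox (Complex \<sigma> a) (Complex \<sigma> b))" by (rule compact_cbox)
  moreover have "\<not> F constant_on UNIV"
  proof
    assume "F constant_on UNIV"
    then obtain d where d: "\<And>s. F s = d" by (auto simp: constant_on_def)
    obtain N B where NB: "N > 0" "c N \<noteq> 0" "B > 0"
      "\<And>t. norm (F (Complex (\<kappa> / 2 + B) t) * of_nat N powr Complex (\<kappa> / 2 + B) t - c N) \<le> norm (c N) / 2"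
      using leading_term by blast
    \<comment> \<open>1/Gamma vanishes at 0, so a constant F would be 0, against the leading
      term.\<close>
    have "F (- of_nat 0) = 0" unfolding F_def by (simp add: rGamma_eq_zero_iff)
    then have "c N = 0" using NB(4)[of 0] d by simp
    then show False using NB(2) by simp
  qed
  ultimately have "finite {z \<in> cbox (Complex \<sigma> a) (Complex \<sigma> b). F z = 0}"
    using holomorphic_compact_finite_zeros[OF F_holo] by blast
  then show ?thesis
    by (rule rev_finite_subset) (auto simp: in_cbox_complex_iff)
qed

text \<open>On the set \<open>Gd\<close> of all \<open>t\<close> in \<open>[T, 2T]\<close> such that \<open>[t, t+H]\<close> contains no zero of odd order, the integral \<open>short_integral T H t\<close> is
  free of cancellation, hence of size \<open>H\<close>, while in mean square it is only of size \<open>\<surd>H\<close>. So \<open>Gd\<close> has measure at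
  most \<open>T/2\<close> once \<open>H\<close> is a large constant, and each zero removes an interval of length \<open>H\<close> from \<open>Gd\<close>.\<close>

lemma zero_count_lower:
  obtains H T0 where "H > 0" "T0 \<ge> 1" "H \<le> T0"
    "\<And>T. T \<ge> T0 \<Longrightarrow> real (card {s. Re s = \<kappa> / 2 \<and> T \<le> Im s \<and> Im s \<le> 2 * T + H \<and> F s = 0 \<and> odd (zorder F s)}) \<ge> T / (2 * H)"
proof -
  obtain A C B where ACB: "A > 0" "C > 0" "B > 0"
    "\<And>t H. H > 0 \<Longrightarrow> short_abs_integral H t \<ge> A * H - C * (1 + \<Psi> B t + \<Psi> B (t + H))"
    using short_abs_integral_lower by blast
  obtain C1 where C1: "C1 > 0" "\<And>T H t. T \<ge> 1 \<Longrightarrow> 0 < H \<Longrightarrow> H \<le> T \<Longrightarrow> t \<in> {T..2 * T} \<Longrightarrow>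
    (\<And>u. t \<le> u \<Longrightarrow> u \<le> t + H \<Longrightarrow> \<not> (F (Complex (\<kappa> / 2) u) = 0 \<and> odd (zorder F (Complex (\<kappa> / 2) u)))) \<Longrightarrow>
    short_abs_integral H t \<le> C1 * T powr (1/2 - \<kappa> / 2) * norm (short_integral T H t)"
    using short_abs_integral_le by blast
  obtain C4 where C4: "C4 > 0" "\<And>T H. T \<ge> 1 \<Longrightarrow> H > 0 \<Longrightarrow>
     integrable lborel (\<lambda>t. indicator {T..2 * T} t * (norm (short_integral T H t))\<^sup>2) \<and>
     (\<integral>t. indicator {T..2 * T} t * (norm (short_integral T H t))\<^sup>2 \<partial>lborel) \<le> C4 * H * T powr \<kappa>"
    using short_integral_mean_square by blast
  obtain C5 where C5: "C5 > 0" "\<And>T. T \<ge> 1 \<Longrightarrow> (\<integral>t. indicator {T..3 * T} t * \<Psi> B t \<partial>lborel) \<le> C5 * T"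
    using horizontal_integral_mean[OF ACB(3)] by blast
  \<comment> \<open>D and E G are the total errors per unit of T: D comes from the two horizontal
    integrals, E from the two terms of the inequality J \<le> G/2 + J^2/(2G).\<close>
  define D where "D = 2 * C * C5"
  define E where "E = C1 / 2 * (1 + C4)"
  \<comment> \<open>G is the square root of H. The main term A H and the error E G compete as G^2
    against G, so a large constant G wins; the second entry is what \<open>key\<close>
    requires.\<close>
  define G where "G = max 1 ((C / 2 + D + E) * 2 / A)"
  define H where "H = G\<^sup>2"
  have G: "G \<ge> 1" "G * A / 2 \<ge> C / 2 + D + E"
  proof -
    show "G \<ge> 1" by (simp add: G_def)
    have "G \<ge> (C / 2 + D + E) * 2 / A" by (simp add: G_def)
    then show "G * A / 2 \<ge> C / 2 + D + E" using ACB(1) by (simp add: field_simps)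
  qed
  have DE: "D > 0" "E > 0" using ACB C5(1) C1(1) C4(1) by (auto simp: D_def E_def intro!: mult_pos_pos)
  have H: "H \<ge> 1" using G by (simp add: H_def power2_eq_square) (metis mult_mono' mult_1 zero_le_one)
  have key: "(A * H - C) / 2 \<ge> D + E * G"
  proof -
    have "(C / 2 + D + E) * G \<le> G * A / 2 * G" using G by (intro mult_right_mono) auto
    moreover have "C / 2 + D + E * G \<le> (C / 2 + D + E) * G"
      using mult_left_mono[OF G(1), of "C / 2 + D"] ACB DE by (simp add: algebra_simps)
    ultimately have "C / 2 + D + E * G \<le> G * A / 2 * G" by linarith
    also have "\<dots> = A * H / 2" by (simp add: H_def power2_eq_square)
    finally show ?thesis by (simp add: field_simps)
  qed
  have keypos: "D + E * G > 0" using DE G by (intro add_pos_pos mult_pos_pos) auto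
  show ?thesis
  proof (rule that)
    show "H > 0" "H \<ge> 1" "H \<le> H" using H by auto
    fix T :: real assume "T \<ge> H"
    then have T: "T \<ge> 1" "H \<le> T" using H by auto
    have H0: "H > 0" using H by simp
    define Z where "Z = {s. Re s = \<kappa> / 2 \<and> T \<le> Im s \<and> Im s \<le> 2 * T + H \<and> F s = 0 \<and> odd (zorder F s)}"
    have Z: "finite Z" unfolding Z_def by (rule finite_zeros)
    \<comment> \<open>A zero at height v lies in [t, t+H] exactly when t lies in [v - H, v].\<close>
    define Gd where "Gd = {T..2 * T} - (\<Union>z\<in>Z. {Im z - H..Im z})"
    have [measurable]: "Gd \<in> sets borel" unfolding Gd_def using Z by (intro sets.Diff sets.finite_UN) auto
    define m :: real where "m = (\<integral>t. indicator Gd t \<partial>(lborel :: real measure))"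
    have Gi: "integrable lborel (indicator Gd :: real \<Rightarrow> real)"
    proof (rule Bochner_Integration.integrable_bound[OF indicator_integrable[of T "2 * T"]])
      show "(indicator Gd :: real \<Rightarrow> real) \<in> borel_measurable lborel" by measurable
    qed (auto simp: Gd_def indicator_def)
    \<comment> \<open>Union bound: [T, 2T] has length T and each zero takes away at most H.\<close>
    have m_lower: "m \<ge> T - real (card Z) * H"
    proof -
      have "(\<integral>t. indicator {T..2 * T} t - (\<Sum>z\<in>Z. indicator {Im z - H..Im z} t) \<partial>(lborel :: real measure)) \<le> m"
        unfolding m_def
      proof (rule integral_mono)
        show "integrable lborel (\<lambda>t. indicator {T..2 * T} t - (\<Sum>z\<in>Z. indicator {Im z - H..Im z} t) :: real)"
          using indicator_integrable by (intro Bochner_Integration.integrable_diff Bochner_Integration.integrable_sum) auto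
        show "indicator {T..2 * T} t - (\<Sum>z\<in>Z. indicator {Im z - H..Im z} t) \<le> (indicator Gd t :: real)" for t
        proof (cases "\<exists>z\<in>Z. t \<in> {Im z - H..Im z}")
          case True
          then obtain z where z: "z \<in> Z" "t \<in> {Im z - H..Im z}" by blast
          have "(1::real) = indicator {Im z - H..Im z} t" using z by simp
          also have "\<dots> \<le> (\<Sum>z\<in>Z. indicator {Im z - H..Im z} t)"
            using z(1) Z by (intro member_le_sum) auto
          finally show ?thesis by (auto simp: indicator_def)
        next
          case False
          then have "(\<Sum>z\<in>Z. indicator {Im z - H..Im z} t) = (0::real)" by (intro sum.neutral) auto
          moreover have "indicator Gd t = (indicator {T..2 * T} t :: real)" using False by (auto simp: Gd_def indicator_def)
          ultimately show ?thesis by simp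
        qed
      qed (rule Gi)
      moreover have "(\<integral>t. indicator {T..2 * T} t - (\<Sum>z\<in>Z. indicator {Im z - H..Im z} t) \<partial>(lborel :: real measure)) = T - real (card Z) * H"
      proof -
        have "(\<integral>t. indicator {T..2 * T} t - (\<Sum>z\<in>Z. indicator {Im z - H..Im z} t) \<partial>(lborel :: real measure))
          = (\<integral>t. (indicator {T..2 * T} t :: real) \<partial>(lborel :: real measure)) - (\<integral>t. (\<Sum>z\<in>Z. indicator {Im z - H..Im z} t) \<partial>(lborel :: real measure))"
          by (rule Bochner_Integration.integral_diff) (use indicator_integrable in \<open>auto intro!: Bochner_Integration.integrable_sum\<close>)
        also have "(\<integral>t. (\<Sum>z\<in>Z. (indicator {Im z - H..Im z} t :: real)) \<partial>(lborel :: real measure)) = (\<Sum>z\<in>Z. \<integral>t. indicator {Im z - H..Im z} t \<partial>(lborel :: real measure))"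
          by (rule Bochner_Integration.integral_sum) (use indicator_integrable in auto)
        finally show ?thesis using T H0 by simp
      qed
      ultimately show ?thesis by simp
    qed
    define J2 where "J2 t = indicator {T..2 * T} t * (norm (short_integral T H t))\<^sup>2" for t
    have J2: "integrable lborel J2" "integral\<^sup>L lborel J2 \<le> C4 * H * T powr \<kappa>"
      using C4(2)[OF T(1) H0] unfolding J2_def[abs_def] by auto
    define w where "w t = indicator {T..3 * T} t * \<Psi> B t" for t
    have w: "integrable lborel w" "integral\<^sup>L lborel w \<le> C5 * T"
      using horizontal_integral_Fubini(1)[of T "3 * T" B] C5(2)[OF T(1)] unfolding w_def[abs_def] by auto
    have w0: "w t \<ge> 0" for t using \<Psi>_nonneg by (simp add: w_def)
    \<comment> \<open>Since H \<le> T, both t and t + H stay in [T, 3T] for t in [T, 2T], so the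
      truncated function \<open>w\<close> serves both horizontal sides.\<close>
    have w': "integrable lborel (\<lambda>t. w (t + H))" "(\<integral>t. w (t + H) \<partial>lborel) = integral\<^sup>L lborel w"
      using lborel_integrable_real_affine[OF w(1), of 1 H] lborel_integral_real_affine[of 1 w H] by (simp_all add: add.commute)
    \<comment> \<open>The weight G balances G against J^2/G, as J^2 has mean of order H =
      G^2.\<close>
    let ?R = "\<lambda>t. C * w t + C * w (t + H) + (C1 * G / 2 * indicator {T..2 * T} t + C1 / (2 * G) * T powr (1 - \<kappa>) * J2 t)"
    have pt: "(A * H - C) * indicator Gd t \<le> ?R t" for t
    proof (cases "t \<in> Gd")
      case False
      have "J2 t \<ge> 0" by (simp add: J2_def)
      then show ?thesis using False w0 ACB C1(1) G by (simp add: add_nonneg_nonneg)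
    next
      case True
      then have t: "t \<in> {T..2 * T}" by (simp add: Gd_def)
      have no: "\<not> (F (Complex (\<kappa> / 2) u) = 0 \<and> odd (zorder F (Complex (\<kappa> / 2) u)))" if u: "t \<le> u" "u \<le> t + H" for u
      proof
        assume *: "F (Complex (\<kappa> / 2) u) = 0 \<and> odd (zorder F (Complex (\<kappa> / 2) u))"
        then have "Complex (\<kappa> / 2) u \<in> Z" using u t by (simp add: Z_def)
        moreover have "t \<in> {Im (Complex (\<kappa> / 2) u) - H..Im (Complex (\<kappa> / 2) u)}" using u by simp
        ultimately show False using True unfolding Gd_def by blast
      qed
      define J where "J = T powr (1/2 - \<kappa> / 2) * norm (short_integral T H t)"
      have Jsq: "J\<^sup>2 = T powr (1 - \<kappa>) * J2 t"
      proof -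
        have "(T powr (1/2 - \<kappa> / 2))\<^sup>2 = T powr (1 - \<kappa>)"
          unfolding power2_eq_square powr_add[symmetric] by (rule arg_cong[where f = "\<lambda>x. T powr x"]) (simp add: field_simps)
        then show ?thesis using t by (simp add: J_def J2_def power_mult_distrib)
      qed
      have "A * H - C * (1 + \<Psi> B t + \<Psi> B (t + H)) \<le> short_abs_integral H t" by (rule ACB(4)[OF H0])
      also have "\<dots> \<le> C1 * T powr (1/2 - \<kappa> / 2) * norm (short_integral T H t)"
        by (rule C1(2)[OF T(1) H0 T(2) t no])
      also have "\<dots> = C1 * J" by (simp add: J_def)
      also have "\<dots> \<le> C1 * (G / 2 + J\<^sup>2 / (2 * G))"
      proof (intro mult_left_mono)
        have "2 * G * J \<le> G\<^sup>2 + J\<^sup>2" using zero_le_power2[of "G - J"] by (simp add: power2_diff)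
        then have "J \<le> (G\<^sup>2 + J\<^sup>2) / (2 * G)" using G by (simp add: field_simps)
        also have "\<dots> = G / 2 + J\<^sup>2 / (2 * G)" using G by (simp add: add_divide_distrib power2_eq_square)
        finally show "J \<le> G / 2 + J\<^sup>2 / (2 * G)" .
      qed (use C1 in simp)
      finally have "A * H - C * (1 + \<Psi> B t + \<Psi> B (t + H)) \<le> C1 * (G / 2 + J\<^sup>2 / (2 * G))" .
      moreover have "w t = \<Psi> B t" "w (t + H) = \<Psi> B (t + H)" using t T H0 by (auto simp: w_def)
      ultimately show ?thesis using True t by (simp add: Jsq algebra_simps)
    qed
    have Ri: "integrable lborel ?R"
      using w(1) w'(1) J2(1) indicator_integrable
      by (intro Bochner_Integration.integrable_add Bochner_Integration.integrable_mult_right)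
    have "(A * H - C) * m = (\<integral>t. (A * H - C) * indicator Gd t \<partial>lborel)"
      unfolding m_def by (rule integral_mult_right_zero[symmetric])
    also have "\<dots> \<le> integral\<^sup>L lborel ?R"
      using Gi Ri pt by (intro integral_mono Bochner_Integration.integrable_mult_right)
    also have "integral\<^sup>L lborel ?R = C * integral\<^sup>L lborel w + C * integral\<^sup>L lborel w + (C1 * G / 2 * T + C1 / (2 * G) * T powr (1 - \<kappa>) * integral\<^sup>L lborel J2)"
    proof -
      note i1 = Bochner_Integration.integrable_mult_right[OF w(1), of C]
      note i2 = Bochner_Integration.integrable_mult_right[OF w'(1), of C]
      note i3 = Bochner_Integration.integrable_mult_right[OF indicator_integrable[of T "2 * T"], of "C1 * G / 2"]
      note i4 = Bochner_Integration.integrable_mult_right[OF J2(1), of "C1 / (2 * G) * T powr (1 - \<kappa>)"]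
      show ?thesis
        unfolding Bochner_Integration.integral_add[OF Bochner_Integration.integrable_add[OF i1 i2] Bochner_Integration.integrable_add[OF i3 i4]]
          Bochner_Integration.integral_add[OF i1 i2] Bochner_Integration.integral_add[OF i3 i4] integral_mult_right_zero w'(2)
        using T by simp
    qed
    also have "\<dots> \<le> C * (C5 * T) + C * (C5 * T) + (C1 * G / 2 * T + C1 / (2 * G) * T powr (1 - \<kappa>) * (C4 * H * T powr \<kappa>))"
      using w(2) J2(2) ACB(2) C1(1) G by (intro add_mono mult_left_mono order_refl) auto
    also have "\<dots> = T * (D + E * G)"
    proof -
      have "T powr (1 - \<kappa>) * T powr \<kappa> = T" using T by (simp add: powr_add[symmetric])
      then have "C1 / (2 * G) * T powr (1 - \<kappa>) * (C4 * H * T powr \<kappa>) = C1 / (2 * G) * C4 * H * T"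
        by (metis (no_types, opaque_lifting) mult.assoc mult.commute)
      also have "\<dots> = C1 / 2 * C4 * G * T" using G by (simp add: H_def power2_eq_square)
      finally show ?thesis by (simp add: D_def E_def algebra_simps)
    qed
    finally have "(A * H - C) * m \<le> T * (D + E * G)" .
    \<comment> \<open>By \<open>key\<close> the factor A H - C is at least twice D + E G; this 2
      forces m \<le> T/2.\<close>
    moreover have "2 * (D + E * G) * m \<le> (A * H - C) * m"
    proof (rule mult_right_mono)
      show "m \<ge> 0" unfolding m_def by (rule Bochner_Integration.integral_nonneg) simp
      show "2 * (D + E * G) \<le> A * H - C" using key by (simp add: field_simps)
    qed
    ultimately have "(D + E * G) * (2 * m) \<le> (D + E * G) * T" by (simp add: algebra_simps)
    then have "2 * m \<le> T" using keypos by (simp only: mult_le_cancel_left_pos)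
    then have "real (card Z) * H \<ge> T / 2" using m_lower by linarith
    then show "real (card {s. Re s = \<kappa> / 2 \<and> T \<le> Im s \<and> Im s \<le> 2 * T + H \<and> F s = 0 \<and> odd (zorder F s)}) \<ge> T / (2 * H)"
      unfolding Z_def[symmetric] using H0 by (simp add: field_simps)
  qed
qed

lemma odd_zero_count_linear:
  "\<exists>d::real. d > 0 \<and> Liminf at_top (\<lambda>T::real. ereal (real (odd_zero_count F (\<kappa> / 2) T) / T)) > ereal d"
proof -
  obtain H T0 where H: "H > 0" "T0 \<ge> 1" "H \<le> T0"
    "\<And>T. T \<ge> T0 \<Longrightarrow> real (card {s. Re s = \<kappa> / 2 \<and> T \<le> Im s \<and> Im s \<le> 2 * T + H \<and> F s = 0 \<and> odd (zorder F s)}) \<ge> T / (2 * H)"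
    using zero_count_lower by blast
  have "1 / (6 * H) \<le> real (odd_zero_count F (\<kappa> / 2) T) / T" if T: "T \<ge> 3 * T0" for T
  proof -
    \<comment> \<open>With T/3 in place of T the window [T/3, 2T/3 + H] lies in [0, T], because H
      \<le> T0 \<le> T/3.\<close>
    let ?Z = "{s. Re s = \<kappa> / 2 \<and> T / 3 \<le> Im s \<and> Im s \<le> 2 * (T / 3) + H \<and> F s = 0 \<and> odd (zorder F s)}"
    have "T / 3 / (2 * H) \<le> real (card ?Z)" using T by (intro H(4)) simp
    also have "card ?Z \<le> odd_zero_count F (\<kappa> / 2) T"
      unfolding odd_zero_count_def
    proof (rule card_mono)
      show "finite {s. Re s = \<kappa> / 2 \<and> 0 \<le> Im s \<and> Im s \<le> T \<and> F s = 0 \<and> odd (zorder F s)}"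
        by (rule finite_zeros)
      show "?Z \<subseteq> {s. Re s = \<kappa> / 2 \<and> 0 \<le> Im s \<and> Im s \<le> T \<and> F s = 0 \<and> odd (zorder F s)}"
        using T H by auto
    qed
    finally have "T / 3 / (2 * H) \<le> real (odd_zero_count F (\<kappa> / 2) T)" by simp
    moreover have "T > 0" using T H by linarith
    ultimately show ?thesis using H(1) by (simp add: field_simps)
  qed
  then have "eventually (\<lambda>T. ereal (1 / (6 * H)) \<le> ereal (real (odd_zero_count F (\<kappa> / 2) T) / T)) at_top"
    unfolding eventually_at_top_linorder by (intro exI[of _ "3 * T0"]) simp
  then have "ereal (1 / (6 * H)) \<le> Liminf at_top (\<lambda>T::real. ereal (real (odd_zero_count F (\<kappa> / 2) T) / T))"
    by (rule Liminf_bounded)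
  \<comment> \<open>Half of the bound obtained, since the conclusion is a strict inequality.\<close>
  moreover have "ereal (1 / (12 * H)) < ereal (1 / (6 * H))" using H(1) by (simp add: field_simps)
  ultimately have "ereal (1 / (12 * H)) < Liminf at_top (\<lambda>T::real. ereal (real (odd_zero_count F (\<kappa> / 2) T) / T))"
    by (rule less_le_trans[rotated])
  then show ?thesis using H(1) by (intro exI[of _ "1 / (12 * H)"]) simp
qed

end

section \<open>Fourier expansions\<close>

lemma upper_half_plane_iff [simp]: "z \<in> upper_half_plane \<longleftrightarrow> Im z > 0"
  by (simp add: upper_half_plane_def)

lemma periodic_int_shift:
  fixes p :: "complex \<Rightarrow> complex" and L :: real
  assumes per: "\<And>z. Im z > 0 \<Longrightarrow> p (z + of_real L) = p z" and z: "Im z > 0"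
  shows "p (z + of_int n * of_real L) = p z"
proof -
  have nat: "p (w + of_nat m * of_real L) = p w" if "Im w > 0" for w m
  proof (induction m)
    case (Suc m)
    have "p (w + of_nat (Suc m) * of_real L) = p ((w + of_nat m * of_real L) + of_real L)"
      by (simp add: algebra_simps)
    also have "\<dots> = p (w + of_nat m * of_real L)"
      using that by (intro per) simp
    finally show ?case using Suc by simp
  qed simp
  show ?thesis
  proof (cases "n \<ge> 0")
    case True
    then show ?thesis using nat[OF z, of "nat n"] by simp
  next
    case False
    have "p ((z + of_int n * of_real L) + of_nat (nat (-n)) * of_real L) = p (z + of_int n * of_real L)"
      using z by (intro nat) simp
    then show ?thesis using False by (simp add: algebra_simps)
  qed
qed

text \<open>H is p composed with a logarithm, well defined by periodicity. It is holomorphic off 0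
  by means of local branches, and at 0 because the limit at the cusp makes the singularity
  removable.\<close>

lemma periodic_factor:
  fixes p :: "complex \<Rightarrow> complex" and L :: real
  assumes L: "L > 0" and holo: "p holomorphic_on upper_half_plane"
    and per: "\<And>z. Im z > 0 \<Longrightarrow> p (z + of_real L) = p z"
    and lim: "(p \<longlongrightarrow> 0) (filtercomap Im at_top)"
  obtains H where "H holomorphic_on ball 0 1" "H 0 = 0"
    "\<And>z. Im z > 0 \<Longrightarrow> p z = H (exp (2 * of_real pi * \<i> * z / of_real L))"
proof -
  define H where "H q = (if q = 0 then 0 else p (of_real L * Ln q / (2 * of_real pi * \<i>)))" for q
  have Im_eq: "Im (of_real L * w / (2 * of_real pi * \<i>)) = - L * Re w / (2 * pi)" for w
    by (simp add: Im_divide power2_eq_square field_simps)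
  have fac: "p z = H (exp (2 * of_real pi * \<i> * z / of_real L))" if z: "Im z > 0" for z
  proof -
    define q where "q = exp (2 * of_real pi * \<i> * z / of_real L)"
    have "exp (Ln q) = exp (2 * of_real pi * \<i> * z / of_real L)"
      by (simp add: q_def)
    then obtain n :: int where n: "Ln q = 2 * of_real pi * \<i> * z / of_real L + of_int (2 * n) * of_real pi * \<i>"
      using exp_eq by (metis of_real_mult of_real_of_int_eq)
    have "of_real L * Ln q / (2 * of_real pi * \<i>) = z + of_int n * of_real L"
      unfolding n using L by (simp add: field_simps)
    then have "H q = p (z + of_int n * of_real L)"
      by (simp add: H_def q_def)
    also have "\<dots> = p z" using per z by (rule periodic_int_shift)
    finally show ?thesis by (simp add: q_def)
  qed
  have at: "\<exists>e>0. H holomorphic_on ball q0 e" if q0: "q0 \<noteq> 0" "norm q0 < 1" for q0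
  proof -
    define e where "e = min (norm q0) (1 - norm q0)"
    \<comment> \<open>A local branch of the logarithm: q/q0 stays near 1, so the cut of
      \<open>Ln\<close> is avoided even when q0 lies on it.\<close>
    define g where "g q = of_real L * (Ln q0 + Ln (q / q0)) / (2 * of_real pi * \<i>)" for q
    have e: "e > 0" using q0 by (auto simp: e_def)
    have near: "q \<noteq> 0 \<and> norm q < 1 \<and> q / q0 \<notin> \<real>\<^sub>\<le>\<^sub>0" if "q \<in> ball q0 e" for q
    proof -
      have d: "norm (q - q0) < e" using that by (simp add: dist_norm norm_minus_commute)
      have 1: "q \<noteq> 0" using d by (auto simp: e_def)
      have "norm q \<le> norm (q - q0) + norm q0" by (metis diff_add_cancel norm_triangle_ineq)
      then have 2: "norm q < 1" using d by (auto simp: e_def)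
      have "norm (q / q0 - 1) = norm (q - q0) / norm q0"
        using q0 by (simp add: norm_divide[symmetric] diff_divide_distrib)
      also have "\<dots> < 1" using d q0 by (simp add: e_def)
      finally have n: "norm (q / q0 - 1) < 1" .
      have "\<bar>Re (q / q0 - 1)\<bar> < 1" using abs_Re_le_cmod[of "q/q0 - 1"] n by linarith
      then have "Re (q / q0) > 0" by simp
      then show ?thesis using 1 2 complex_nonpos_Reals_iff by (metis not_le)
    qed
    have expg: "exp (2 * of_real pi * \<i> * g q / of_real L) = q" if "q \<in> ball q0 e" for q
    proof -
      have "2 * of_real pi * \<i> * g q / of_real L = Ln q0 + Ln (q / q0)"
        unfolding g_def using L by simp
      then show ?thesis using near[OF that] q0 by (simp add: exp_add)
    qed
    have Img: "Im (g q) > 0" if "q \<in> ball q0 e" for q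
    proof -
      have "norm q = exp (Re (Ln q0 + Ln (q / q0)))"
        using expg[OF that] near[OF that] q0 by (metis exp_Ln exp_add norm_exp_eq_Re nonzero_mult_div_cancel_left times_divide_eq_right divide_eq_0_iff)
      then have "Re (Ln q0 + Ln (q / q0)) < 0"
        using near[OF that] by (metis exp_less_one_iff)
      then show ?thesis unfolding g_def Im_eq using L
        by (simp add: divide_neg_pos mult_pos_neg)
    qed
    have eq: "H q = p (g q)" if "q \<in> ball q0 e" for q
      using fac[OF Img[OF that]] expg[OF that] by simp
    have "g holomorphic_on ball q0 e" unfolding g_def
      using near q0 by (intro holomorphic_intros) auto
    then have "(p \<circ> g) holomorphic_on ball q0 e"
      by (rule holomorphic_on_compose_gen[OF _ holo]) (use Img in auto)
    then have "H holomorphic_on ball q0 e"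
      by (rule holomorphic_transform) (simp add: eq)
    then show ?thesis using e by blast
  qed
  \<comment> \<open>\<open>SOME\<close> selects a radius at each point, so that the balls form an
    open cover of the punctured disc.\<close>
  have hol1: "H holomorphic_on (ball 0 1 - {0})"
  proof (rule holomorphic_on_subset[where s = "\<Union>q\<in>ball 0 1 - {0}. ball q (SOME e. e > 0 \<and> H holomorphic_on ball q e)"])
    have S: "(SOME e. e > 0 \<and> H holomorphic_on ball q e) > 0 \<and> H holomorphic_on ball q (SOME e. e > 0 \<and> H holomorphic_on ball q e)"
      if "q \<in> ball 0 1 - {0}" for q
      using someI_ex[of "\<lambda>e. e > 0 \<and> H holomorphic_on ball q e"] at[of q] that by auto
    show "H holomorphic_on (\<Union>q\<in>ball 0 1 - {0}. ball q (SOME e. e > 0 \<and> H holomorphic_on ball q e))"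
      by (rule holomorphic_on_UN_open) (use S in auto)
    show "ball 0 1 - {0} \<subseteq> (\<Union>q\<in>ball 0 1 - {0}. ball q (SOME e. e > 0 \<and> H holomorphic_on ball q e))"
      using S by force
  qed
  have lim0: "(H \<longlongrightarrow> H 0) (at 0)"
  proof -
    have "(H \<longlongrightarrow> 0) (at 0)"
    proof (rule tendstoI)
      fix e :: real assume "e > 0"
      then have "eventually (\<lambda>z. dist (p z) 0 < e) (filtercomap Im at_top)"
        using lim by (simp add: tendsto_iff)
      then obtain P where P: "eventually P at_top" "\<And>z. P (Im z) \<Longrightarrow> dist (p z) 0 < e"
        unfolding eventually_filtercomap by blast
      then obtain Y where Y: "\<And>y. y \<ge> Y \<Longrightarrow> P y" unfolding eventually_at_top_linorder by blast
      have "eventually (\<lambda>q::complex. norm q < exp (- 2 * pi * Y / L)) (at 0)"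
        unfolding eventually_at by (intro exI[of _ "exp (- 2 * pi * Y / L)"]) (auto simp: dist_norm)
      moreover have "eventually (\<lambda>q::complex. q \<noteq> 0) (at 0)" by (simp add: eventually_at_filter)
      ultimately show "eventually (\<lambda>q. dist (H q) 0 < e) (at 0)"
      proof eventually_elim
        case (elim q)
        then have "ln (norm q) < - 2 * pi * Y / L"
          using ln_less_cancel_iff[of "norm q" "exp (- 2 * pi * Y / L)"] by simp
        then have "- L * Re (Ln q) / (2 * pi) \<ge> Y"
          using L elim by (simp add: field_simps)
        then have "P (Im (of_real L * Ln q / (2 * of_real pi * \<i>)))"
          unfolding Im_eq by (rule Y)
        then show ?case using elim P(2) by (simp add: H_def)
      qed
    qed
    then show ?thesis by (simp add: H_def)
  qed
  have "continuous_on (ball 0 1) H"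
    unfolding continuous_on_eq_continuous_at[OF open_ball]
  proof
    fix q :: complex assume q: "q \<in> ball 0 1"
    show "isCont H q"
    proof (cases "q = 0")
      case True then show ?thesis using lim0 by (simp add: isCont_def)
    next
      case False
      have "continuous_on (ball 0 1 - {0}) H" using hol1 by (rule holomorphic_on_imp_continuous_on)
      moreover have "open (ball 0 (1::real) - {0::complex})" by (intro open_Diff) auto
      ultimately show ?thesis using q False
        using continuous_on_eq_continuous_at by blast
    qed
  qed
  then have "H holomorphic_on ball 0 1"
    using no_isolated_singularity[of "ball 0 1" H "{0}"] hol1 by simp
  then show ?thesis using that[of H] fac by (simp add: H_def)
qed

text \<open>As H vanishes at 0 and its derivative is bounded on a smaller closed disc, |H(q)| \<le>
  C |q|, and |q| is the exponential on the right.\<close>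

lemma cusp_decay:
  fixes p :: "complex \<Rightarrow> complex" and L :: real
  assumes L: "L > 0" and holo: "p holomorphic_on upper_half_plane"
    and per: "\<And>z. Im z > 0 \<Longrightarrow> p (z + of_real L) = p z"
    and lim: "(p \<longlongrightarrow> 0) (filtercomap Im at_top)" and y0: "y0 > 0"
  obtains C where "\<And>z. Im z \<ge> y0 \<Longrightarrow> norm (p z) \<le> C * exp (- 2 * pi * Im z / L)"
proof -
  obtain H where H: "H holomorphic_on ball 0 1" "H 0 = 0"
    "\<And>z. Im z > 0 \<Longrightarrow> p z = H (exp (2 * of_real pi * \<i> * z / of_real L))"
    using periodic_factor[OF assms(1-4)] by blast
  define r where "r = exp (- 2 * pi * y0 / L)"
  have r: "r < 1" using L y0 by (simp add: r_def divide_neg_pos)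
  have sub: "cball 0 r \<subseteq> ball 0 1" using r by auto
  have "continuous_on (cball 0 r) (deriv H)"
    using holomorphic_on_imp_continuous_on[OF holomorphic_deriv[OF H(1) open_ball]] sub
    by (rule continuous_on_subset)
  then have "compact (deriv H ` cball 0 r)" by (rule compact_continuous_image) simp
  then obtain C where C: "\<And>q. q \<in> cball 0 r \<Longrightarrow> norm (deriv H q) \<le> C"
    by (meson bounded_iff compact_imp_bounded imageI)
  have bd: "norm (H q) \<le> C * norm q" if "norm q \<le> r" for q
  proof -
    have "norm (H q - H 0) \<le> C * norm (q - 0)"
    proof (rule field_differentiable_bound[of "cball 0 r" H "deriv H"])
      show "(H has_field_derivative deriv H z) (at z within cball 0 r)" if "z \<in> cball 0 r" for z
        using H(1) sub that holomorphic_derivI[OF H(1) open_ball]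
        by (meson has_field_derivative_at_within subsetD)
      show "0 \<in> cball 0 r" by (simp add: r_def)
    qed (use that C in auto)
    then show ?thesis by (simp add: H(2))
  qed
  show ?thesis
  proof (rule that)
    fix z assume z: "Im z \<ge> y0"
    have n: "norm (exp (2 * of_real pi * \<i> * z / of_real L)) = exp (- 2 * pi * Im z / L)"
      using L by (simp add: norm_exp_eq_Re)
    have "norm (exp (2 * of_real pi * \<i> * z / of_real L)) \<le> r"
      unfolding n r_def using z L by (simp add: divide_le_cancel)
    from bd[OF this] show "norm (p z) \<le> C * exp (- 2 * pi * Im z / L)"
      using H(3)[of z] z y0 n by simp
  qed
qed

lemma tendsto_zero_at_cusp:
  fixes p :: "complex \<Rightarrow> complex" and \<alpha> :: real
  assumes bd: "\<And>z. Im z > 0 \<Longrightarrow> norm (p z) \<le> C * Im z powr (- \<alpha>)" and \<alpha>: "\<alpha> > 0"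
  shows "(p \<longlongrightarrow> 0) (filtercomap Im at_top)"
proof (rule Lim_null_comparison)
  show "eventually (\<lambda>z. norm (p z) \<le> C * Im z powr (- \<alpha>)) (filtercomap Im at_top)"
    using bd eventually_filtercomapI[OF eventually_gt_at_top[of "0::real"]] by (rule eventually_mono[rotated])
  have "((\<lambda>y. C * y powr (- \<alpha>)) \<longlongrightarrow> C * 0) at_top"
    using \<alpha> by (intro tendsto_mult tendsto_const tendsto_neg_powr filterlim_ident) auto
  then have "((\<lambda>y. C * y powr (- \<alpha>)) \<longlongrightarrow> 0) at_top" by simp
  then show "((\<lambda>z. C * Im z powr (- \<alpha>)) \<longlongrightarrow> 0) (filtercomap Im at_top)"
    by (rule filterlim_compose) (rule filterlim_filtercomap)
qed

text \<open>The coefficient bound is Hecke's: Cauchy's inequality on the circle |q| = exp (-2 pi/n),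
  which corresponds to Im z = 1/n; the n-th power of this radius gives the factor exp (2
  pi).\<close>

lemma fourier_expansion:
  fixes p :: "complex \<Rightarrow> complex" and \<alpha> :: real
  assumes holo: "p holomorphic_on upper_half_plane"
    and per: "\<And>z. Im z > 0 \<Longrightarrow> p (z + 1) = p z"
    and bd: "\<And>z. Im z > 0 \<Longrightarrow> norm (p z) \<le> C * Im z powr (- \<alpha>)" and \<alpha>: "\<alpha> > 0"
  obtains a where "a 0 = 0"
    "\<And>z. Im z > 0 \<Longrightarrow> (\<lambda>n. a n * exp (2 * of_real pi * \<i> * of_nat n * z)) sums p z"
    "\<And>n. norm (a n) \<le> C * exp (2 * pi) * real n powr \<alpha>"
proof -
  note lim = tendsto_zero_at_cusp[OF bd \<alpha>]
  obtain H where H: "H holomorphic_on ball 0 1" "H 0 = 0"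
    "\<And>z. Im z > 0 \<Longrightarrow> p z = H (exp (2 * of_real pi * \<i> * z))"
    using periodic_factor[of 1 p] holo per lim by auto
  define a where "a n = (deriv ^^ n) H 0 / fact n" for n
  have C0: "C \<ge> 0" using order_trans[OF norm_ge_zero bd[of \<i>]] by simp
  show ?thesis
  proof (rule that)
    show "a 0 = 0" by (simp add: a_def H)
    show "(\<lambda>n. a n * exp (2 * of_real pi * \<i> * of_nat n * z)) sums p z" if z: "Im z > 0" for z
    proof -
      have "exp (2 * of_real pi * \<i> * z) \<in> ball 0 1"
        using z by (simp add: norm_exp_eq_Re)
      from holomorphic_power_series[OF H(1) this]
      show ?thesis unfolding H(3)[OF z] a_def
        by (simp add: exp_of_nat_mult[symmetric] mult_ac)
    qed
    show "norm (a n) \<le> C * exp (2 * pi) * real n powr \<alpha>" for n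
    proof (cases "n = 0")
      case True then show ?thesis by (simp add: a_def H)
    next
      case False
      define r where "r = exp (- 2 * pi / real n)"
      have r: "0 < r" "r < 1" using False by (auto simp: r_def)
      have "norm ((deriv ^^ n) H 0) \<le> fact n * (C * real n powr \<alpha>) / r ^ n"
      proof (rule Cauchy_inequality)
        show "H holomorphic_on ball 0 r" using H(1) r by (auto intro: holomorphic_on_subset)
        show "continuous_on (cball 0 r) H"
          using holomorphic_on_imp_continuous_on[OF H(1)] r by (auto intro: continuous_on_subset)
        fix q :: complex assume q: "norm (0 - q) = r"
        define z where "z = Ln q / (2 * of_real pi * \<i>)"
        have q0: "q \<noteq> 0" using q r by auto
        have "Im z = - ln (norm q) / (2 * pi)"
          unfolding z_def by (simp add: Im_divide power2_eq_square field_simps q0)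
        also have "\<dots> = 1 / real n" using q False by (simp add: r_def)
        finally have Imz: "Im z = 1 / real n" .
        have "exp (2 * of_real pi * \<i> * z) = q" unfolding z_def using q0 by simp
        then have "norm (H q) = norm (p z)" using H(3)[of z] Imz False by simp
        also have "\<dots> \<le> C * Im z powr (- \<alpha>)" using Imz False by (intro bd) simp
        also have "\<dots> = C * real n powr \<alpha>"
          unfolding Imz using False by (simp add: powr_minus powr_divide)
        finally show "norm (H q) \<le> C * real n powr \<alpha>" .
      qed (use r in auto)
      also have "r ^ n = exp (- 2 * pi)" unfolding r_def using False by (simp add: exp_of_nat_mult[symmetric])
      finally show ?thesis by (simp add: a_def norm_divide exp_minus field_simps)
    qed
  qed
qed

section \<open>Growth of cusp forms\<close>

lemma Jacobi_0_1: "Jacobi a 1 = 1"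
  by (simp add: Jacobi_def)

lemma abs_Jacobi_le: "\<bar>Jacobi a n\<bar> \<le> 1"
proof -
  have L: "\<bar>Legendre a p\<bar> \<le> 1" for p by (simp add: Legendre_def)
  have "\<bar>\<Prod>p\<in>#A. Legendre a p\<bar> \<le> 1" for A
    by (induction A) (auto simp: abs_mult intro!: mult_le_one L)
  then show ?thesis by (simp add: Jacobi_def)
qed

text \<open>Growth is studied through the fourth power of f, which removes signs,
  \<open>theta_eps\<close> and the branch of the square root from the transformation law. The value
  0 is carried along as a case, harmless for upper bounds.\<close>

lemma shimura_symbol_power4: "shimura_symbol c d ^ (4 * m) \<in> {0, 1}"
proof -
  have "\<bar>shimura_symbol c d\<bar> \<le> 1"
    by (simp add: shimura_symbol_def abs_Jacobi_le)
  then have "shimura_symbol c d \<in> {-1, 0, 1}" by auto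
  then show ?thesis by (cases "m = 0") (auto simp: power_0_left)
qed

lemma theta_eps_power4: "theta_eps d ^ 4 = 1"
  by (simp add: theta_eps_def)

lemma half_power_power4: "half_power z (int m) ^ 4 = z ^ (2 * m)"
proof -
  have "half_power z (int m) ^ 4 = csqrt z ^ (2 * (2 * m))"
    by (simp add: half_power_def power_mult[symmetric] mult.commute)
  also have "\<dots> = z ^ (2 * m)" unfolding power_mult[of "csqrt z" 2] power2_csqrt ..
  finally show ?thesis .
qed

lemma half_power_minus: "half_power z (- m) = inverse (half_power z m)"
  by (simp add: half_power_def power_int_minus)

section \<open>The action of SL_2(Z) on the upper half-plane\<close>

lemma moebius_denom_nz:
  fixes a b c d :: int
  assumes "a * d - b * c = 1" "Im z > 0"
  shows "of_int c * z + of_int d \<noteq> (0::complex)"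
proof
  assume *: "of_int c * z + of_int d = (0::complex)"
  then have "Im (of_int c * z + of_int d) = 0" by simp
  then have "c = 0" using assms by simp
  then show False using * assms by auto
qed

lemma Im_moebius_act:
  fixes a b c d :: int
  assumes det: "a * d - b * c = 1" and z: "Im z > 0"
  shows "Im (moebius_act a b c d z) = Im z / (norm (of_int c * z + of_int d))\<^sup>2"
proof -
  have "Im (moebius_act a b c d z) = real_of_int (a * d - b * c) * Im z / (norm (of_int c * z + of_int d))\<^sup>2"
    unfolding moebius_act_def
    by (simp add: Im_divide cmod_power2 algebra_simps)
  then show ?thesis by (simp add: det)
qed

lemma Im_moebius_act_pos:
  fixes a b c d :: int
  assumes "a * d - b * c = 1" "Im z > 0"
  shows "Im (moebius_act a b c d z) > 0"
  using Im_moebius_act[OF assms] moebius_denom_nz[OF assms] assms by simp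

lemma moebius_act_comp:
  fixes a b c d a' b' c' d' :: int
  assumes det: "a * d - b * c = 1" "a' * d' - b' * c' = 1" and z: "Im z > 0"
  shows "moebius_act a b c d (moebius_act a' b' c' d' z) =
         moebius_act (a * a' + b * c') (a * b' + b * d') (c * a' + d * c') (c * b' + d * d') z"
proof -
  let ?D = "of_int c' * z + of_int d' :: complex" and ?Nm = "of_int a' * z + of_int b' :: complex"
  have D: "?D \<noteq> 0" using moebius_denom_nz[OF det(2) z] .
  have "moebius_act a b c d (?Nm / ?D) = (of_int a * (?Nm / ?D) + of_int b) * ?D / ((of_int c * (?Nm / ?D) + of_int d) * ?D)"
    using D by (simp add: moebius_act_def)
  also have "\<dots> = (of_int a * ?Nm + of_int b * ?D) / (of_int c * ?Nm + of_int d * ?D)"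
    using D by (simp add: distrib_right)
  also have "\<dots> = moebius_act (a * a' + b * c') (a * b' + b * d') (c * a' + d * c') (c * b' + d * d') z"
    by (simp add: moebius_act_def algebra_simps)
  finally show ?thesis by (simp add: moebius_act_def)
qed

lemma moebius_denom_comp:
  fixes a' b' c' d' c d :: int
  assumes "a' * d' - b' * c' = 1" "Im z > 0"
  shows "(of_int c * moebius_act a' b' c' d' z + of_int d) * (of_int c' * z + of_int d') =
         of_int (c * a' + d * c') * z + (of_int (c * b' + d * d') :: complex)"
  using moebius_denom_nz[OF assms] by (simp add: moebius_act_def field_simps)

text \<open>Dirichlet approximation in place of the fundamental domain: a fraction h/c close to Re z
  with c at most y^(-1/2) makes |cz - h|^2 at most 5y, hence the new imaginary part at least
  1/5.\<close>

lemma sl2_reduction: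
  assumes z: "Im z > 0"
  obtains a b c d :: int where "a * d - b * c = 1" "Im (moebius_act a b c d z) \<ge> 1 / 5"
proof (cases "Im z \<ge> 1 / 5")
  case True
  show ?thesis by (rule that[of 1 1 0 0]) (use True in \<open>auto simp: moebius_act_def\<close>)
next
  case False
  define y where "y = Im z"
  define s where "s = 1 / sqrt y"
  have y: "0 < y" "y < 1 / 5" using z False by (auto simp: y_def)
  have s2: "s\<^sup>2 = 1 / y" using y by (simp add: s_def power_divide)
  have s1: "s \<ge> 1"
  proof -
    have "s\<^sup>2 \<ge> 1\<^sup>2" unfolding s2 using y by simp
    moreover have "s \<ge> 0" using y by (simp add: s_def)
    ultimately show ?thesis using power2_le_imp_le by blast
  qed
  define Q where "Q = nat \<lfloor>s\<rfloor>"
  have Qs: "real Q \<le> s" using s1 by (simp add: Q_def)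
  have Q0: "Q > 0" using s1 by (simp add: Q_def)
  have "s < real Q + 1" using s1 by (simp add: Q_def)
  then have Q2: "s \<le> 2 * real Q" using Q0 by linarith
  obtain h c :: int where hc: "coprime h c" "0 < c" "c \<le> int Q" "\<bar>of_int c * Re z - of_int h\<bar> < 1 / real Q"
    using Dirichlet_approx_coprime[OF Q0, of "Re z"] by blast
  \<comment> \<open>Bezout coefficients complete the bottom row (c, -h) to a matrix of determinant
    1.\<close>
  obtain u v where uv: "u * h + v * c = 1"
    using hc(1) bezout_int[of h c] by (metis coprime_imp_gcd_eq_1)
  have det: "(- u) * (- h) - (- v) * c = 1" using uv by (simp add: algebra_simps)
  have "(norm (of_int c * z + of_int (- h)))\<^sup>2 = (of_int c * y)\<^sup>2 + (of_int c * Re z - of_int h)\<^sup>2"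
    by (simp add: cmod_power2 y_def)
  \<comment> \<open>The first square uses c \<le> s = y^(-1/2), the second 1/Q \<le> 2/s, since
    rounding s \<ge> 1 down loses at most a factor 2.\<close>
  also have "\<dots> \<le> y + 4 * y"
  proof (rule add_mono)
    have "of_int c \<le> s" using hc(3) Qs by linarith
    then have "(of_int c * y)\<^sup>2 \<le> (s * y)\<^sup>2" using hc(2) y by (intro power_mono mult_right_mono) auto
    also have "\<dots> = y" using y unfolding power_mult_distrib s2 by (simp add: power2_eq_square)
    finally show "(of_int c * y)\<^sup>2 \<le> y" .
    have "(of_int c * Re z - of_int h)\<^sup>2 = \<bar>of_int c * Re z - of_int h\<bar>\<^sup>2" by simp
    also have "\<dots> \<le> (1 / real Q)\<^sup>2" using hc(4) by (intro power_mono) auto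
    also have "\<dots> \<le> (2 / s)\<^sup>2" using Q2 Q0 s1 by (intro power_mono) (auto simp: field_simps)
    also have "\<dots> = 4 * y" by (simp add: power_divide s2)
    finally show "(of_int c * Re z - of_int h)\<^sup>2 \<le> 4 * y" .
  qed
  finally have le: "(norm (of_int c * z + of_int (- h)))\<^sup>2 \<le> 5 * y" by simp
  have pos: "(norm (of_int c * z + of_int (- h)))\<^sup>2 > 0"
    using moebius_denom_nz[OF det z] by simp
  have "1 / 5 \<le> y / (norm (of_int c * z + of_int (- h)))\<^sup>2"
    using le pos y by (simp add: field_simps)
  then show ?thesis
    using that[OF det] Im_moebius_act[OF det z] by (simp add: y_def)
qed

lemma holomorphic_moebius_act:
  fixes a b c d :: int
  assumes "a * d - b * c = 1" "f holomorphic_on upper_half_plane"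
  shows "(\<lambda>z. f (moebius_act a b c d z)) holomorphic_on upper_half_plane"
proof -
  have "(\<lambda>z. moebius_act a b c d z) holomorphic_on upper_half_plane"
    unfolding moebius_act_def using moebius_denom_nz[OF assms(1)]
    by (intro holomorphic_intros) auto
  then have "(f \<circ> moebius_act a b c d) holomorphic_on upper_half_plane"
    by (rule holomorphic_on_compose_gen[OF _ assms(2)]) (use Im_moebius_act_pos[OF assms(1)] in auto)
  then show ?thesis by (simp add: o_def)
qed

text \<open>The scalar depends on the matrix but not on z; the periodicity argument at a cusp relies
  on this.\<close>

lemma cusp_form_automorphy4:
  assumes f: "f \<in> cusp_forms_half k M" and det: "a * d - b * c = 1" and c: "int M dvd c"
  obtains s :: complex where "s \<in> {0, 1}"
    "\<And>z. Im z > 0 \<Longrightarrow> f (moebius_act a b c d z) ^ 4 = s * (of_int c * z + of_int d) ^ (4 * k + 2) * f z ^ 4"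
proof
  let ?s = "of_int (shimura_symbol c d ^ (4 * (2 * k + 1))) :: complex"
  have "shimura_symbol c d ^ (4 * (2 * k + 1)) = 0 \<or> shimura_symbol c d ^ (4 * (2 * k + 1)) = 1"
    using shimura_symbol_power4[of c d "2 * k + 1"] by auto
  then show "?s \<in> {0, 1}" by (metis insertCI of_int_0 of_int_1)
  fix z assume z: "Im z > 0"
  let ?j = "of_int c * z + of_int d :: complex"
  have tr: "f (moebius_act a b c d z) =
             of_int (shimura_symbol c d) ^ (2 * k + 1)
             * theta_eps d powi (- 2 * int k - 1)
             * half_power ?j (2 * int k + 1) * f z"
    using f det c z unfolding cusp_forms_half_def by auto
  have t: "(theta_eps d powi (- 2 * int k - 1)) ^ 4 = 1"
  proof -
    have "(theta_eps d powi (- 2 * int k - 1)) ^ 4 = (theta_eps d ^ 4) powi (- 2 * int k - 1)"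
      by (metis power_int_mult power_int_of_nat mult.commute)
    then show ?thesis by (simp add: theta_eps_power4)
  qed
  have h: "half_power ?j (2 * int k + 1) ^ 4 = ?j ^ (4 * k + 2)"
    using half_power_power4[of ?j "2 * k + 1"] by (simp add: algebra_simps)
  show "f (moebius_act a b c d z) ^ 4 = ?s * ?j ^ (4 * k + 2) * f z ^ 4"
  proof -
    have s4: "(of_int (shimura_symbol c d) ^ (2 * k + 1)) ^ 4 = ?s"
      by (simp only: power_mult[symmetric] of_int_power mult.commute)
    show ?thesis unfolding tr power_mult_distrib t h s4 by simp
  qed
qed

text \<open>The function h, the fourth power of f slashed by the matrix, is periodic and vanishes at
  infinity, so it decays exponentially; the quantity to be bounded is |h(z)| times the power 2k+1 of
  Im z.\<close>

lemma cusp_form_bound_at_cusp: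
  assumes f: "f \<in> cusp_forms_half k M" and M: "M > 0" and det: "a * d - b * c = 1" and y0: "y0 > 0"
  obtains C where "\<And>z. Im z \<ge> y0 \<Longrightarrow>
     norm (f (moebius_act a b c d z)) ^ 4 * Im (moebius_act a b c d z) ^ (2 * k + 1) \<le> C"
proof -
  define h where "h z = f (moebius_act a b c d z) ^ 4 / (of_int c * z + of_int d) ^ (4 * k + 2)" for z
  have fh: "f holomorphic_on upper_half_plane" using f by (simp add: cusp_forms_half_def)
  have nz: "of_int c * z + of_int d \<noteq> (0::complex)" if "Im z > 0" for z
    using moebius_denom_nz[OF det that] .
  have holo: "h holomorphic_on upper_half_plane"
    unfolding h_def using nz holomorphic_moebius_act[OF det fh]
    by (intro holomorphic_intros) auto
  define m where "m = int M"
  \<comment> \<open>The conjugate of the translation by M under the matrix (a, b; c, d); its lower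
    left entry is a multiple of M, so it lies in Gamma_0(M).\<close>
  have det': "(1 - a * c * m) * (1 + a * c * m) - (a\<^sup>2 * m) * (- (c\<^sup>2 * m)) = 1"
    by (simp add: power2_eq_square algebra_simps)
  have "int M dvd - (c\<^sup>2 * m)" by (simp add: m_def)
  then obtain s :: complex where s: "s \<in> {0, 1}"
    "\<And>z. Im z > 0 \<Longrightarrow> f (moebius_act (1 - a * c * m) (a\<^sup>2 * m) (- (c\<^sup>2 * m)) (1 + a * c * m) z) ^ 4 =
        s * (of_int (- (c\<^sup>2 * m)) * z + of_int (1 + a * c * m)) ^ (4 * k + 2) * f z ^ 4"
    using cusp_form_automorphy4[OF f det'] by blast
  have shift: "h (z + of_real (real M)) = s * h z" if z: "Im z > 0" for z
  proof -
    let ?w = "moebius_act a b c d z"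
    have w: "Im ?w > 0" using Im_moebius_act_pos[OF det z] .
    have e: "(1 - a * c * m) * a + (a\<^sup>2 * m) * c = a"
      "(1 - a * c * m) * b + (a\<^sup>2 * m) * d = a * m + b"
      "- (c\<^sup>2 * m) * a + (1 + a * c * m) * c = c"
      "- (c\<^sup>2 * m) * b + (1 + a * c * m) * d = c * m + d"
    proof -
      have "(1 - a * c * m) * b + (a\<^sup>2 * m) * d = b + a * m * (a * d - b * c)"
        by (simp add: power2_eq_square algebra_simps)
      then show "(1 - a * c * m) * b + (a\<^sup>2 * m) * d = a * m + b" by (simp add: det)
      have "- (c\<^sup>2 * m) * b + (1 + a * c * m) * d = d + c * m * (a * d - b * c)"
        by (simp add: power2_eq_square algebra_simps)
      then show "- (c\<^sup>2 * m) * b + (1 + a * c * m) * d = c * m + d" by (simp add: det)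
    qed (simp_all add: power2_eq_square algebra_simps)
    have "moebius_act (1 - a * c * m) (a\<^sup>2 * m) (- (c\<^sup>2 * m)) (1 + a * c * m) ?w = moebius_act a (a * m + b) c (c * m + d) z"
      unfolding moebius_act_comp[OF det' det z] e ..
    also have "\<dots> = moebius_act a b c d (z + of_real (real M))"
      by (simp add: moebius_act_def m_def algebra_simps)
    finally have 1: "moebius_act (1 - a * c * m) (a\<^sup>2 * m) (- (c\<^sup>2 * m)) (1 + a * c * m) ?w = moebius_act a b c d (z + of_real (real M))" .
    have 2: "(of_int (- (c\<^sup>2 * m)) * ?w + of_int (1 + a * c * m)) * (of_int c * z + of_int d) = of_int c * (z + of_real (real M)) + of_int d"
      unfolding moebius_denom_comp[OF det z] e by (simp add: m_def algebra_simps)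
    let ?j = "of_int (- (c\<^sup>2 * m)) * ?w + of_int (1 + a * c * m) :: complex"
    have j: "?j \<noteq> 0" using moebius_denom_nz[OF det' w] .
    have "h (z + of_real (real M)) = s * ?j ^ (4 * k + 2) * f ?w ^ 4 / (?j * (of_int c * z + of_int d)) ^ (4 * k + 2)"
      unfolding h_def 2 1[symmetric] s(2)[OF w] ..
    also have "\<dots> = s * h z" unfolding h_def power_mult_distrib using j by simp
    finally show ?thesis .
  qed
  \<comment> \<open>If s = 0, then h vanishes at all translates by M, hence everywhere, and is still
    periodic.\<close>
  have per: "h (z + of_real (real M)) = h z" if z: "Im z > 0" for z
  proof (cases "s = 1")
    case False
    then have 0: "h (w + of_real (real M)) = 0" if "Im w > 0" for w using s(1) shift[OF that] by auto
    have "h z = 0" using 0[of "z - of_real (real M)"] z by simp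
    then show ?thesis using 0[OF z] by simp
  qed (use shift[OF z] in auto)
  have lim: "(h \<longlongrightarrow> 0) (filtercomap Im at_top)"
  proof -
    have "((\<lambda>z. half_power (of_int c * z + of_int d) (- 2 * int k - 1) * f (moebius_act a b c d z)) \<longlongrightarrow> 0) (filtercomap Im at_top)"
      using f det unfolding cusp_forms_half_def by auto
    then have "((\<lambda>z. (half_power (of_int c * z + of_int d) (- 2 * int k - 1) * f (moebius_act a b c d z)) ^ 4) \<longlongrightarrow> 0 ^ 4) (filtercomap Im at_top)"
      by (rule tendsto_power)
    moreover have "(half_power (of_int c * z + of_int d) (- 2 * int k - 1) * f (moebius_act a b c d z)) ^ 4 = h z" for z
    proof -
      have "- 2 * int k - 1 = - int (2 * k + 1)" by simp
      then have "half_power (of_int c * z + of_int d) (- 2 * int k - 1) ^ 4 = inverse ((of_int c * z + of_int d) ^ (4 * k + 2))"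
        by (simp only: half_power_minus power_inverse half_power_power4) (simp add: algebra_simps)
      then show ?thesis by (simp only: power_mult_distrib h_def divide_inverse mult.commute)
    qed
    ultimately show ?thesis by simp
  qed
  obtain C where C: "\<And>z. Im z \<ge> y0 \<Longrightarrow> norm (h z) \<le> C * exp (- 2 * pi * Im z / real M)"
    using cusp_decay[of "real M" h y0] M holo per lim y0 by auto
  \<comment> \<open>A power times a decaying exponential, bounded on [y0, \<infinity>): by its limit
    for large y and by compactness below.\<close>
  define g where "g y = y ^ (2 * k + 1) * exp (- (2 * pi / real M) * y)" for y :: real
  have "(g \<longlongrightarrow> 0) at_top"
  proof -
    have M': "2 * pi / real M > 0" using M by simp
    have "((\<lambda>y. (2 * pi / real M * y) ^ (2 * k + 1) / exp (2 * pi / real M * y)) \<longlongrightarrow> 0) at_top"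
      by (rule filterlim_compose[OF tendsto_power_div_exp_0])
         (use M' in \<open>intro filterlim_tendsto_pos_mult_at_top[OF tendsto_const _ filterlim_ident]\<close>)
    then have "((\<lambda>y. (1 / (2 * pi / real M) ^ (2 * k + 1)) * ((2 * pi / real M * y) ^ (2 * k + 1) / exp (2 * pi / real M * y))) \<longlongrightarrow> (1 / (2 * pi / real M) ^ (2 * k + 1)) * 0) at_top"
      by (intro tendsto_mult tendsto_const)
    moreover have "(\<lambda>y. (1 / (2 * pi / real M) ^ (2 * k + 1)) * ((2 * pi / real M * y) ^ (2 * k + 1) / exp (2 * pi / real M * y))) = g"
    proof
      fix y :: real
      have "exp (- (2 * pi / real M) * y) = 1 / exp (2 * pi / real M * y)"
        by (simp add: exp_minus field_simps)
      moreover have "(2 * pi / real M) ^ (2 * k + 1) \<noteq> 0" using M by simp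
      ultimately show "(1 / (2 * pi / real M) ^ (2 * k + 1)) * ((2 * pi / real M * y) ^ (2 * k + 1) / exp (2 * pi / real M * y)) = g y"
        unfolding g_def power_mult_distrib by simp
    qed
    ultimately show ?thesis by simp
  qed
  then obtain Y where Y: "\<And>y. y \<ge> Y \<Longrightarrow> \<bar>g y\<bar> < 1"
    using tendstoD[of g 0 at_top 1] by (auto simp: eventually_at_top_linorder)
  have "compact (g ` {y0..Y})"
    by (rule compact_continuous_image) (use M in \<open>auto simp: g_def intro!: continuous_intros\<close>)
  then obtain B where B: "\<And>y. y \<in> {y0..Y} \<Longrightarrow> \<bar>g y\<bar> \<le> B"
    by (metis bounded_iff compact_imp_bounded imageI real_norm_def)
  have gB: "g y \<le> max 1 B" if "y \<ge> y0" for y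
    using B[of y] Y[of y] that by (cases "y \<ge> Y") auto
  have C0: "C \<ge> 0"
  proof -
    have "0 \<le> C * exp (- 2 * pi * y0 / real M)"
      using order_trans[OF norm_ge_zero C[of "of_real y0 * \<i>"]] by simp
    then show ?thesis by (simp add: zero_le_mult_iff)
  qed
  show ?thesis
  proof (rule that)
    fix z assume z: "Im z \<ge> y0"
    then have z': "Im z > 0" using y0 by simp
    let ?j = "norm (of_int c * z + of_int d)"
    have j: "?j > 0" using nz[OF z'] by simp
    have "norm (f (moebius_act a b c d z)) ^ 4 * Im (moebius_act a b c d z) ^ (2 * k + 1) =
          norm (f (moebius_act a b c d z)) ^ 4 * (Im z ^ (2 * k + 1) / ?j ^ (2 * (2 * k + 1)))"
      by (simp only: Im_moebius_act[OF det z'] power_divide power_mult)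
    also have "2 * (2 * k + 1) = 4 * k + 2" by simp
    also have "norm (f (moebius_act a b c d z)) ^ 4 * (Im z ^ (2 * k + 1) / ?j ^ (4 * k + 2)) = norm (h z) * Im z ^ (2 * k + 1)"
      unfolding h_def norm_divide norm_power by simp
    also have "\<dots> \<le> C * exp (- 2 * pi * Im z / real M) * Im z ^ (2 * k + 1)"
      using C[OF z] z' by (intro mult_right_mono) auto
    also have "\<dots> = C * g (Im z)" by (simp add: g_def)
    also have "\<dots> \<le> C * max 1 B" using gB[OF z] C0 by (intro mult_left_mono)
    finally show "norm (f (moebius_act a b c d z)) ^ 4 * Im (moebius_act a b c d z) ^ (2 * k + 1) \<le> C * max 1 B" .
  qed
qed

text \<open>\<Phi> does not increase under Gamma_0(M), which has finitely many cosets, and on each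
  coset the bound at the corresponding cusp applies to points of height at least 1/5; every z is the
  image of such a point.\<close>

lemma cusp_form_bound4:
  assumes f: "f \<in> cusp_forms_half k M" and M: "M > 0"
  obtains C where "\<And>z. Im z > 0 \<Longrightarrow> norm (f z) ^ 4 * Im z ^ (2 * k + 1) \<le> C"
proof -
  define \<Phi> where "\<Phi> z = norm (f z) ^ 4 * Im z ^ (2 * k + 1)" for z
  have inv: "\<Phi> (moebius_act a b c d z) \<le> \<Phi> z"
    if det: "a * d - b * c = 1" and c: "int M dvd c" and z: "Im z > 0" for a b c d z
  proof -
    obtain s :: complex where s: "s \<in> {0, 1}"
      "\<And>z. Im z > 0 \<Longrightarrow> f (moebius_act a b c d z) ^ 4 = s * (of_int c * z + of_int d) ^ (4 * k + 2) * f z ^ 4"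
      using cusp_form_automorphy4[OF f det c] by blast
    let ?j = "norm (of_int c * z + of_int d)"
    have j: "?j \<noteq> 0" using moebius_denom_nz[OF det z] by simp
    have "norm (f (moebius_act a b c d z)) ^ 4 = norm s * ?j ^ (2 * (2 * k + 1)) * norm (f z) ^ 4"
      unfolding norm_power[symmetric] s(2)[OF z] by (simp add: norm_mult)
    moreover have "Im (moebius_act a b c d z) ^ (2 * k + 1) = Im z ^ (2 * k + 1) / ?j ^ (2 * (2 * k + 1))"
      by (simp only: Im_moebius_act[OF det z] power_divide power_mult)
    ultimately have "\<Phi> (moebius_act a b c d z) = norm s * ?j ^ (2 * (2 * k + 1)) * norm (f z) ^ 4 * (Im z ^ (2 * k + 1) / ?j ^ (2 * (2 * k + 1)))"
      by (simp only: \<Phi>_def)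
    also have "\<dots> = norm s * \<Phi> z"
    proof -
      have "A * X * B * (I / X) = A * (B * I)" if "X \<noteq> 0" for A X B I :: real using that by simp
      from this[of "?j ^ (2 * (2 * k + 1))"] j show ?thesis by (simp add: \<Phi>_def)
    qed
    also have "\<dots> \<le> 1 * \<Phi> z" using s(1) z by (intro mult_right_mono) (auto simp: \<Phi>_def)
    finally show ?thesis by simp
  qed
  \<comment> \<open>A coset is determined by the bottom row modulo M; for residues attained by no
    matrix the claim is vacuous.\<close>
  have cls: "\<exists>C. \<forall>a b c d w. a * d - b * c = 1 \<longrightarrow> c mod int M = r \<longrightarrow> d mod int M = t \<longrightarrow>
               Im w \<ge> 1 / 5 \<longrightarrow> \<Phi> (moebius_act a b c d w) \<le> C" for r t
  proof (cases "\<exists>a b c d :: int. a * d - b * c = 1 \<and> c mod int M = r \<and> d mod int M = t")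
    case True
    then obtain a b c d :: int where g: "a * d - b * c = 1" "c mod int M = r" "d mod int M = t" by blast
    obtain C where C: "\<And>w. Im w \<ge> 1 / 5 \<Longrightarrow> \<Phi> (moebius_act a b c d w) \<le> C"
      using cusp_form_bound_at_cusp[OF f M g(1), of "1 / 5"] unfolding \<Phi>_def by auto
    have "\<Phi> (moebius_act a' b' c' d' w) \<le> C"
      if g': "a' * d' - b' * c' = 1" "c' mod int M = r" "d' mod int M = t" and w: "Im w \<ge> 1 / 5" for a' b' c' d' w
    proof -
      \<comment> \<open>The entries of (a', b'; c', d') times the inverse of (a, b; c, d); the
        congruent bottom rows make its lower left entry divisible by M.\<close>
      have det: "(a' * d - b' * c) * (d' * a - c' * b) - (b' * a - a' * b) * (c' * d - d' * c) = 1"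
      proof -
        have "(a' * d - b' * c) * (d' * a - c' * b) - (b' * a - a' * b) * (c' * d - d' * c)
            = (a' * d' - b' * c') * (a * d - b * c)" by (simp add: algebra_simps)
        then show ?thesis using g g' by simp
      qed
      have "[c' * d - d' * c = c * d - d * c] (mod int M)"
        using g g' by (intro cong_diff cong_mult) (auto simp: cong_def)
      then have dvd: "int M dvd c' * d - d' * c" by (simp add: cong_0_iff mult.commute)
      have w': "Im w > 0" using w by simp
      have e: "(a' * d - b' * c) * a + (b' * a - a' * b) * c = a' * (a * d - b * c)"
        "(a' * d - b' * c) * b + (b' * a - a' * b) * d = b' * (a * d - b * c)"
        "(c' * d - d' * c) * a + (d' * a - c' * b) * c = c' * (a * d - b * c)"
        "(c' * d - d' * c) * b + (d' * a - c' * b) * d = d' * (a * d - b * c)"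
        by (simp_all add: algebra_simps)
      have "moebius_act (a' * d - b' * c) (b' * a - a' * b) (c' * d - d' * c) (d' * a - c' * b) (moebius_act a b c d w)
          = moebius_act a' b' c' d' w"
        unfolding moebius_act_comp[OF det g(1) w'] e g(1) by simp
      then have "\<Phi> (moebius_act a' b' c' d' w) \<le> \<Phi> (moebius_act a b c d w)"
        using inv[OF det dvd Im_moebius_act_pos[OF g(1) w']] by simp
      also have "\<dots> \<le> C" by (rule C[OF w])
      finally show ?thesis .
    qed
    then show ?thesis by blast
  qed auto
  then obtain K where K: "\<And>r t a b c d w. a * d - b * c = 1 \<Longrightarrow> c mod int M = r \<Longrightarrow> d mod int M = t \<Longrightarrow>
               Im w \<ge> 1 / 5 \<Longrightarrow> \<Phi> (moebius_act a b c d w) \<le> K r t" by metis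
  define C where "C = Max ((\<lambda>(r, t). K r t) ` ({0..<int M} \<times> {0..<int M}))"
  show ?thesis
  proof (rule that)
    fix z assume z: "Im z > 0"
    obtain a b c d :: int where g: "a * d - b * c = 1" "Im (moebius_act a b c d z) \<ge> 1 / 5"
      using sl2_reduction[OF z] by blast
    \<comment> \<open>The inverse matrix, which writes z as the image of its reduced point.\<close>
    have g': "d * a - (- b) * (- c) = 1" using g(1) by (simp add: mult.commute)
    have "moebius_act d (- b) (- c) a (moebius_act a b c d z) = moebius_act 1 0 0 1 z"
    proof -
      have e: "d * a + (- b) * c = 1" "d * b + (- b) * d = 0" "(- c) * a + a * c = 0" "(- c) * b + a * d = 1"
        using g(1) by (simp_all add: mult.commute)
      show ?thesis unfolding moebius_act_comp[OF g' g(1) z] e ..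
    qed
    also have "\<dots> = z" by (simp add: moebius_act_def)
    finally have "\<Phi> z \<le> K ((- c) mod int M) (a mod int M)"
      using K[OF g' refl refl g(2)] by simp
    also have "\<dots> \<le> C"
      unfolding C_def by (rule Max_ge) (use M in \<open>auto intro!: rev_image_eqI[of "((- c) mod int M, a mod int M)"]\<close>)
    finally show "norm (f z) ^ 4 * Im z ^ (2 * k + 1) \<le> C" by (simp add: \<Phi>_def)
  qed
qed

lemma cusp_form_bound:
  assumes f: "f \<in> cusp_forms_half k M" and M: "M > 0"
  obtains C where "\<And>z. Im z > 0 \<Longrightarrow> norm (f z) \<le> C * Im z powr (- (real k / 2 + 1 / 4))"
proof -
  obtain C where C: "\<And>z. Im z > 0 \<Longrightarrow> norm (f z) ^ 4 * Im z ^ (2 * k + 1) \<le> C"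
    using cusp_form_bound4[OF assms] by blast
  have C0: "C \<ge> 0" using order_trans[OF _ C[of \<i>], of 0] by simp
  show ?thesis
  proof (rule that)
    fix z assume z: "Im z > 0"
    have "norm (f z) ^ 4 \<le> C * Im z powr (- real (2 * k + 1))"
      using C[OF z] z by (simp add: powr_minus powr_realpow field_simps del: of_nat_add of_nat_mult of_nat_Suc)
    also have "\<dots> = (C powr (1/4) * Im z powr (- (real k / 2 + 1 / 4))) ^ 4"
    proof -
      have "Im z powr (- real (2 * k + 1)) = (Im z powr (- (real k / 2 + 1 / 4))) ^ 4"
        using z by (simp add: powr_power) (rule arg_cong[of _ _ "\<lambda>x. Im z powr x"], simp add: field_simps)
      moreover have "C = (C powr (1/4)) ^ 4" using C0 by (cases "C = 0") (auto simp: powr_power)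
      ultimately show ?thesis by (metis power_mult_distrib)
    qed
    finally show "norm (f z) \<le> C powr (1/4) * Im z powr (- (real k / 2 + 1 / 4))"
      by (rule power_le_imp_le_base[of _ 3, simplified]) (use C0 in auto)
  qed
qed

section \<open>The Fricke involution\<close>

lemma power_le_fact_exp:
  fixes y :: real assumes "y \<ge> 0"
  shows "y ^ n \<le> fact n * exp y"
proof -
  have "(\<lambda>n. y ^ n / fact n) sums exp y"
    using exp_converges[of y] by (simp add: divide_inverse mult.commute)
  then have "y ^ n / fact n \<le> exp y"
    using sum_le_suminf[of "\<lambda>n. y ^ n / fact n" "{n}"] assms by (auto simp: sums_iff)
  then show ?thesis by (simp add: field_simps)
qed

text \<open>For Im z \<ge> 1 exponential decay beats any power; for Im z < 1 lowering the exponent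
  by m only enlarges the right-hand side. One constant must serve all m up to B, because the mean
  square estimate lets m vary with b and u.\<close>

lemma cusp_form_decay:
  fixes p :: "complex \<Rightarrow> complex" and \<alpha> :: real
  assumes holo: "p holomorphic_on upper_half_plane"
    and per: "\<And>z. Im z > 0 \<Longrightarrow> p (z + 1) = p z"
    and bd: "\<And>z. Im z > 0 \<Longrightarrow> norm (p z) \<le> C * Im z powr (- \<alpha>)" and \<alpha>: "\<alpha> > 0"
  obtains K where "K > 0" "\<And>m z. Im z > 0 \<Longrightarrow> 0 \<le> m \<Longrightarrow> m \<le> B \<Longrightarrow> norm (p z) \<le> K * Im z powr (- \<alpha> - m)"
proof -
  note lim = tendsto_zero_at_cusp[OF bd \<alpha>]
  obtain D where D: "\<And>z. Im z \<ge> 1 \<Longrightarrow> norm (p z) \<le> D * exp (- 2 * pi * Im z / 1)"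
    using cusp_decay[of 1 p 1] holo per lim by auto
  define n where "n = nat \<lceil>\<alpha> + max B 0\<rceil>"
  have n: "real n \<ge> \<alpha> + max B 0" unfolding n_def by (rule real_nat_ceiling_ge)
  have D0: "D \<ge> 0" using order_trans[OF norm_ge_zero D[of \<i>]] by (simp add: zero_le_mult_iff)
  have C0: "C \<ge> 0" using order_trans[OF norm_ge_zero bd[of \<i>]] by simp
  show ?thesis
  proof (rule that)
    show "C + D * fact n + 1 > 0" using C0 D0 by (simp add: add_nonneg_pos)
    fix z :: complex and m assume z: "Im z > 0" and m: "0 \<le> m" "m \<le> B"
    show "norm (p z) \<le> (C + D * fact n + 1) * Im z powr (- \<alpha> - m)"
    proof (cases "Im z \<ge> 1")
      case True
      have "Im z powr (\<alpha> + m) \<le> Im z powr real n" using True n m by (intro powr_mono) auto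
      also have "\<dots> = Im z ^ n" using z by (simp add: powr_realpow)
      also have "\<dots> \<le> fact n * exp (Im z)" using z by (intro power_le_fact_exp) simp
      also have "\<dots> \<le> fact n * exp (2 * pi * Im z)"
        using True pi_gt3 mult_right_mono[of 1 "2 * pi" "Im z"] by simp
      finally have "exp (- 2 * pi * Im z / 1) \<le> fact n * Im z powr (- \<alpha> - m)"
        using z by (simp add: exp_minus powr_minus[of _ "\<alpha> + m", simplified] field_simps)
      then have "D * exp (- 2 * pi * Im z / 1) \<le> D * (fact n * Im z powr (- \<alpha> - m))"
        using D0 by (rule mult_left_mono)
      also have "\<dots> \<le> (C + D * fact n + 1) * Im z powr (- \<alpha> - m)"
        using C0 by (simp add: algebra_simps)
      finally show ?thesis using D[OF True] by linarith
    next
      case False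
      have "Im z powr (- \<alpha>) \<le> Im z powr (- \<alpha> - m)" using False z m by (intro powr_mono') auto
      then have "C * Im z powr (- \<alpha>) \<le> C * Im z powr (- \<alpha> - m)" using C0 by (rule mult_left_mono)
      also have "\<dots> \<le> (C + D * fact n + 1) * Im z powr (- \<alpha> - m)"
        using D0 by (intro mult_right_mono) auto
      finally show ?thesis using bd[OF z] by linarith
    qed
  qed
qed

text \<open>For r = 1/sqrt M the map w -> i r exp w carries the strip |Im w| < pi/2 onto the upper
  half-plane and z -> -1/(Mz) into w -> -w; the exponential factor frees this symmetry from
  automorphy factors.\<close>

definition ray :: "real \<Rightarrow> (complex \<Rightarrow> complex) \<Rightarrow> real \<Rightarrow> complex \<Rightarrow> complex" where
  "ray r p \<kappa> w = p (\<i> * of_real r * exp w) * exp (of_real (\<kappa> / 2) * w)"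

lemma Im_ray: "Im (\<i> * of_real r * exp (Complex u \<theta>)) = r * exp u * cos \<theta>"
  by (simp add: Re_exp)

text \<open>For u \<ge> 0 the decay is that of p at infinity; for u < 0 the reflection reads it off
  from q. The factor exp (\<kappa>w/2) cancels the power \<kappa>/2 of exp u in the bound and leaves
  exp (-m|u|).\<close>

lemma strip_function_ray:
  fixes p q :: "complex \<Rightarrow> complex" and \<kappa> r :: real
  assumes r: "0 < r" "r \<le> 1" and \<kappa>: "\<kappa> > 0"
    and p: "p holomorphic_on upper_half_plane" "\<And>z. Im z > 0 \<Longrightarrow> p (z + 1) = p z"
      "\<And>z. Im z > 0 \<Longrightarrow> norm (p z) \<le> C * Im z powr (- (\<kappa> / 2))"
    and q: "q holomorphic_on upper_half_plane" "\<And>z. Im z > 0 \<Longrightarrow> q (z + 1) = q z"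
      "\<And>z. Im z > 0 \<Longrightarrow> norm (q z) \<le> D * Im z powr (- (\<kappa> / 2))"
    and pq: "\<And>w. \<bar>Im w\<bar> < pi / 2 \<Longrightarrow> ray r p \<kappa> (- w) = ray r q \<kappa> w"
  shows "strip_function (ray r p \<kappa>) \<kappa>"
proof
  have cpos: "cos \<theta> > 0" if "\<bar>\<theta>\<bar> < pi / 2" for \<theta> :: real
    using that by (intro cos_gt_zero_pi) auto
  show "ray r p \<kappa> holomorphic_on {w. \<bar>Im w\<bar> < pi / 2}"
  proof -
    have "(\<lambda>w. \<i> * of_real r * exp w) ` {w. \<bar>Im w\<bar> < pi / 2} \<subseteq> upper_half_plane"
      using r cpos by (auto simp: upper_half_plane_def Re_exp)
    then have "(p \<circ> (\<lambda>w. \<i> * of_real r * exp w)) holomorphic_on {w. \<bar>Im w\<bar> < pi / 2}"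
      by (intro holomorphic_on_compose_gen[OF _ p(1)] holomorphic_intros) auto
    then show ?thesis unfolding ray_def o_def by (intro holomorphic_intros)
  qed
  fix B :: real
  obtain K where K: "K > 0" "\<And>m z. Im z > 0 \<Longrightarrow> 0 \<le> m \<Longrightarrow> m \<le> B \<Longrightarrow> norm (p z) \<le> K * Im z powr (- (\<kappa> / 2) - m)"
    using cusp_form_decay[OF p, of B] \<kappa> by auto
  obtain L where L: "L > 0" "\<And>m z. Im z > 0 \<Longrightarrow> 0 \<le> m \<Longrightarrow> m \<le> B \<Longrightarrow> norm (q z) \<le> L * Im z powr (- (\<kappa> / 2) - m)"
    using cusp_form_decay[OF q, of B] \<kappa> by auto
  \<comment> \<open>As r \<le> 1, the exponent with B gives the largest power of r over all m \<le>
    B.\<close>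
  define R where "R = r powr (- (\<kappa> / 2) - B)"
  have half: "norm (ray r g \<kappa> (Complex u \<theta>)) \<le> E * R * cos \<theta> powr (- \<kappa> / 2 - m) * exp (- m * u)"
    if E: "E > 0" "\<And>m z. Im z > 0 \<Longrightarrow> 0 \<le> m \<Longrightarrow> m \<le> B \<Longrightarrow> norm (g z) \<le> E * Im z powr (- (\<kappa> / 2) - m)"
      and \<theta>: "\<bar>\<theta>\<bar> < pi / 2" and m: "0 \<le> m" "m \<le> B"
    for g :: "complex \<Rightarrow> complex" and E u \<theta> m
  proof -
    note c = cpos[OF \<theta>]
    have "norm (ray r g \<kappa> (Complex u \<theta>)) = norm (g (\<i> * of_real r * exp (Complex u \<theta>))) * exp (\<kappa> / 2 * u)"
      by (simp add: ray_def norm_mult norm_exp_eq_Re)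
    also have "\<dots> \<le> (E * (r * exp u * cos \<theta>) powr (- (\<kappa> / 2) - m)) * exp (\<kappa> / 2 * u)"
      using E(2)[of "\<i> * of_real r * exp (Complex u \<theta>)" m] m r c unfolding Im_ray by (intro mult_right_mono) auto
    also have "(r * exp u * cos \<theta>) powr (- (\<kappa> / 2) - m) = r powr (- (\<kappa> / 2) - m) * exp ((- (\<kappa> / 2) - m) * u) * cos \<theta> powr (- (\<kappa> / 2) - m)"
      using r c by (simp add: powr_mult exp_powr_real mult.commute)
    also have "E * (r powr (- (\<kappa> / 2) - m) * exp ((- (\<kappa> / 2) - m) * u) * cos \<theta> powr (- (\<kappa> / 2) - m)) * exp (\<kappa> / 2 * u)
       = E * r powr (- (\<kappa> / 2) - m) * cos \<theta> powr (- \<kappa> / 2 - m) * (exp ((- (\<kappa> / 2) - m) * u) * exp (\<kappa> / 2 * u))"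
      by simp
    also have "exp ((- (\<kappa> / 2) - m) * u) * exp (\<kappa> / 2 * u) = exp (- m * u)"
      by (simp add: exp_add[symmetric] algebra_simps)
    also have "E * r powr (- (\<kappa> / 2) - m) * cos \<theta> powr (- \<kappa> / 2 - m) * exp (- m * u) \<le> E * R * cos \<theta> powr (- \<kappa> / 2 - m) * exp (- m * u)"
      unfolding R_def using E(1) m r by (intro mult_right_mono mult_left_mono powr_mono') auto
    finally show ?thesis .
  qed
  show "\<exists>C. \<forall>u \<theta> m. \<bar>\<theta>\<bar> < pi / 2 \<longrightarrow> 0 \<le> m \<longrightarrow> m \<le> B \<longrightarrow>
      norm (ray r p \<kappa> (Complex u \<theta>)) \<le> C * cos \<theta> powr (- \<kappa> / 2 - m) * exp (- m * \<bar>u\<bar>)"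
  proof (intro exI allI impI)
    fix u \<theta> m :: real assume \<theta>: "\<bar>\<theta>\<bar> < pi / 2" and m: "0 \<le> m" "m \<le> B"
    show "norm (ray r p \<kappa> (Complex u \<theta>)) \<le> (max K L * R) * cos \<theta> powr (- \<kappa> / 2 - m) * exp (- m * \<bar>u\<bar>)"
    proof (cases "u \<ge> 0")
      case True
      have "norm (ray r p \<kappa> (Complex u \<theta>)) \<le> K * R * cos \<theta> powr (- \<kappa> / 2 - m) * exp (- m * u)"
        using half[OF K \<theta> m] by simp
      also have "\<dots> \<le> max K L * R * cos \<theta> powr (- \<kappa> / 2 - m) * exp (- m * u)"
        by (intro mult_right_mono) (auto simp: R_def)
      finally show ?thesis using True by simp
    next
      case False
      have "Complex u \<theta> = - Complex (- u) (- \<theta>)" by (simp add: complex_eq_iff)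
      then have "ray r p \<kappa> (Complex u \<theta>) = ray r q \<kappa> (Complex (- u) (- \<theta>))"
        using pq[of "Complex (- u) (- \<theta>)"] \<theta> by simp
      then have "norm (ray r p \<kappa> (Complex u \<theta>)) \<le> L * R * cos \<theta> powr (- \<kappa> / 2 - m) * exp (- m * (- u))"
        using half[OF L, of "- \<theta>" m "- u"] \<theta> m by simp
      also have "\<dots> \<le> max K L * R * cos \<theta> powr (- \<kappa> / 2 - m) * exp (- m * (- u))"
        by (intro mult_right_mono) (auto simp: R_def)
      finally show ?thesis using False by simp
    qed
  qed
qed

text \<open>Square roots are multiplicative only up to sign. Here both roots lie in the open first
  quadrant, so their quotient has positive real part and is the principal root.\<close>

lemma csqrt_mult_upper:
  assumes "Im z > 0"
  shows "csqrt (z + 1) * csqrt (z / (z + 1)) = csqrt z"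
proof -
  have z1: "z + 1 \<noteq> 0" using assms by (auto simp: complex_eq_iff)
  define a where "a = csqrt z"
  define b where "b = csqrt (z + 1)"
  have pos: "Re a > 0" "Im a > 0" "Re b > 0" "Im b > 0"
  proof -
    have q: "Re (csqrt w) > 0 \<and> Im (csqrt w) > 0" if "Im w > 0" for w
    proof -
      have "2 * Re (csqrt w) * Im (csqrt w) = Im ((csqrt w)\<^sup>2)" by (simp add: power2_eq_square)
      then have "2 * Re (csqrt w) * Im (csqrt w) > 0" using that by simp
      moreover have "Re (csqrt w) \<ge> 0" using csqrt_principal[of w] by auto
      ultimately show ?thesis by (auto simp: zero_less_mult_iff)
    qed
    show "Re a > 0" "Im a > 0" "Re b > 0" "Im b > 0"
      using q[of z] q[of "z + 1"] assms by (auto simp: a_def b_def)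
  qed
  have b0: "b \<noteq> 0" using pos by auto
  have "Re (a / b) = (Re a * Re b + Im a * Im b) / ((Re b)\<^sup>2 + (Im b)\<^sup>2)" by (simp add: Re_divide)
  also have "\<dots> > 0" using pos by (intro divide_pos_pos add_pos_pos mult_pos_pos) auto
  finally have "Re (a / b) > 0" .
  then have "csqrt ((a / b)\<^sup>2) = a / b" by (intro csqrt_square) simp
  moreover have "(a / b)\<^sup>2 = z / (z + 1)" by (simp add: a_def b_def power_divide)
  ultimately have "b * csqrt (z / (z + 1)) = a" using b0 by (metis nonzero_mult_div_cancel_left times_divide_eq_right)
  then show ?thesis by (simp only: a_def b_def)
qed

lemma cusp_form_transform:
  fixes a b c d :: int
  assumes "f \<in> cusp_forms_half k M" "a * d - b * c = 1" "int M dvd c" "Im z > 0"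
  shows "f (moebius_act a b c d z) =
             of_int (shimura_symbol c d) ^ (2 * k + 1)
             * theta_eps d powi (- 2 * int k - 1)
             * half_power (of_int c * z + of_int d) (2 * int k + 1) * f z"
  using assms unfolding cusp_forms_half_def by auto

lemma cusp_form_periodic:
  assumes "f \<in> cusp_forms_half k M" and "Im z > 0"
  shows "f (z + 1) = f z"
  using cusp_form_transform[OF assms(1), of 1 1 1 0 z] assms(2)
  by (simp add: moebius_act_def shimura_symbol_def Jacobi_0_1 theta_eps_def half_power_def)

lemma holomorphic_csqrt_upper: "csqrt holomorphic_on upper_half_plane"
  by (intro holomorphic_on_csqrt' holomorphic_intros) (auto simp: complex_nonpos_Reals_iff)

lemma Im_fricke_arg:
  assumes M: "M > 0" and z: "Im z > 0"
  shows "Im (- 1 / (of_nat M * z)) = Im z / (real M * (norm z)\<^sup>2)"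
proof -
  have "of_nat M * z \<noteq> 0" using assms by auto
  have "Im (- 1 / (of_nat M * z)) = real M * Im z / ((real M)\<^sup>2 * ((Re z)\<^sup>2 + (Im z)\<^sup>2))"
    by (simp add: Im_divide power_mult_distrib distrib_left)
  then show ?thesis unfolding cmod_power2 using M by (simp add: power2_eq_square)
qed

lemma Im_fricke_arg_pos:
  assumes "M > 0" "Im z > 0"
  shows "Im (- 1 / (of_nat M * z)) > 0"
proof -
  have "z \<noteq> 0" using assms by auto
  then show ?thesis unfolding Im_fricke_arg[OF assms] using assms by simp
qed

text \<open>With w = -1/(M(z+1)), the point -1/(Mz) is the image of w under (1, 0; M, 1). The
  multiplier of this matrix is 1, and its automorphy factor z/(z+1) converts the half-integral power
  of z+1 into that of z.\<close>

lemma fricke_periodic: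
  assumes f: "f \<in> cusp_forms_half k M" and M: "M > 0" and z: "Im z > 0"
  shows "fricke k M f (z + 1) = fricke k M f z"
proof -
  define w where "w = - 1 / (of_nat M * (z + 1))"
  have z1: "z \<noteq> 0" "z + 1 \<noteq> 0" using z by (auto simp: complex_eq_iff)
  have w: "Im w > 0" unfolding w_def using M z by (intro Im_fricke_arg_pos) auto
  have tr: "f (moebius_act 1 0 (int M) 1 w) =
             of_int (shimura_symbol (int M) 1) ^ (2 * k + 1)
             * theta_eps 1 powi (- 2 * int k - 1)
             * half_power (of_int (int M) * w + of_int 1) (2 * int k + 1) * f w"
    by (rule cusp_form_transform[OF f _ _ w]) auto
  have j: "of_nat M * w + 1 = z / (z + 1)"
  proof -
    have "of_nat M * w = - 1 / (z + 1)" using M by (simp add: w_def)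
    moreover have "z / (z + 1) = ((z + 1) - 1) / (z + 1)" by simp
    moreover have "((z + 1) - 1) / (z + 1) = 1 - 1 / (z + 1)"
      unfolding diff_divide_distrib using z1(2) by simp
    ultimately show ?thesis by simp
  qed
  have act: "moebius_act 1 0 (int M) 1 w = - 1 / (of_nat M * z)"
  proof -
    have "moebius_act 1 0 (int M) 1 w = w / (z / (z + 1))" by (simp add: moebius_act_def j)
    also have "\<dots> = (- 1 / of_nat M) / (z + 1) * ((z + 1) / z)" by (simp add: w_def)
    also have "\<dots> = - 1 / (of_nat M * z)" using z1 by simp
    finally show ?thesis .
  qed
  have fz: "f (- 1 / (of_nat M * z)) = half_power (z / (z + 1)) (2 * int k + 1) * f w"
    using tr unfolding act by (simp add: j shimura_symbol_def Jacobi_0_1 theta_eps_def)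
  have e: "- 2 * int k - 1 = - (2 * int k + 1)" by simp
  have hp: "half_power z (2 * int k + 1) = half_power (z + 1) (2 * int k + 1) * half_power (z / (z + 1)) (2 * int k + 1)"
    unfolding half_power_def csqrt_mult_upper[OF z, symmetric] by (rule power_int_mult_distrib)
  have nz: "half_power (z / (z + 1)) (2 * int k + 1) \<noteq> 0"
    using z1 by (simp add: half_power_def power_int_eq_0_iff)
  show ?thesis
    unfolding fricke_def e half_power_minus fz hp using nz by (simp add: w_def)
qed

lemma fricke_holomorphic:
  assumes f: "f \<in> cusp_forms_half k M" and M: "M > 0"
  shows "fricke k M f holomorphic_on upper_half_plane"
proof -
  have fh: "f holomorphic_on upper_half_plane" using f by (simp add: cusp_forms_half_def)
  have "(\<lambda>z. - 1 / (of_nat M * z)) holomorphic_on upper_half_plane"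
    using M by (intro holomorphic_intros) auto
  moreover have "(\<lambda>z. - 1 / (of_nat M * z)) ` upper_half_plane \<subseteq> upper_half_plane"
    using Im_fricke_arg_pos[OF M] unfolding upper_half_plane_def by blast
  ultimately have "(f \<circ> (\<lambda>z. - 1 / (of_nat M * z))) holomorphic_on upper_half_plane"
    by (intro holomorphic_on_compose_gen[OF _ fh])
  then show ?thesis
    unfolding fricke_def[abs_def] half_power_def o_def
    by (intro holomorphic_intros holomorphic_csqrt_upper) auto
qed

lemma norm_half_power: "z \<noteq> 0 \<Longrightarrow> norm (half_power z m) = norm z powr (real_of_int m / 2)"
proof -
  assume "z \<noteq> 0"
  then have "norm (csqrt z) = norm z powr (1/2)"
    by (simp add: powr_half_sqrt)
  then have "norm (half_power z m) = (norm z powr (1/2)) powi m"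
    by (simp add: half_power_def norm_power_int)
  also have "\<dots> = norm z powr (real_of_int m / 2)"
    using \<open>z \<noteq> 0\<close> by (simp add: powr_real_of_int'[symmetric] powr_powr)
  finally show ?thesis .
qed

text \<open>Im (-1/(Mz)) = Im z / (M |z|^2), so the powers of M and |z| cancel against the
  normalization and the same constant survives.\<close>

lemma fricke_bound:
  assumes f: "\<And>z. Im z > 0 \<Longrightarrow> norm (f z) \<le> C * Im z powr (- (real k / 2 + 1 / 4))" and M: "M > 0" and z: "Im z > 0"
  shows "norm (fricke k M f z) \<le> C * Im z powr (- (real k / 2 + 1 / 4))"
proof -
  define \<alpha> where "\<alpha> = real k / 2 + 1 / 4"
  have nz: "norm z > 0" using z by auto
  have "norm (fricke k M f z) = real M powr (- \<alpha>) * norm z powr (- 2 * \<alpha>) * norm (f (- 1 / (of_nat M * z)))"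
    using nz unfolding fricke_def norm_mult
    by (simp add: norm_half_power \<alpha>_def add_divide_distrib diff_divide_distrib)
  also have "\<dots> \<le> real M powr (- \<alpha>) * norm z powr (- 2 * \<alpha>) * (C * Im (- 1 / (of_nat M * z)) powr (- \<alpha>))"
    unfolding \<alpha>_def by (intro mult_left_mono f Im_fricke_arg_pos M z mult_nonneg_nonneg) auto
  also have "Im (- 1 / (of_nat M * z)) powr (- \<alpha>) = Im z powr (- \<alpha>) * (real M powr \<alpha> * norm z powr (2 * \<alpha>))"
  proof -
    have "((norm z)\<^sup>2) powr (- \<alpha>) = norm z powr (- (2 * \<alpha>))"
      using nz powr_powr[of "norm z" 2 "- \<alpha>"] by simp
    then have "Im (- 1 / (of_nat M * z)) powr (- \<alpha>) = Im z powr (- \<alpha>) / (real M powr (- \<alpha>) * norm z powr (- (2 * \<alpha>)))"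
      unfolding Im_fricke_arg[OF M z] using M z by (simp add: powr_divide powr_mult)
    then show ?thesis by (simp only: powr_minus divide_inverse inverse_mult_distrib inverse_inverse_eq)
  qed
  also have "real M powr (- \<alpha>) * norm z powr (- 2 * \<alpha>) * (C * (Im z powr (- \<alpha>) * (real M powr \<alpha> * norm z powr (2 * \<alpha>)))) = C * Im z powr (- \<alpha>)"
    using M nz by (simp add: powr_minus field_simps)
  finally show ?thesis unfolding \<alpha>_def .
qed

text \<open>The constants in z^(-\<kappa>) cancel against i^\<kappa> and M^(-\<kappa>/2) =
  r^\<kappa>, so the prefactor of the involution is exactly exp (-\<kappa>w).\<close>

lemma ray_fricke:
  fixes k :: nat
  assumes M: "M > 0" and w: "\<bar>Im w\<bar> < pi / 2"
  defines "r \<equiv> 1 / sqrt (real M)" and "\<kappa> \<equiv> real k + 1 / 2"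
  shows "ray r (fricke k M f) \<kappa> w = ray r f \<kappa> (- w)"
proof -
  define n where "n = 2 * int k + 1"
  have r: "r > 0" "r\<^sup>2 = 1 / real M" using M by (auto simp: r_def power_divide)
  define z where "z = \<i> * of_real r * exp w"
  \<comment> \<open>The hypothesis on w puts Im l strictly between 0 and pi, so l is the principal
    logarithm of z and fixes the branch of \<open>csqrt z\<close>.\<close>
  define l where "l = \<i> * of_real (pi / 2) + of_real (ln r) + w"
  have zl: "z = exp l"
  proof -
    have "exp (\<i> * of_real (pi / 2)) = \<i>" by (metis cis_conv_exp cis_pi_half)
    moreover have "exp (complex_of_real (ln r)) = of_real r" by (simp only: exp_of_real exp_ln[OF r(1)])
    ultimately show ?thesis by (simp only: z_def l_def exp_add)
  qed
  have "Im l > 0" "Im l < pi" using w by (auto simp: l_def)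
  then have Lnz: "Ln z = l" unfolding zl by (intro Ln_exp) auto
  have cz: "csqrt z = exp (l / 2)" using Lnz zl by (simp add: csqrt_exp_Ln)
  have ci: "csqrt \<i> = exp (\<i> * of_real (pi / 4))"
  proof -
    have "Ln (exp (\<i> * of_real (pi / 2))) = \<i> * of_real (pi / 2)" by (intro Ln_exp) auto
    moreover have "exp (\<i> * of_real (pi / 2)) = \<i>" by (metis cis_conv_exp cis_pi_half)
    ultimately have "Ln \<i> = \<i> * of_real (pi / 2)" by (simp only:)
    then have "csqrt \<i> = exp (\<i> * of_real (pi / 2) / 2)" by (metis csqrt_exp_Ln complex_i_not_zero)
    also have "\<i> * of_real (pi / 2) / 2 = \<i> * complex_of_real (pi / 4)" by simp
    finally show ?thesis .
  qed
  have expn: "exp x powi m = exp (of_int m * x)" for x :: complex and m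
    by (rule exp_power_int)
  have pre: "half_power \<i> n * of_real (real M powr (- real k / 2 - 1 / 4)) * half_power z (- n) = exp (- of_real \<kappa> * w)"
  proof -
    have "real M = exp (- 2 * ln r)"
      using M by (simp add: r_def ln_div ln_sqrt)
    then have "real M powr (- real k / 2 - 1 / 4) = exp (- 2 * ln r) powr (- real k / 2 - 1 / 4)"
      by (simp only:)
    also have "\<dots> = exp ((- real k / 2 - 1 / 4) * (- 2 * ln r))" by (simp add: powr_def)
    also have "(- real k / 2 - 1 / 4) * (- 2 * ln r) = \<kappa> * ln r" by (simp add: \<kappa>_def algebra_simps)
    finally have "half_power \<i> n * of_real (real M powr (- real k / 2 - 1 / 4)) * half_power z (- n)
       = exp (of_int n * (\<i> * of_real (pi / 4))) * exp (of_real (\<kappa> * ln r)) * exp (of_int (- n) * (l / 2))"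
      by (simp only: half_power_def cz ci expn exp_of_real)
    also have "\<dots> = exp (of_int n * (\<i> * of_real (pi / 4)) + of_real (\<kappa> * ln r) + of_int (- n) * (l / 2))"
      by (simp only: exp_add)
    also have "of_int n * (\<i> * of_real (pi / 4)) + of_real (\<kappa> * ln r) + of_int (- n) * (l / 2) = - of_real \<kappa> * w"
    proof -
      have nk: "of_int n = 2 * complex_of_real \<kappa>" "of_int (- n) = - (2 * complex_of_real \<kappa>)"
        by (simp_all add: n_def \<kappa>_def)
      show ?thesis unfolding nk l_def by (simp add: field_simps)
    qed
    finally show ?thesis .
  qed
  have arg: "- 1 / (of_nat M * z) = \<i> * of_real r * exp (- w)"
  proof -
    have "of_nat M * (of_real r * of_real r) = (1 :: complex)"
      using r(2) M by (simp add: power2_eq_square flip: of_real_mult)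
    have "(\<i> * of_real r * exp (- w)) * (of_nat M * z) = (\<i> * \<i>) * (of_nat M * (of_real r * of_real r)) * (exp (- w) * exp w)"
      by (simp only: z_def mult_ac)
    also have "\<dots> = - 1" by (simp add: exp_minus \<open>of_nat M * (of_real r * of_real r) = (1 :: complex)\<close>)
    finally have "(\<i> * of_real r * exp (- w)) * (of_nat M * z) = - 1" .
    moreover have "of_nat M * z \<noteq> 0" using M by (simp add: zl)
    ultimately show ?thesis by (simp add: field_simps)
  qed
  have e: "- 2 * int k - 1 = - n" by (simp add: n_def)
  have "fricke k M f z = exp (- of_real \<kappa> * w) * f (\<i> * of_real r * exp (- w))"
    unfolding fricke_def e arg n_def[symmetric] pre ..
  then have "ray r (fricke k M f) \<kappa> w = f (\<i> * of_real r * exp (- w)) * (exp (- of_real \<kappa> * w) * exp (of_real (\<kappa> / 2) * w))"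
    by (simp add: ray_def z_def)
  also have "exp (- of_real \<kappa> * w) * exp (of_real (\<kappa> / 2) * w) = exp (of_real (\<kappa> / 2) * (- w))"
    by (simp add: exp_add[symmetric] field_simps)
  finally show ?thesis by (simp add: ray_def)
qed

section \<open>Zeros on the critical line\<close>

lemma strip_function_add:
  assumes "strip_function \<phi> \<kappa>" "strip_function \<psi> \<kappa>"
  shows "strip_function (\<lambda>w. \<phi> w + e * \<psi> w) \<kappa>"
    "strip_function.laplace (\<lambda>w. \<phi> w + e * \<psi> w) z = strip_function.laplace \<phi> z + e * strip_function.laplace \<psi> z"
proof -
  interpret f: strip_function \<phi> \<kappa> by (rule assms)
  interpret g: strip_function \<psi> \<kappa> by (rule assms)
  show s: "strip_function (\<lambda>w. \<phi> w + e * \<psi> w) \<kappa>"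
  proof
    show "(\<lambda>w. \<phi> w + e * \<psi> w) holomorphic_on {w. \<bar>Im w\<bar> < pi / 2}"
      by (intro holomorphic_intros f.holo g.holo)
    fix B :: real
    obtain C where C: "\<And>u \<theta> m. \<bar>\<theta>\<bar> < pi / 2 \<Longrightarrow> 0 \<le> m \<Longrightarrow> m \<le> B \<Longrightarrow>
      norm (\<phi> (Complex u \<theta>)) \<le> C * cos \<theta> powr (- \<kappa> / 2 - m) * exp (- m * \<bar>u\<bar>)"
      using f.decay[of B] by blast
    obtain D where D: "\<And>u \<theta> m. \<bar>\<theta>\<bar> < pi / 2 \<Longrightarrow> 0 \<le> m \<Longrightarrow> m \<le> B \<Longrightarrow>
      norm (\<psi> (Complex u \<theta>)) \<le> D * cos \<theta> powr (- \<kappa> / 2 - m) * exp (- m * \<bar>u\<bar>)"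
      using g.decay[of B] by blast
    show "\<exists>C. \<forall>u \<theta> m. \<bar>\<theta>\<bar> < pi / 2 \<longrightarrow> 0 \<le> m \<longrightarrow> m \<le> B \<longrightarrow>
      norm (\<phi> (Complex u \<theta>) + e * \<psi> (Complex u \<theta>)) \<le> C * cos \<theta> powr (- \<kappa> / 2 - m) * exp (- m * \<bar>u\<bar>)"
    proof (intro exI[of _ "C + norm e * D"] allI impI)
      fix u \<theta> m :: real assume *: "\<bar>\<theta>\<bar> < pi / 2" "0 \<le> m" "m \<le> B"
      let ?x = "cos \<theta> powr (- \<kappa> / 2 - m) * exp (- m * \<bar>u\<bar>)"
      have "norm (\<phi> (Complex u \<theta>) + e * \<psi> (Complex u \<theta>)) \<le> norm (\<phi> (Complex u \<theta>)) + norm e * norm (\<psi> (Complex u \<theta>))"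
        by (metis norm_mult norm_triangle_ineq)
      also have "\<dots> \<le> C * ?x + norm e * (D * ?x)"
        using C[OF *, of u] D[OF *, of u] by (intro add_mono mult_left_mono) (auto simp: mult.assoc)
      finally show "norm (\<phi> (Complex u \<theta>) + e * \<psi> (Complex u \<theta>)) \<le> (C + norm e * D) * cos \<theta> powr (- \<kappa> / 2 - m) * exp (- m * \<bar>u\<bar>)"
        by (simp add: algebra_simps)
    qed
  qed
  have i: "integrable lborel (\<lambda>u. \<phi> (of_real u) * exp (z * of_real u))" "integrable lborel (\<lambda>u. \<psi> (of_real u) * exp (z * of_real u))"
    using f.integrable_strip[of 0 z] g.integrable_strip[of 0 z] by (simp_all add: complex_of_real_def)
  show "strip_function.laplace (\<lambda>w. \<phi> w + e * \<psi> w) z = f.laplace z + e * g.laplace z"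
    unfolding strip_function.laplace_def[OF s] f.laplace_def g.laplace_def
    using i by (simp add: distrib_right mult.assoc)
qed

lemma cnj_eq_multiple_cases:
  assumes "cnj z = \<tau> * z" "\<tau> \<in> {1, -1}"
  shows "z = (if \<tau> = 1 then of_real (Re z) else \<i> * of_real (Im z))"
  using assms by (auto simp: complex_eq_iff)

(* \<epsilon> is the choice of sign in L(s,f) +- L(s,f|W_4N). The order of a zero, hence the count, only
   makes sense if this function does not vanish identically (it does vanish for one choice of sign
   when f is an eigenfunction of W_4N); this is what nonzero says. *)
theorem theorem1p2:
  fixes k N :: nat and f :: "complex \<Rightarrow> complex" and \<epsilon> :: complex
  assumes k: "k \<ge> 1"
    and N: "N > 0" "is_square N"
    and f: "f \<in> cusp_forms_half k (4 * N)"
    and coeffs: "(\<forall>n\<ge>1. Im (fourier_coeff f n) = 0) \<or> (\<forall>n\<ge>1. Re (fourier_coeff f n) = 0)"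
    and sign: "\<epsilon> \<in> {1, -1}"
    and nonzero: "\<exists>s. L_function f s + \<epsilon> * L_function (fricke k (4 * N) f) s \<noteq> 0"
  shows "\<exists>d::real. d > 0 \<and>
    Liminf at_top (\<lambda>T::real. ereal (real (odd_zero_count
        (\<lambda>s. L_function f s + \<epsilon> * L_function (fricke k (4 * N) f) s)
        (real k / 2 + 1 / 4) T) / T)) > ereal d"
proof -
  define M where "M = 4 * N"
  have M: "M > 0" using N by (simp add: M_def)
  note f = f[folded M_def]
  define q where "q = fricke k M f"
  define \<kappa> where "\<kappa> = real k + 1 / 2"
  have \<kappa>: "\<kappa> \<ge> 1" "\<kappa> / 2 = real k / 2 + 1 / 4" using k by (auto simp: \<kappa>_def field_simps)
  define r where "r = 1 / sqrt (real M)"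
  have r: "0 < r" "r \<le> 1" using M by (auto simp: r_def)
  obtain C where C: "\<And>z. Im z > 0 \<Longrightarrow> norm (f z) \<le> C * Im z powr (- (\<kappa> / 2))"
    using cusp_form_bound[OF f M] unfolding \<kappa>(2) by blast
  have fh: "f holomorphic_on upper_half_plane" using f by (simp add: cusp_forms_half_def)
  note fper = cusp_form_periodic[OF f]
  have qh: "q holomorphic_on upper_half_plane" unfolding q_def by (rule fricke_holomorphic[OF f M])
  have qper: "q (z + 1) = q z" if "Im z > 0" for z unfolding q_def by (rule fricke_periodic[OF f M that])
  have qC: "norm (q z) \<le> C * Im z powr (- (\<kappa> / 2))" if "Im z > 0" for z
    using C that unfolding q_def \<kappa>(2) by (intro fricke_bound M) auto
  have qr: "ray r q \<kappa> w = ray r f \<kappa> (- w)" if "\<bar>Im w\<bar> < pi / 2" for w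
    unfolding q_def r_def \<kappa>_def by (rule ray_fricke[OF M that])
  interpret sf: strip_function "ray r f \<kappa>" \<kappa>
    by (rule strip_function_ray[OF r _ fh fper C qh qper qC]) (use \<kappa> qr in auto)
  interpret sq: strip_function "ray r q \<kappa>" \<kappa>
    by (rule strip_function_ray[OF r _ qh qper qC fh fper C]) (use \<kappa> qr in auto)
  have ray_real: "ray r p \<kappa> (of_real u) = p (\<i> * of_real (r * exp u)) * exp (of_real (\<kappa> / 2 * u))" for p u
    by (simp add: ray_def exp_of_real[symmetric] mult.assoc del: exp_of_real)
  obtain a where a: "a 0 = 0" "\<And>z. Im z > 0 \<Longrightarrow> (\<lambda>n. a n * exp (2 * of_real pi * \<i> * of_nat n * z)) sums f z"
    "\<And>n. norm (a n) \<le> C * exp (2 * pi) * real n powr (\<kappa> / 2)"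
    using fourier_expansion[OF fh fper C] \<kappa>(1) by auto
  obtain b where b: "b 0 = 0" "\<And>z. Im z > 0 \<Longrightarrow> (\<lambda>n. b n * exp (2 * of_real pi * \<i> * of_nat n * z)) sums q z"
    "\<And>n. norm (b n) \<le> C * exp (2 * pi) * real n powr (\<kappa> / 2)"
    using fourier_expansion[OF qh qper qC] \<kappa>(1) by auto
  have fa: "fourier_coeff f = a" by (rule fourier_coeff_eqI[OF a(1,2)])
  have qb: "fourier_coeff q = b" by (rule fourier_coeff_eqI[OF b(1,2)])
  define \<rho> where "\<rho> = 2 * pi * r"
  have \<rho>: "\<rho> > 0" using r by (simp add: \<rho>_def)
  have \<kappa>0: "\<kappa> / 2 > 0" using \<kappa>(1) by simp
  have sumsf: "(\<lambda>n. a (Suc n) * of_nat (Suc n) powr (- s)) sums (of_real \<rho> powr s * rGamma s * sf.laplace (s - of_real (\<kappa> / 2)))"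
    if "Re s > \<kappa> / 2 + 1" for s
    unfolding \<rho>_def by (rule sf.dirichlet_series[OF r(1) \<kappa>0 a(1) _ a(3) ray_real that]) (rule a(2))
  have sumsq: "(\<lambda>n. b (Suc n) * of_nat (Suc n) powr (- s)) sums (of_real \<rho> powr s * rGamma s * sq.laplace (s - of_real (\<kappa> / 2)))"
    if "Re s > \<kappa> / 2 + 1" for s
    unfolding \<rho>_def by (rule sq.dirichlet_series[OF r(1) \<kappa>0 b(1) _ b(3) ray_real that]) (rule b(2))
  have holo: "(\<lambda>s. of_real \<rho> powr s * rGamma s * l (s - of_real (\<kappa> / 2))) holomorphic_on UNIV"
    if "l holomorphic_on UNIV" for l :: "complex \<Rightarrow> complex"
  proof -
    have "(l \<circ> (\<lambda>s. s - of_real (\<kappa> / 2))) holomorphic_on UNIV"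
      by (rule holomorphic_on_compose_gen[OF _ that]) (auto intro!: holomorphic_intros)
    then show ?thesis unfolding o_def using \<rho> by (intro holomorphic_intros) auto
  qed
  \<comment> \<open>The right-hand side is entire because 1/Gamma and the transform are, so it is
    the continuation of the series.\<close>
  have Lf: "L_function f = (\<lambda>s. of_real \<rho> powr s * rGamma s * sf.laplace (s - of_real (\<kappa> / 2)))"
    by (rule L_function_eqI[OF holo[OF sf.laplace_entire]]) (unfold fa, rule sumsf)
  have Lq: "L_function q = (\<lambda>s. of_real \<rho> powr s * rGamma s * sq.laplace (s - of_real (\<kappa> / 2)))"
    by (rule L_function_eqI[OF holo[OF sq.laplace_entire]]) (unfold qb, rule sumsq)
  define F where "F s = L_function f s + \<epsilon> * L_function q s" for s
  define \<phi> where "\<phi> w = ray r f \<kappa> w + \<epsilon> * ray r q \<kappa> w" for w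
  interpret sg: strip_function \<phi> \<kappa>
    unfolding \<phi>_def[abs_def] by (rule strip_function_add(1)) (rule sf.strip_function_axioms sq.strip_function_axioms)+
  have lap: "sg.laplace z = sf.laplace z + \<epsilon> * sq.laplace z" for z
    unfolding \<phi>_def[abs_def] by (rule strip_function_add(2)) (rule sf.strip_function_axioms sq.strip_function_axioms)+
  have eps: "\<epsilon> * \<epsilon> = 1" "cnj \<epsilon> = \<epsilon>" using sign by auto
  \<comment> \<open>Reflection exchanges the two summands, and \<epsilon> squared is 1.\<close>
  have even: "\<phi> (of_real (- u)) = \<epsilon> * \<phi> (of_real u)" for u
    using qr[of "of_real u"] qr[of "of_real (- u)"] pi_gt_zero eps(1)
    by (simp add: \<phi>_def distrib_left mult.assoc[symmetric])
  \<comment> \<open>One sign covers real (1) and purely imaginary (-1) coefficients; at n = 0, where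
    the hypothesis is silent, the coefficient is 0.\<close>
  obtain \<sigma> :: complex where \<sigma>: "\<sigma> \<in> {1, -1}" "\<And>n. cnj (a n) = \<sigma> * a n"
  proof (cases "\<forall>n\<ge>1. Im (fourier_coeff f n) = 0")
    case True
    then have "cnj (a n) = 1 * a n" for n using a(1) by (cases "n = 0") (auto simp: fa complex_eq_iff)
    then show ?thesis using that[of 1] by simp
  next
    case False
    then have "\<forall>n\<ge>1. Re (fourier_coeff f n) = 0" using coeffs by blast
    then have "cnj (a n) = - 1 * a n" for n using a(1) by (cases "n = 0") (auto simp: fa complex_eq_iff)
    then show ?thesis using that[of "- 1"] by simp
  qed
  \<comment> \<open>On the imaginary axis the exponentials in the expansion are real.\<close>
  have fcnj: "cnj (f (\<i> * of_real y)) = \<sigma> * f (\<i> * of_real y)" if "y > 0" for y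
  proof -
    have e: "2 * of_real pi * \<i> * of_nat n * (\<i> * of_real y) = of_real (- (2 * pi * real n * y))" for n
      by (simp add: algebra_simps)
    have s: "(\<lambda>n. a n * of_real (exp (- (2 * pi * real n * y)))) sums f (\<i> * of_real y)"
      using a(2)[of "\<i> * of_real y"] that unfolding e exp_of_real by simp
    have "cnj (a n * of_real (exp (- (2 * pi * real n * y)))) = \<sigma> * (a n * of_real (exp (- (2 * pi * real n * y))))" for n
      by (simp only: complex_cnj_mult complex_cnj_complex_of_real \<sigma>(2) mult.assoc)
    moreover have "(\<lambda>n. cnj (a n * of_real (exp (- (2 * pi * real n * y))))) sums cnj (f (\<i> * of_real y))"
      using s by (simp only: sums_cnj)
    ultimately have "(\<lambda>n. \<sigma> * (a n * of_real (exp (- (2 * pi * real n * y))))) sums cnj (f (\<i> * of_real y))"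
      by (simp only:)
    then show ?thesis using sums_mult[OF s] by (rule sums_unique2)
  qed
  have rayf: "cnj (ray r f \<kappa> (of_real u)) = \<sigma> * ray r f \<kappa> (of_real u)" for u
    unfolding ray_real complex_cnj_mult using fcnj[of "r * exp u"] r by (simp add: exp_cnj)
  have \<phi>cnj: "cnj (\<phi> (of_real u)) = \<sigma> * \<phi> (of_real u)" for u
  proof -
    \<comment> \<open>The values of q on the axis are reflected values of f, so the behaviour of f
      under conjugation carries over to q.\<close>
    have "ray r q \<kappa> (of_real u) = ray r f \<kappa> (of_real (- u))" using qr[of "of_real u"] pi_gt_zero by simp
    then have \<phi>u: "\<phi> (of_real u) = ray r f \<kappa> (of_real u) + \<epsilon> * ray r f \<kappa> (of_real (- u))" by (simp only: \<phi>_def)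
    show ?thesis unfolding \<phi>u complex_cnj_add complex_cnj_mult rayf eps(2) by (simp add: algebra_simps)
  qed
  define \<tau> where "\<tau> = \<sigma> * \<epsilon>"
  have \<tau>: "\<tau> \<in> {1, -1}" using \<sigma>(1) sign by (auto simp: \<tau>_def)
  \<comment> \<open>Conjugation sends t to -t at the cost of \<sigma>, and the substitution u -> -u
    brings t back at the cost of \<epsilon>.\<close>
  have lapcnj: "cnj (sg.laplace (Complex 0 t)) = \<tau> * sg.laplace (Complex 0 t)" for t
  proof -
    have "cnj (sg.laplace (Complex 0 t)) = (\<integral>u. cnj (\<phi> (of_real u) * exp (Complex 0 t * of_real u)) \<partial>lborel)"
      unfolding sg.laplace_def by (simp only: Bochner_Integration.integral_cnj)
    also have "\<dots> = (\<integral>u. \<sigma> * \<phi> (of_real u) * exp (Complex 0 t * of_real (- u)) \<partial>lborel)"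
    proof (rule Bochner_Integration.integral_cong[OF refl])
      fix u :: real
      have "cnj (Complex 0 t * of_real u) = Complex 0 t * of_real (- u)" by (simp add: complex_eq_iff)
      then show "cnj (\<phi> (of_real u) * exp (Complex 0 t * of_real u)) = \<sigma> * \<phi> (of_real u) * exp (Complex 0 t * of_real (- u))"
        by (simp only: complex_cnj_mult \<phi>cnj exp_cnj)
    qed
    also have "\<dots> = (\<integral>u. \<sigma> * \<phi> (of_real (- u)) * exp (Complex 0 t * of_real u) \<partial>lborel)"
      using lborel_integral_real_affine[of "-1" "\<lambda>u. \<sigma> * \<phi> (of_real u) * exp (Complex 0 t * of_real (- u))" 0] by simp
    also have "\<dots> = (\<integral>u. \<tau> * (\<phi> (of_real u) * exp (Complex 0 t * of_real u)) \<partial>lborel)"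
      unfolding even \<tau>_def by (simp only: mult.assoc)
    finally show ?thesis unfolding sg.laplace_def by (simp only: integral_mult_right_zero)
  qed
  define \<omega> where "\<omega> = (if \<tau> = 1 then 1 else \<i>)"
  define X where "X t = (if \<tau> = 1 then Re (sg.laplace (Complex 0 t)) else Im (sg.laplace (Complex 0 t)))" for t
  \<comment> \<open>The exponent \<kappa>/2 is that of Hecke's bound; the factor 2 comes from adding
    two coefficients with |\<epsilon>| = 1.\<close>
  interpret hl: hardy_littlewood \<phi> \<kappa> \<rho> "\<kappa> / 2" "2 * (C * exp (2 * pi))" "\<lambda>n. a n + \<epsilon> * b n" \<omega> X F
  proof unfold_locales
    show "\<kappa> \<ge> 1" "\<rho> > 0" "\<kappa> / 2 \<ge> 0" "\<omega> \<noteq> 0" using \<kappa>(1) \<rho> by (auto simp: \<omega>_def)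
    show "F s = of_real \<rho> powr s * rGamma s * sg.laplace (s - of_real (\<kappa> / 2))" for s
      unfolding F_def Lf Lq lap by (simp add: algebra_simps)
    have "norm \<epsilon> = 1" using sign by auto
    then show "norm (a n + \<epsilon> * b n) \<le> 2 * (C * exp (2 * pi)) * real n powr (\<kappa> / 2)" for n
      using norm_triangle_ineq[of "a n" "\<epsilon> * b n"] a(3)[of n] b(3)[of n] by (simp add: norm_mult)
    show "(\<lambda>n. (a (Suc n) + \<epsilon> * b (Suc n)) * of_nat (Suc n) powr (- s)) sums F s" if "Re s > \<kappa> / 2 + 1" for s
      using sums_add[OF sumsf[OF that] sums_mult[OF sumsq[OF that], of \<epsilon>]]
      unfolding F_def Lf Lq by (simp only: distrib_right mult.assoc)
    show "\<exists>s. F s \<noteq> 0" using nonzero unfolding F_def q_def M_def .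
    show "sg.laplace (Complex 0 t) = \<omega> * of_real (X t)" for t
      using cnj_eq_multiple_cases[OF lapcnj \<tau>, of t] by (auto simp: \<omega>_def X_def)
  qed
  show ?thesis
    using hl.odd_zero_count_linear unfolding \<kappa>(2) F_def[abs_def] q_def M_def .
qed

end
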